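(* Let $n\ge 2$, $m\ge 1$, $0<\alpha<1$. For $1\le i,j\le n$ let $a^{ij}\in C^{1,\alpha}_{loc}(\mathbb{R}^n\times\mathbb{R}^m\times\mathbb{R}^{mn})$ be real-valued functions for which there is a constant $\lambda>0$ such that $\sum_{i,j=1}^n a^{ij}(x,p,q)\xi_i\xi_j\ge\lambda|\xi|^2$ for all $(x,p,q)\in\mathbb{R}^n\times\mathbb{R}^m\times\mathbb{R}^{mn}$ and all $\xi\in\mathbb{R}^n$. Let $\phi=(\phi^1,\dots,\phi^m):B_R\times B'_{R'}\times\mathbb{R}^{mn}\to\mathbb{R}^m$ be of class $C^{1,\alpha}_{loc}$. Then for any given $c_0\in B'_{R'}$ and $c_1\in\mathbb{R}^{mn}$, the elliptic quasi-linear system $$\sum_{i,j=1}^n a^{ij}\big(x,u(x),Du(x)\big)\,D_{ij}u^k(x)=\phi^k\big(x,u(x),Du(x)\big)\qquad (1\le k\le m),$$ $$u(0)=c_0,\qquad Du(0)=c_1,$$ has $C^{2,\alpha}$ solutions $u=(u^1,\dots,u^m)$ from $B_R$ to $B'_{R'}$ when $R$ is sufficiently small.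
   Context: $B_R=\{x\in\mathbb{R}^n: |x|\le R\}$ is the closed ball of radius $R$ centered at the origin in $\mathbb{R}^n$ and $B'_{R'}=\{y\in\mathbb{R}^m: |y|\le R'\}$ is the closed ball of radius $R'$ centered at the origin in $\mathbb{R}^m$. $Du(x)\in\mathbb{R}^{mn}$ denotes the collection of all first order partial derivatives $\partial_k u^j(x)$ ($1\le j\le m$, $1\le k\le n$), and $D_{ij}=\partial^2/\partial x_i\partial x_j$. A function is of class $C^{1,\alpha}_{loc}$ if it is $C^1$ and its first order partial derivatives are locally Hölder continuous with exponent $\alpha$. A function on $B_R$ is of class $C^{2,\alpha}$ if its second order partial derivatives exist and are Hölder continuous with exponent $\alpha$ on $B_R$.
   Formalization: The initial value c_0 is taken in the open ball |c_0| < R' instead of the closed ball B'_{R'}, since for |c_0| = R' the claim fails (e.g. n=2, m=1, Laplace equation, R'=1, c_0=1, c_1=(1,0), as u would have an interior maximum at 0). *)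

theory Defs
  imports "HOL-Analysis.Analysis"
begin

(* Derivatives are taken within the domain S, so that they also make sense at the
   boundary points of the closed domains considered here.  On a convex S with nonempty
   interior the derivative within S is unique wherever it exists; in the interior of S
   it is the ordinary derivative.  For S = UNIV this is the ordinary partial derivative. *)
definition partial_in :: "'a::euclidean_space set \<Rightarrow> 'a \<Rightarrow> ('a \<Rightarrow> 'b::real_normed_vector) \<Rightarrow> 'a \<Rightarrow> 'b"
  where "partial_in S b f x = frechet_derivative f (at x within S) b"

definition holder_on :: "real \<Rightarrow> 'a::metric_space set \<Rightarrow> ('a \<Rightarrow> 'b::metric_space) \<Rightarrow> bool"
  where "holder_on \<alpha> S f \<longleftrightarrow> (\<exists>C. \<forall>x\<in>S. \<forall>y\<in>S. dist (f x) (f y) \<le> C * dist x y powr \<alpha>)"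

definition locally_holder_on :: "real \<Rightarrow> 'a::metric_space set \<Rightarrow> ('a \<Rightarrow> 'b::metric_space) \<Rightarrow> bool"
  where "locally_holder_on \<alpha> S f \<longleftrightarrow> (\<forall>x\<in>S. \<exists>e>0. holder_on \<alpha> (S \<inter> ball x e) f)"

(* On a product such as (real^'n) \<times> (real^'m) \<times> (real^'n^'m), Basis is the set of all
   coordinate directions in each of the three groups of variables x, p, q. *)
definition C1_holder_loc_on ::
    "real \<Rightarrow> 'a::euclidean_space set \<Rightarrow> ('a \<Rightarrow> 'b::real_normed_vector) \<Rightarrow> bool"
  where "C1_holder_loc_on \<alpha> S f \<longleftrightarrow>
    f differentiable_on S \<and>
    (\<forall>b\<in>Basis. continuous_on S (partial_in S b f) \<and> locally_holder_on \<alpha> S (partial_in S b f))"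

definition D1 :: "(real^'n) set \<Rightarrow> 'n \<Rightarrow> (real^'n \<Rightarrow> real) \<Rightarrow> real^'n \<Rightarrow> real"
  where "D1 S k f = partial_in S (axis k 1) f"

definition D2 :: "(real^'n) set \<Rightarrow> 'n \<Rightarrow> 'n \<Rightarrow> (real^'n \<Rightarrow> real) \<Rightarrow> real^'n \<Rightarrow> real"
  where "D2 S i j f = D1 S i (D1 S j f)"

(* The collection of all first order partial derivatives: the entry in row j and
   column k is the k-th partial derivative of the j-th component. *)
definition Du :: "(real^'n) set \<Rightarrow> (real^'n \<Rightarrow> real^'m) \<Rightarrow> real^'n \<Rightarrow> real^'n^'m"
  where "Du S u x = (\<chi> j k. D1 S k (\<lambda>y. u y $ j) x)"

definition C2_holder_on :: "real \<Rightarrow> (real^'n) set \<Rightarrow> (real^'n \<Rightarrow> real^'m) \<Rightarrow> bool"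
  where "C2_holder_on \<alpha> S u \<longleftrightarrow>
    (\<forall>l. (\<lambda>y. u y $ l) differentiable_on S \<and>
         (\<forall>j. D1 S j (\<lambda>y. u y $ l) differentiable_on S) \<and>
         (\<forall>i j. holder_on \<alpha> S (D2 S i j (\<lambda>y. u y $ l))))"

end

(* Freeze the leading coefficients at the initial data z0 = (0, c0, c1) and put
   L = sum a^{ij}(z0) D_ij. The solution is sought as u = P + N f, where P is a quadratic polynomial
   with the prescribed initial data and L P = phi(z0), N is an approximate inverse of L whose values
   vanish to second order at 0, and f, the new unknown, satisfies f(0) = 0.

   N is built without singular integrals. With S the symmetric part of a(z0) and
   Q(y) = y . S^{-1} y, the kernel kappa = int_1^2 s^{1-n} (1 - Q/s^2)_+^4 ds satisfies
   L kappa (y) = 2^{-n} eta(y/2) - eta(y) for a nonnegative bump eta, so the images under L of the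
   terms of - sum_k 4^{-k} int f(x + 2^{-k} y) kappa(y) dy telescope, and the sum is
   c f(x) - int f(x + 2 y) eta(y) dy with a Lipschitz error term. As second derivatives of kappa have
   mean zero, those of the k-th term vary by at most a multiple of
   2^{-k alpha} min(1, 2^k |x - x'|), and summing over k gives |x - x'|^alpha.

   On the ball of radius R all perturbation terms are O(R^{1 - alpha}) in the C^alpha seminorm, and
   f |-> a(x, u, Du) is Lipschitz in this seminorm because a is C^{1,alpha}; so for small R Picard
   iteration converges. A solution on one ball restricts to all smaller balls. *)
theory Submission
  imports Defs
begin

section \<open>A telescoping kernel\<close>

text \<open>On the other hand no boundary values are prescribed: a right-hand side on the small ball
  may be extended to the whole space in any way, and any quadratic polynomial may be subtracted from
  the result. Such a polynomial changes L N f only by a constant, which is why the error of N is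
  estimated in terms of differences of values; at 0 both L N f and f vanish, and this fixes the
  constant. Vanishing at 0 also makes the Hoelder seminorm a norm that controls the sup norm. The
  integral over s comes from reading the telescoping identity backwards. With eta = 8 (1 - Q)_+^3,
  the function 2^{-n} eta(y/2) - eta(y) is the integral over [1,2] of d/ds (s^{-n} eta(y/s)), and
  this derivative is L applied to s^{1-n} (1 - Q/s^2)_+^4. The power 4 is such that a Lipschitz
  kernel is left after two derivatives.\<close>

lemma has_real_derivative_max_power:
  "((\<lambda>x::real. (max 0 x) ^ Suc (Suc p)) has_real_derivative (real (Suc (Suc p)) * (max 0 x) ^ Suc p)) (at x)"
proof (cases "x = 0")
  case False
  then consider "x > 0" | "x < 0" by linarith
  then show ?thesis
  proof cases
    case 1
    have "((\<lambda>x::real. x ^ Suc (Suc p)) has_real_derivative (real (Suc (Suc p)) * x ^ Suc p)) (at x)"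
      by (rule derivative_eq_intros | simp)+
    moreover have "eventually (\<lambda>y. y ^ Suc (Suc p) = (max 0 y) ^ Suc (Suc p)) (nhds x)"
      using eventually_nhds_in_open[of "{0<..}" x] 1 by (auto elim!: eventually_mono)
    ultimately show ?thesis
      using 1 by (subst DERIV_cong_ev[OF refl _ refl, symmetric]) (auto simp: max_def)
  next
    case 2
    have "eventually (\<lambda>y. (0::real) = (max 0 y) ^ Suc (Suc p)) (nhds x)"
      using eventually_nhds_in_open[of "{..<0}" x] 2 by (auto elim!: eventually_mono simp: max_def)
    then have "((\<lambda>x::real. (max 0 x) ^ Suc (Suc p)) has_real_derivative 0) (at x)"
      by (subst DERIV_cong_ev[OF refl _ refl, of _ "\<lambda>_. 0"]) (auto elim: eventually_mono)
    then show ?thesis using 2 by (simp add: max_def)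
  qed
next
  case True
  have "((\<lambda>h. (max 0 h) ^ Suc (Suc p) / h) \<longlongrightarrow> 0) (at (0::real))"
  proof (rule Lim_null_comparison)
    show "\<forall>\<^sub>F h in at (0::real). norm ((max 0 h) ^ Suc (Suc p) / h) \<le> \<bar>h\<bar> ^ Suc p"
    proof (intro always_eventually allI)
      fix h :: real
      show "norm ((max 0 h) ^ Suc (Suc p) / h) \<le> \<bar>h\<bar> ^ Suc p"
        by (cases "h > 0") (simp_all add: max_def abs_if mult_nonneg_nonneg mult_nonpos_nonneg)
    qed
    show "((\<lambda>h. \<bar>h\<bar> ^ Suc p) \<longlongrightarrow> 0) (at (0::real))"
      by (rule tendsto_eq_rhs[OF tendsto_power[OF tendsto_rabs[OF tendsto_ident_at]]]) simp
  qed
  then show ?thesis using True by (simp add: DERIV_def)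
qed

text \<open>As a function of Q(y), the average of (1 - Q)_+^p over the dilations y/s, 1 \<le> s
  \<le> 2, with weight s^{-w}. The kernel kappa is the case w = n - 1, p = 4.\<close>

definition profile :: "nat \<Rightarrow> nat \<Rightarrow> real \<Rightarrow> real"
  where "profile w p t = integral (cbox 1 2) (\<lambda>s. (max 0 (1 - t / s\<^sup>2)) ^ p / s ^ w)"

lemma profile_integrable:
  "(\<lambda>s::real. (max 0 (1 - t / s\<^sup>2)) ^ p / s ^ w) integrable_on cbox 1 2"
  by (intro integrable_continuous) (auto intro!: continuous_intros)

text \<open>Two indices are carried because each derivative lowers the power by one and contributes
  s^{-2} to the weight, so the family is closed under differentiation.\<close>

lemma has_real_derivative_profile:
  "(profile w (Suc (Suc p)) has_real_derivative - real (Suc (Suc p)) * profile (w + 2) (Suc p) t) (at t)"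
proof -
  have "((\<lambda>t. integral (cbox 1 2) (\<lambda>s::real. (max 0 (1 - t / s\<^sup>2)) ^ Suc (Suc p) / s ^ w))
      has_field_derivative integral (cbox 1 2) (\<lambda>s. - real (Suc (Suc p)) * ((max 0 (1 - t / s\<^sup>2)) ^ Suc p / s ^ (w + 2))))
      (at t within UNIV)"
  proof (rule leibniz_rule_field_derivative)
    fix t s :: real assume "s \<in> cbox 1 2"
    then have s: "s > 0" by auto
    have "((\<lambda>t. 1 - t / s\<^sup>2) has_real_derivative (- 1 / s\<^sup>2)) (at t)"
      using s by (auto intro!: derivative_eq_intros simp: divide_simps)
    from DERIV_chain2[OF has_real_derivative_max_power this, of p]
    have "((\<lambda>t. (max 0 (1 - t / s\<^sup>2)) ^ Suc (Suc p)) has_real_derivative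
        real (Suc (Suc p)) * (max 0 (1 - t / s\<^sup>2)) ^ Suc p * (- 1 / s\<^sup>2)) (at t)" .
    from DERIV_cdivide[OF this, of "s ^ w"]
    show "((\<lambda>t. (max 0 (1 - t / s\<^sup>2)) ^ Suc (Suc p) / s ^ w) has_field_derivative
        - real (Suc (Suc p)) * ((max 0 (1 - t / s\<^sup>2)) ^ Suc p / s ^ (w + 2))) (at t within UNIV)"
      by (rule DERIV_cong) (use s in \<open>simp add: field_simps power_add power2_eq_square\<close>)
  next
    show "continuous_on (UNIV \<times> cbox 1 2)
      (\<lambda>(t, s::real). - real (Suc (Suc p)) * ((max 0 (1 - t / s\<^sup>2)) ^ Suc p / s ^ (w + 2)))"
      by (auto simp: split_beta intro!: continuous_intros)
    next
    show "(\<lambda>s::real. (max 0 (1 - t / s\<^sup>2)) ^ Suc (Suc p) / s ^ w) integrable_on cbox 1 2" for t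
      by (rule profile_integrable)
  qed simp_all
  then show ?thesis
    unfolding profile_def[abs_def] by (simp only: integral_mult_right)
qed

lemma profile_eq_0: "t \<ge> 4 \<Longrightarrow> p > 0 \<Longrightarrow> profile w p t = 0"
proof -
  assume t: "t \<ge> 4" and p: "p > 0"
  have "profile w p t = integral (cbox 1 2) (\<lambda>s::real. 0)"
    unfolding profile_def
  proof (rule integral_cong)
    fix s :: real assume "s \<in> cbox 1 2"
    then have s: "1 \<le> s" "s \<le> 2" by auto
    then have "s\<^sup>2 \<le> 2\<^sup>2" by (intro power_mono) auto
    then have "1 - t / s\<^sup>2 \<le> 0" using t s by (simp add: field_simps)
    then show "(max 0 (1 - t / s\<^sup>2)) ^ p / s ^ w = 0" using p by (simp add: max_def)
  qed
  then show ?thesis by simp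
qed

lemma profile_bounds:
  assumes "t \<ge> 0" shows "0 \<le> profile w p t" "profile w p t \<le> 1"
proof -
  have b: "0 \<le> (max 0 (1 - t / s\<^sup>2)) ^ p / s ^ w" "(max 0 (1 - t / s\<^sup>2)) ^ p / s ^ w \<le> 1"
    if "s \<in> cbox 1 2" for s :: real
  proof -
    have s: "s \<ge> 1" using that by auto
    then have "(max 0 (1 - t / s\<^sup>2)) ^ p \<le> 1" using assms by (intro power_le_one) auto
    moreover have "s ^ w \<ge> 1" using s by (rule one_le_power)
    ultimately show "(max 0 (1 - t / s\<^sup>2)) ^ p / s ^ w \<le> 1" by (simp add: divide_simps)
    show "0 \<le> (max 0 (1 - t / s\<^sup>2)) ^ p / s ^ w" using s by simp
  qed
  show "0 \<le> profile w p t" unfolding profile_def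
    by (rule integral_nonneg[OF profile_integrable]) (use b in auto)
  have "profile w p t \<le> integral (cbox 1 2) (\<lambda>s::real. 1)" unfolding profile_def
    by (rule integral_le[OF profile_integrable]) (use b in auto)
  then show "profile w p t \<le> 1" by simp
qed

(* The integrand is the s-derivative of 8 s^(-n) (1 - t/s^2)_+^3, with n = m + 1. *)
lemma profile_ode:
  "48 * t * profile (m + 4) 2 t - 8 * real (Suc m) * profile (m + 2) 3 t
   = 8 * (max 0 (1 - t / 4)) ^ 3 / 2 ^ Suc m - 8 * (max 0 (1 - t)) ^ 3"
proof -
  have I1: "((\<lambda>s. 48 * t * ((max 0 (1 - t / s\<^sup>2)) ^ 2 / s ^ (m + 4))
        - 8 * real (Suc m) * ((max 0 (1 - t / s\<^sup>2)) ^ 3 / s ^ (m + 2))) has_integral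
      (8 * (max 0 (1 - t / 2\<^sup>2)) ^ 3 / 2 ^ Suc m - 8 * (max 0 (1 - t / 1\<^sup>2)) ^ 3 / 1 ^ Suc m)) {1..2}"
  proof (rule fundamental_theorem_of_calculus)
    fix s :: real assume "s \<in> {1..2}"
    then have s: "s > 0" by auto
    have d1: "((\<lambda>s. 1 - t / s\<^sup>2) has_real_derivative (2 * t / s ^ 3)) (at s)"
      using s by (auto intro!: derivative_eq_intros simp: field_simps power2_eq_square power3_eq_cube)
    from DERIV_chain2[OF has_real_derivative_max_power d1, of 1]
    have d2: "((\<lambda>s. (max 0 (1 - t / s\<^sup>2)) ^ 3) has_real_derivative
        3 * (max 0 (1 - t / s\<^sup>2)) ^ 2 * (2 * t / s ^ 3)) (at s)" by (simp add: numeral_eq_Suc)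
    have d3: "((\<lambda>s. s ^ Suc m) has_real_derivative (real (Suc m) * s ^ m)) (at s)"
      by (rule derivative_eq_intros | simp)+
    have "((\<lambda>s. 8 * (max 0 (1 - t / s\<^sup>2)) ^ 3 / s ^ Suc m) has_real_derivative
        (48 * t * ((max 0 (1 - t / s\<^sup>2)) ^ 2 / s ^ (m + 4))
        - 8 * real (Suc m) * ((max 0 (1 - t / s\<^sup>2)) ^ 3 / s ^ (m + 2)))) (at s)"
      by (rule DERIV_cong[OF DERIV_divide[OF DERIV_cmult[OF d2, of 8] d3]])
        (use s in \<open>simp_all add: divide_simps power_add power2_eq_square power3_eq_cube numeral_eq_Suc, algebra\<close>)
    then show "((\<lambda>s. 8 * (max 0 (1 - t / s\<^sup>2)) ^ 3 / s ^ Suc m) has_vector_derivative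
        (48 * t * ((max 0 (1 - t / s\<^sup>2)) ^ 2 / s ^ (m + 4))
        - 8 * real (Suc m) * ((max 0 (1 - t / s\<^sup>2)) ^ 3 / s ^ (m + 2)))) (at s within {1..2})"
      by (simp add: has_real_derivative_iff_has_vector_derivative[symmetric] has_field_derivative_at_within)
  qed simp
  have I2: "((\<lambda>s. 48 * t * ((max 0 (1 - t / s\<^sup>2)) ^ 2 / s ^ (m + 4))
        - 8 * real (Suc m) * ((max 0 (1 - t / s\<^sup>2)) ^ 3 / s ^ (m + 2))) has_integral
      (48 * t * profile (m + 4) 2 t - 8 * real (Suc m) * profile (m + 2) 3 t)) {1..2}"
    unfolding profile_def cbox_interval[symmetric]
    by (rule has_integral_diff[OF has_integral_mult_right has_integral_mult_right]; rule integrable_integral[OF profile_integrable])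
  from has_integral_unique[OF I2 I1] show ?thesis by simp
qed

section \<open>Inverse of a positive definite matrix\<close>

text \<open>The lower bound comes from ellipticity at x = A y, where x . S x = A y . y, together
  with |y| \<le> N |A y|; this gives the constant lam / N^2. The matrix A defines the quadratic form
  Q.\<close>

lemma positive_definite_inverse:
  fixes S :: "real^'n^'n"
  assumes sym: "transpose S = S" and "lam > 0"
    and pos: "\<And>x. x \<bullet> (S *v x) \<ge> lam * (norm x)\<^sup>2"
  obtains A :: "real^'n^'n" and c where
    "transpose A = A" "S ** A = mat 1" "c > 0" "\<And>y. y \<bullet> (A *v y) \<ge> c * (norm y)\<^sup>2"
proof -
  have "x = 0" if "S *v x = 0" for x
  proof -
    have "lam * (norm x)\<^sup>2 \<le> 0" using pos[of x] that by simp
    then show ?thesis using \<open>lam > 0\<close> by (simp add: mult_le_0_iff)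
  qed
  then obtain A where A: "A ** S = mat 1" using matrix_left_invertible_ker[of S] by auto
  then have A': "S ** A = mat 1" using matrix_left_right_inverse by blast
  have "transpose A ** S = mat 1"
    using arg_cong[OF A', of transpose] by (simp add: matrix_transpose_mul sym)
  then have "transpose A = transpose A ** S ** A"
    by (metis A' matrix_mul_assoc matrix_mul_rid)
  also have "\<dots> = A" using \<open>transpose A ** S = mat 1\<close> by simp
  finally have symA: "transpose A = A" .
  obtain N where N: "N > 0" "\<And>x. norm (S *v x) \<le> norm x * N"
    using bounded_linear.pos_bounded[OF matrix_vector_mul_bounded_linear] by metis
  have "y \<bullet> (A *v y) \<ge> lam / N\<^sup>2 * (norm y)\<^sup>2" for y
  proof -
    have y: "S *v (A *v y) = y" using A' by (simp add: matrix_vector_mul_assoc)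
    have "norm y \<le> norm (A *v y) * N" using N(2)[of "A *v y"] y by simp
    then have "(norm y)\<^sup>2 \<le> (norm (A *v y) * N)\<^sup>2" by (intro power_mono) auto
    then have "(norm y)\<^sup>2 / N\<^sup>2 \<le> (norm (A *v y))\<^sup>2" using N(1) by (simp add: field_simps)
    then have "lam * ((norm y)\<^sup>2 / N\<^sup>2) \<le> lam * (norm (A *v y))\<^sup>2"
      using \<open>lam > 0\<close> by (intro mult_left_mono) auto
    also have "\<dots> \<le> (A *v y) \<bullet> y" using pos[of "A *v y"] y by simp
    finally show ?thesis by (simp add: inner_commute)
  qed
  then show thesis using that[OF symA A', of "lam / N\<^sup>2"] N(1) \<open>lam > 0\<close> by simp
qed

section \<open>Bounded Lipschitz functions\<close>

text \<open>One constant serves both as sup bound and as Lipschitz constant, so products and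
  compositions stay in the class without separate bookkeeping.\<close>

definition bounded_lipschitz :: "'a::metric_space set \<Rightarrow> ('a \<Rightarrow> real) \<Rightarrow> bool"
  where "bounded_lipschitz S k \<longleftrightarrow>
    (\<exists>B. \<forall>y\<in>S. \<bar>k y\<bar> \<le> B \<and> (\<forall>z\<in>S. \<bar>k y - k z\<bar> \<le> B * dist y z))"

lemma bounded_lipschitz_const: "bounded_lipschitz S (\<lambda>_. c)"
  unfolding bounded_lipschitz_def by (intro exI[of _ "\<bar>c\<bar>"]) auto

lemma bounded_lipschitz_add:
  assumes "bounded_lipschitz S f" "bounded_lipschitz S g"
  shows "bounded_lipschitz S (\<lambda>x. f x + g x)"
proof -
  obtain B C where B: "\<And>y z. y \<in> S \<Longrightarrow> z \<in> S \<Longrightarrow> \<bar>f y\<bar> \<le> B \<and> \<bar>f y - f z\<bar> \<le> B * dist y z"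
    and C: "\<And>y z. y \<in> S \<Longrightarrow> z \<in> S \<Longrightarrow> \<bar>g y\<bar> \<le> C \<and> \<bar>g y - g z\<bar> \<le> C * dist y z"
    using assms unfolding bounded_lipschitz_def by metis
  have "\<bar>f y + g y\<bar> \<le> B + C" "\<bar>(f y + g y) - (f z + g z)\<bar> \<le> (B + C) * dist y z"
    if "y \<in> S" "z \<in> S" for y z
    using B[OF that] C[OF that] by (auto simp: distrib_right)
  then show ?thesis unfolding bounded_lipschitz_def by (intro exI[of _ "B + C"]) blast
qed

lemma bounded_lipschitz_mult:
  assumes "bounded_lipschitz S f" "bounded_lipschitz S g"
  shows "bounded_lipschitz S (\<lambda>x. f x * g x)"
proof -
  obtain B C where B: "\<And>y z. y \<in> S \<Longrightarrow> z \<in> S \<Longrightarrow> \<bar>f y\<bar> \<le> B \<and> \<bar>f y - f z\<bar> \<le> B * dist y z"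
    and C: "\<And>y z. y \<in> S \<Longrightarrow> z \<in> S \<Longrightarrow> \<bar>g y\<bar> \<le> C \<and> \<bar>g y - g z\<bar> \<le> C * dist y z"
    using assms unfolding bounded_lipschitz_def by metis
  \<comment> \<open>The factor 2 is due to the Lipschitz part, where B * C occurs twice; the sup
    bound is weakened to match.\<close>
  have "\<bar>f y * g y\<bar> \<le> 2 * B * C" "\<bar>f y * g y - f z * g z\<bar> \<le> 2 * B * C * dist y z"
    if "y \<in> S" "z \<in> S" for y z
  proof -
    have nn: "0 \<le> B" "0 \<le> C" using B[OF that] C[OF that] by linarith+
    have "\<bar>f y * g y\<bar> \<le> B * C"
      unfolding abs_mult using B[OF that] C[OF that] nn by (intro mult_mono) auto
    then show "\<bar>f y * g y\<bar> \<le> 2 * B * C" using nn mult_nonneg_nonneg[OF nn] by linarith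
    have "\<bar>f y * g y - f z * g z\<bar> = \<bar>f y * (g y - g z) + (f y - f z) * g z\<bar>"
      by (simp add: algebra_simps)
    also have "\<dots> \<le> \<bar>f y\<bar> * \<bar>g y - g z\<bar> + \<bar>f y - f z\<bar> * \<bar>g z\<bar>"
      by (metis abs_mult abs_triangle_ineq)
    also have "\<dots> \<le> B * (C * dist y z) + (B * dist y z) * C"
      using B[OF that] C[OF that] C[OF that(2,1)] nn by (intro add_mono mult_mono) auto
    finally show "\<bar>f y * g y - f z * g z\<bar> \<le> 2 * B * C * dist y z" by (simp add: algebra_simps)
  qed
  then show ?thesis unfolding bounded_lipschitz_def by (intro exI[of _ "2 * B * C"]) blast
qed

lemma bounded_lipschitz_linear:
  assumes "bounded_linear f" "bounded S"
  shows "bounded_lipschitz S (f :: 'a::real_normed_vector \<Rightarrow> real)"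
proof -
  obtain K where K: "K > 0" "\<And>x. norm (f x) \<le> norm x * K"
    using bounded_linear.pos_bounded[OF assms(1)] by metis
  obtain B where B: "B > 0" "\<And>x. x \<in> S \<Longrightarrow> norm x \<le> B" using assms(2) bounded_pos by blast
  have "\<bar>f y\<bar> \<le> K * (B + 1)" "\<bar>f y - f z\<bar> \<le> K * (B + 1) * dist y z" if "y \<in> S" "z \<in> S" for y z
  proof -
    have "norm y * K \<le> (B + 1) * K" using B(2)[OF that(1)] K(1) by (intro mult_right_mono) auto
    then show "\<bar>f y\<bar> \<le> K * (B + 1)" using K(2)[of y] by (simp add: mult.commute)
    have "\<bar>f y - f z\<bar> \<le> dist y z * K"
      using K(2)[of "y - z"] by (simp add: linear_diff[OF bounded_linear.linear[OF assms(1)]] dist_norm)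
    also have "\<dots> \<le> dist y z * (K * (B + 1))" using K(1) B(1) by (intro mult_left_mono) auto
    finally show "\<bar>f y - f z\<bar> \<le> K * (B + 1) * dist y z" by (simp add: mult.commute)
  qed
  then show ?thesis unfolding bounded_lipschitz_def by (intro exI[of _ "K * (B + 1)"]) blast
qed

lemma bounded_lipschitz_sum:
  "finite I \<Longrightarrow> (\<And>i. i \<in> I \<Longrightarrow> bounded_lipschitz S (f i)) \<Longrightarrow> bounded_lipschitz S (\<lambda>x. \<Sum>i\<in>I. f i x)"
  by (induction I rule: finite_induct) (auto intro: bounded_lipschitz_const bounded_lipschitz_add)

lemma bounded_lipschitz_compose:
  assumes "bounded_lipschitz S f" "bounded_lipschitz T g" "f ` S \<subseteq> T"
  shows "bounded_lipschitz S (\<lambda>x. g (f x))"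
proof -
  obtain B C where B: "\<And>y z. y \<in> S \<Longrightarrow> z \<in> S \<Longrightarrow> \<bar>f y - f z\<bar> \<le> B * dist y z"
    and C: "\<And>y z. y \<in> T \<Longrightarrow> z \<in> T \<Longrightarrow> \<bar>g y\<bar> \<le> C \<and> \<bar>g y - g z\<bar> \<le> C * \<bar>y - z\<bar>"
    using assms unfolding bounded_lipschitz_def dist_real_def by metis
  \<comment> \<open>Since |B| + 1 \<ge> 1, this constant dominates both C, the bound of g, and C *
    B, the Lipschitz constant.\<close>
  have "\<bar>g (f y)\<bar> \<le> C * (\<bar>B\<bar> + 1)" "\<bar>g (f y) - g (f z)\<bar> \<le> C * (\<bar>B\<bar> + 1) * dist y z"
    if "y \<in> S" "z \<in> S" for y z
  proof -
    have T: "f y \<in> T" "f z \<in> T" using that assms(3) by auto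
    have C0: "C \<ge> 0" using C[OF T] by linarith
    show "\<bar>g (f y)\<bar> \<le> C * (\<bar>B\<bar> + 1)" using C[OF T] C0 by (simp add: distrib_left add.commute add_increasing2)
    have "B * dist y z \<le> (\<bar>B\<bar> + 1) * dist y z" by (intro mult_right_mono) auto
    then have "\<bar>f y - f z\<bar> \<le> (\<bar>B\<bar> + 1) * dist y z" using B[OF that] by linarith
    then have "C * \<bar>f y - f z\<bar> \<le> C * ((\<bar>B\<bar> + 1) * dist y z)" using C0 by (rule mult_left_mono)
    then show "\<bar>g (f y) - g (f z)\<bar> \<le> C * (\<bar>B\<bar> + 1) * dist y z"
      using C[OF T] by (simp add: mult.assoc)
  qed
  then show ?thesis unfolding bounded_lipschitz_def by (intro exI[of _ "C * (\<bar>B\<bar> + 1)"]) blast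
qed

text \<open>The polynomial factors of the kernels are bounded only on balls. The collar of width 1
  takes care of the outside: a point beyond r + 1 has distance at least 1 from every point where k
  is non-zero, and at such distances the sup bound is a Lipschitz bound.\<close>

lemma bounded_lipschitz_extend_by_zero:
  fixes k :: "'a::real_normed_vector \<Rightarrow> real"
  assumes "bounded_lipschitz (cball 0 (r + 1)) k" "\<And>y. norm y \<ge> r \<Longrightarrow> k y = 0"
  shows "bounded_lipschitz UNIV k"
proof -
  obtain B where B: "\<And>y z. y \<in> cball 0 (r+1) \<Longrightarrow> z \<in> cball 0 (r+1) \<Longrightarrow> \<bar>k y\<bar> \<le> B \<and> \<bar>k y - k z\<bar> \<le> B * dist y z"
    using assms(1) unfolding bounded_lipschitz_def by metis
  have b: "\<bar>k y\<bar> \<le> \<bar>B\<bar>" for y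
    using B[of y y] assms(2)[of y] by (cases "norm y \<le> r + 1") (auto simp: dist_norm)
  have far: "\<bar>k y - k z\<bar> \<le> \<bar>B\<bar> * dist y z" if "norm y \<le> norm z" for y z
  proof (cases "norm z \<le> r + 1")
    case True
    then have "\<bar>k y - k z\<bar> \<le> B * dist y z" using B[of y z] that by auto
    also have "\<dots> \<le> \<bar>B\<bar> * dist y z" by (intro mult_right_mono) auto
    finally show ?thesis .
  next
    case False
    then have kz: "k z = 0" by (intro assms(2)) auto
    show ?thesis
    proof (cases "norm y \<ge> r")
      case True then show ?thesis using kz assms(2)[of y] by simp
    next
      case f: False
      have "dist y z \<ge> 1" using norm_triangle_ineq2[of z y] False f by (auto simp: dist_norm norm_minus_commute)
      then have "\<bar>B\<bar> * 1 \<le> \<bar>B\<bar> * dist y z" by (intro mult_left_mono) auto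
      then show ?thesis using b[of y] kz by simp
    qed
  qed
  have "\<bar>k y - k z\<bar> \<le> \<bar>B\<bar> * dist y z" for y z
    using far[of y z] far[of z y] by (cases "norm y \<le> norm z") (auto simp: dist_commute abs_minus_commute)
  with b show ?thesis unfolding bounded_lipschitz_def by blast
qed

text \<open>The derivative is a multiple of another profile, and profiles are at most 1 for t \<ge>
  0; the exponent \<open>Suc p\<close> \<ge> 2 is what the derivative formula asks for.\<close>

lemma bounded_lipschitz_profile:
  assumes "p > 0" shows "bounded_lipschitz {0..T} (profile w (Suc p))"
proof -
  obtain q where q: "p = Suc q" using assms gr0_implies_Suc by blast
  have "\<bar>profile w (Suc p) y - profile w (Suc p) z\<bar> \<le> (real (Suc p)) * \<bar>y - z\<bar>" if "y \<in> {0..T}" "z \<in> {0..T}" for y z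
  proof -
    have "norm (profile w (Suc p) y - profile w (Suc p) z) \<le> (real (Suc p)) * norm (y - z)"
    proof (rule field_differentiable_bound[of "{0..T}"])
      fix t assume "t \<in> {0..T}"
      show "(profile w (Suc p) has_field_derivative (- real (Suc p) * profile (w + 2) p t)) (at t within {0..T})"
        unfolding q by (rule has_field_derivative_at_within[OF has_real_derivative_profile])
      have "\<bar>profile (w + 2) p t\<bar> \<le> 1" using profile_bounds[of t "w + 2" p] \<open>t \<in> {0..T}\<close> by auto
      then have "real (Suc p) * \<bar>profile (w + 2) p t\<bar> \<le> real (Suc p) * 1" by (intro mult_left_mono) auto
      then show "norm (- real (Suc p) * profile (w + 2) p t) \<le> real (Suc p)"
        by (simp only: abs_mult abs_minus_cancel abs_of_nat real_norm_def mult_1_right)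
    qed (use that in auto)
    then show ?thesis by simp
  qed
  moreover have "\<bar>profile w (Suc p) y\<bar> \<le> real (Suc p)" if "y \<in> {0..T}" for y
    using profile_bounds[of y w "Suc p"] that by auto
  ultimately show ?thesis unfolding bounded_lipschitz_def dist_real_def by blast
qed

(* The identity between K2 and E makes the dyadic sum of rescaled kernels telescope. *)
lemma telescoping_kernel:
  fixes a :: "'n::finite \<Rightarrow> 'n \<Rightarrow> real"
  assumes "lam > 0"
    and pos: "\<And>\<xi> :: real^'n. (\<Sum>i\<in>UNIV. \<Sum>j\<in>UNIV. a i j * \<xi> $ i * \<xi> $ j) \<ge> lam * (norm \<xi>)\<^sup>2"
  obtains K :: "real^'n \<Rightarrow> real" and K1 K2 E r where
    "bounded_lipschitz UNIV K" "\<And>j. bounded_lipschitz UNIV (K1 j)"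
    "\<And>i j. bounded_lipschitz UNIV (K2 i j)" "bounded_lipschitz UNIV E"
    "\<And>y. norm y \<ge> r \<Longrightarrow> K y = 0" "\<And>j y. norm y \<ge> r \<Longrightarrow> K1 j y = 0"
    "\<And>i j y. norm y \<ge> r \<Longrightarrow> K2 i j y = 0" "\<And>y. norm y \<ge> r \<Longrightarrow> E y = 0"
    "\<And>y. (K has_derivative (\<lambda>w. \<Sum>j\<in>UNIV. w $ j * K1 j y)) (at y)"
    "\<And>j y. (K1 j has_derivative (\<lambda>w. \<Sum>i\<in>UNIV. w $ i * K2 i j y)) (at y)"
    "\<And>i j. K2 i j = K2 j i"
    "\<And>y. (\<Sum>i\<in>UNIV. \<Sum>j\<in>UNIV. a i j * K2 i j y) = E ((1/2) *\<^sub>R y) / 2 ^ CARD('n) - E y"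
    "\<And>y. E y \<ge> 0" "E 0 > 0" "r > 0"
proof -
  \<comment> \<open>A Hessian sees only the symmetric part of \<open>a\<close>, and symmetry of the
    matrix is needed for Q to have gradient 2 A y.\<close>
  define S :: "real^'n^'n" where "S = (\<chi> i j. (a i j + a j i) / 2)"
  have symS: "transpose S = S" by (simp add: S_def transpose_def vec_eq_iff)
  have quadS: "(\<Sum>i\<in>UNIV. \<Sum>j\<in>UNIV. S $ i $ j * M i j) = (\<Sum>i\<in>UNIV. \<Sum>j\<in>UNIV. a i j * M i j)"
    if M: "\<And>i j. M i j = M j i" for M
  proof -
    have "(\<Sum>i\<in>UNIV. \<Sum>j\<in>UNIV. a j i * M i j) = (\<Sum>j\<in>UNIV. \<Sum>i\<in>UNIV. a j i * M j i)"
      by (subst sum.swap) (intro sum.cong refl arg_cong2[where f="(*)"] M)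
    then have "(\<Sum>i\<in>UNIV. \<Sum>j\<in>UNIV. a i j * M i j) + (\<Sum>i\<in>UNIV. \<Sum>j\<in>UNIV. a j i * M i j)
       = 2 * (\<Sum>i\<in>UNIV. \<Sum>j\<in>UNIV. a i j * M i j)" by simp
    moreover have "(\<Sum>i\<in>UNIV. \<Sum>j\<in>UNIV. S $ i $ j * M i j) =
       ((\<Sum>i\<in>UNIV. \<Sum>j\<in>UNIV. a i j * M i j) + (\<Sum>i\<in>UNIV. \<Sum>j\<in>UNIV. a j i * M i j)) / 2"
      unfolding S_def by (simp add: sum.distrib[symmetric] sum_divide_distrib distrib_right add_divide_distrib)
    ultimately show ?thesis by simp
  qed
  have "x \<bullet> (S *v x) \<ge> lam * (norm x)\<^sup>2" for x
  proof -
    have "x \<bullet> (S *v x) = (\<Sum>i\<in>UNIV. \<Sum>j\<in>UNIV. S $ i $ j * (x $ i * x $ j))"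
      by (simp add: inner_vec_def matrix_vector_mult_def sum_distrib_left algebra_simps)
    also have "\<dots> = (\<Sum>i\<in>UNIV. \<Sum>j\<in>UNIV. a i j * (x $ i * x $ j))" by (rule quadS) simp
    finally show ?thesis using pos[of x] by (simp add: mult.assoc)
  qed
  from positive_definite_inverse[OF symS \<open>lam > 0\<close> this]
  obtain A :: "real^'n^'n" and c where symA: "transpose A = A" and SA: "S ** A = mat 1"
    and c: "c > 0" "\<And>y. y \<bullet> (A *v y) \<ge> c * (norm y)\<^sup>2" by blast
  define Q where "Q y = y \<bullet> (A *v y)" for y
  \<comment> \<open>Outside this radius Q \<ge> c r^2 = 4, and there all profiles with positive
    exponent vanish because s \<le> 2.\<close>
  define r where "r = 2 / sqrt c"
  have r: "r > 0" using c by (simp add: r_def)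
  have Qr: "Q y \<ge> 4" if "norm y \<ge> r" for y
  proof -
    have "r\<^sup>2 \<le> (norm y)\<^sup>2" using that r by (intro power_mono) auto
    then have "c * r\<^sup>2 \<le> c * (norm y)\<^sup>2" using c(1) by (intro mult_left_mono) auto
    moreover have "c * r\<^sup>2 = 4" using c(1) by (simp add: r_def power_divide)
    ultimately show ?thesis using c(2)[of y] by (simp add: Q_def)
  qed
  have Q0: "Q y \<ge> 0" for y using c(2)[of y] c(1) by (simp add: Q_def order_trans[rotated])
  have symA': "A $ i $ j = A $ j $ i" for i j
    using symA by (metis transpose_def vec_lambda_beta)
  have swap: "v \<bullet> (A *v w) = w \<bullet> (A *v v)" for v w
    by (metis dot_lmul_matrix inner_commute symA transpose_matrix_vector)
  have dA: "((\<lambda>y. (A *v y) $ j) has_derivative (\<lambda>w. \<Sum>i\<in>UNIV. w $ i * A $ j $ i)) (at y)" for j y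
  proof -
    have "bounded_linear (\<lambda>y. (A *v y) $ j)"
      by (rule bounded_linear_compose[OF bounded_linear_vec_nth matrix_vector_mul_bounded_linear])
    from bounded_linear_imp_has_derivative[OF this, of "at y"]
    show ?thesis by (simp add: matrix_vector_mult_def mult.commute)
  qed
  have dQ: "(Q has_derivative (\<lambda>w. \<Sum>j\<in>UNIV. w $ j * (2 * (A *v y) $ j))) (at y)" for y
  proof -
    have "(Q has_derivative (\<lambda>w. y \<bullet> (A *v w) + w \<bullet> (A *v y))) (at y)"
      unfolding Q_def[abs_def]
      by (rule has_derivative_inner[OF has_derivative_ident
        bounded_linear_imp_has_derivative[OF matrix_vector_mul_bounded_linear]])
    moreover have "y \<bullet> (A *v w) + w \<bullet> (A *v y) = (\<Sum>j\<in>UNIV. w $ j * (2 * (A *v y) $ j))" for w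
      unfolding swap[of y w] by (simp add: inner_vec_def sum_distrib_left algebra_simps)
    ultimately show ?thesis by simp
  qed
  obtain m where m: "CARD('n) = Suc m" by (metis zero_less_card_finite gr0_implies_Suc)
  have dP: "((\<lambda>y. profile w (Suc (Suc p)) (Q y)) has_derivative
      (\<lambda>v. \<Sum>j\<in>UNIV. v $ j * (- 2 * real (Suc (Suc p)) * profile (w + 2) (Suc p) (Q y) * (A *v y) $ j))) (at y)"
    for w p y
  proof -
    have "((\<lambda>y. profile w (Suc (Suc p)) (Q y)) has_derivative
      (\<lambda>v. (- real (Suc (Suc p)) * profile (w + 2) (Suc p) (Q y)) * (\<Sum>j\<in>UNIV. v $ j * (2 * (A *v y) $ j)))) (at y)"
      by (rule has_derivative_compose[OF dQ has_real_derivative_profile[unfolded has_field_derivative_def]])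
    then show ?thesis by (rule has_derivative_eq_rhs)
        (intro ext, unfold sum_distrib_left, intro sum.cong refl, simp add: algebra_simps)
  qed
  \<comment> \<open>K is followed by its gradient and Hessian. Each derivative of (1 - Q/s^2)_+^p
    brings out -2 p (A y)_j, whence -8 = -2 * 4 and 48 = (-8) * (-6). The weight exponent n - 1 is
    \<open>m\<close>.\<close>
  define K where "K y = profile m 4 (Q y)" for y
  define K1 where "K1 j y = -8 * (profile (m + 2) 3 (Q y) * (A *v y) $ j)" for j y
  define K2 where "K2 i j y = 48 * (profile (m + 4) 2 (Q y) * ((A *v y) $ i * (A *v y) $ j))
     + (-8) * (profile (m + 2) 3 (Q y) * A $ i $ j)" for i j y
  define E where "E y = 8 * (max 0 (1 - Q y)) ^ 3" for y
  let ?B = "cball (0::real^'n) (r + 1)"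
  have blA: "bounded_lipschitz ?B (\<lambda>y. (A *v y) $ j)" for j
    by (intro bounded_lipschitz_linear bounded_linear_compose[OF bounded_linear_vec_nth matrix_vector_mul_bounded_linear] bounded_cball)
  have blQ: "bounded_lipschitz ?B Q"
    unfolding Q_def[abs_def] inner_vec_def inner_real_def
    by (intro bounded_lipschitz_sum finite bounded_lipschitz_mult blA bounded_lipschitz_linear bounded_linear_vec_nth bounded_cball)
  obtain T where T: "\<And>y. y \<in> ?B \<Longrightarrow> Q y \<le> T"
    using blQ unfolding bounded_lipschitz_def by (metis abs_le_D1)
  have blP: "bounded_lipschitz ?B (\<lambda>y. profile w p (Q y))" if "p \<ge> 2" for w p
  proof -
    have q: "p = Suc (p - 1)" "p - 1 > 0" using that by auto
    have "bounded_lipschitz ?B (\<lambda>y. profile w (Suc (p - 1)) (Q y))"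
      by (rule bounded_lipschitz_compose[OF blQ bounded_lipschitz_profile[OF q(2), of T]]) (use Q0 T in auto)
    then show ?thesis using q(1) by simp
  qed
  have zero: "K y = 0" "K1 j y = 0" "K2 i j y = 0" "E y = 0" if "norm y \<ge> r" for y i j
    using Qr[OF that] by (simp_all add: K_def K1_def K2_def E_def profile_eq_0)
  have "bounded_lipschitz UNIV K"
    by (rule bounded_lipschitz_extend_by_zero[of r]) (auto simp: K_def[abs_def] zero[unfolded K_def] intro!: blP)
  moreover have "bounded_lipschitz UNIV (K1 j)" for j
    by (rule bounded_lipschitz_extend_by_zero[of r])
      (unfold K1_def[abs_def], intro bounded_lipschitz_mult bounded_lipschitz_const blP blA, auto simp: profile_eq_0 Qr)
  moreover have "bounded_lipschitz UNIV (K2 i j)" for i j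
    by (rule bounded_lipschitz_extend_by_zero[of r])
      (unfold K2_def[abs_def], intro bounded_lipschitz_add bounded_lipschitz_mult bounded_lipschitz_const blP blA, auto simp: profile_eq_0 Qr)
  moreover have "bounded_lipschitz UNIV E"
  proof (rule bounded_lipschitz_extend_by_zero[of r])
    have m: "bounded_lipschitz {..1} (\<lambda>t::real. max 0 t)"
      unfolding bounded_lipschitz_def dist_real_def
      by (intro exI[of _ 1]) auto
    have q: "bounded_lipschitz ?B (\<lambda>y. 1 + (-1) * Q y)"
      by (intro bounded_lipschitz_add bounded_lipschitz_mult bounded_lipschitz_const blQ)
    have 1: "bounded_lipschitz ?B (\<lambda>y. max 0 (1 + (-1) * Q y))"
      by (rule bounded_lipschitz_compose[OF q m]) (use Q0 in auto)
    have "bounded_lipschitz ?B (\<lambda>y. 8 * (max 0 (1 + (-1) * Q y) * (max 0 (1 + (-1) * Q y) * max 0 (1 + (-1) * Q y))))"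
      by (intro bounded_lipschitz_mult bounded_lipschitz_const 1)
    then show "bounded_lipschitz ?B E" by (simp add: E_def[abs_def] power3_eq_cube mult.assoc)
  qed (simp add: zero)
  moreover have "(K has_derivative (\<lambda>w. \<Sum>j\<in>UNIV. w $ j * K1 j y)) (at y)" for y
    using dP[of m 2 y] by (simp add: K_def[abs_def] K1_def numeral_eq_Suc mult.assoc)
  moreover have "(K1 j has_derivative (\<lambda>w. \<Sum>i\<in>UNIV. w $ i * K2 i j y)) (at y)" for j y
  proof -
    have "(K1 j has_derivative (\<lambda>v. -8 * (profile (m + 2) 3 (Q y) * (\<Sum>i\<in>UNIV. v $ i * A $ j $ i)
       + (\<Sum>i\<in>UNIV. v $ i * (- 6 * profile (m + 4) 2 (Q y) * (A *v y) $ i)) * (A *v y) $ j))) (at y)"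
      unfolding K1_def[abs_def]
      by (rule has_derivative_mult_right[OF has_derivative_mult[OF _ dA]])
        (use dP[of "m + 2" 1 y] in \<open>simp add: numeral_eq_Suc\<close>)
    then show ?thesis
      by (rule has_derivative_eq_rhs)
        (simp add: fun_eq_iff K2_def symA'[of j] sum_distrib_left sum_distrib_right sum.distrib[symmetric] algebra_simps)
  qed
  moreover have K2sym: "K2 i j = K2 j i" for i j
    by (simp add: K2_def fun_eq_iff symA'[of i j] mult.commute)
  \<comment> \<open>As S is inverse to A, contracting S with the products (A y)_i (A y)_j gives
    Q(y), and contracting it with A gives the trace n of the identity. What remains is
    \<open>profile_ode\<close> at t = Q(y).\<close>
  moreover have "(\<Sum>i\<in>UNIV. \<Sum>j\<in>UNIV. a i j * K2 i j y) = E ((1/2) *\<^sub>R y) / 2 ^ CARD('n) - E y" for y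
  proof -
    have "(\<Sum>i\<in>UNIV. \<Sum>j\<in>UNIV. a i j * K2 i j y) = (\<Sum>i\<in>UNIV. \<Sum>j\<in>UNIV. S $ i $ j * K2 i j y)"
      by (rule quadS[symmetric]) (simp add: K2sym)
    also have "\<dots> = 48 * profile (m + 4) 2 (Q y) * (\<Sum>i\<in>UNIV. \<Sum>j\<in>UNIV. S $ i $ j * ((A *v y) $ i * (A *v y) $ j))
        - 8 * profile (m + 2) 3 (Q y) * (\<Sum>i\<in>UNIV. \<Sum>j\<in>UNIV. S $ i $ j * A $ i $ j)"
      unfolding K2_def by (simp add: sum_distrib_left sum.distrib[symmetric] sum_subtractf[symmetric] algebra_simps)
    also have "(\<Sum>i\<in>UNIV. \<Sum>j\<in>UNIV. S $ i $ j * ((A *v y) $ i * (A *v y) $ j)) = (A *v y) \<bullet> (S *v (A *v y))"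
      by (simp add: inner_vec_def matrix_vector_mult_def[of S] sum_distrib_left algebra_simps)
    also have "\<dots> = Q y" using SA by (simp add: matrix_vector_mul_assoc Q_def inner_commute)
    also have "(\<Sum>i\<in>UNIV. \<Sum>j\<in>UNIV. S $ i $ j * A $ i $ j) = (\<Sum>i\<in>UNIV. (S ** A) $ i $ i)"
      by (auto simp: matrix_matrix_mult_def intro!: sum.cong symA' arg_cong2[where f="(*)"])
    also have "\<dots> = real (Suc m)" unfolding SA m[symmetric] by (simp add: mat_def)
    finally have "(\<Sum>i\<in>UNIV. \<Sum>j\<in>UNIV. a i j * K2 i j y) = 
      8 * (max 0 (1 - Q y / 4)) ^ 3 / 2 ^ Suc m - 8 * (max 0 (1 - Q y)) ^ 3"
      using profile_ode[of "Q y" m] by (simp add: algebra_simps)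
    moreover have "Q ((1/2) *\<^sub>R y) = Q y / 4"
      by (simp add: Q_def matrix_vector_mult_scaleR)
    ultimately show ?thesis by (simp only: E_def m)
  qed
  moreover have "E y \<ge> 0" for y by (simp add: E_def)
  moreover have "E 0 > 0" by (simp add: E_def Q_def)
  ultimately show thesis using that[of K K1 K2 E r] r zero by blast
qed

section \<open>Convolution with compactly supported kernels\<close>

text \<open>Unlike in \<open>holder_on\<close>, the constant is a parameter: it is the quantity that
  the contraction argument tracks.\<close>

definition holder_const :: "real \<Rightarrow> real \<Rightarrow> 'a set \<Rightarrow> ('a::real_normed_vector \<Rightarrow> 'b::real_normed_vector) \<Rightarrow> bool"
  where "holder_const \<alpha> F S f \<longleftrightarrow> (\<forall>x\<in>S. \<forall>y\<in>S. norm (f x - f y) \<le> F * norm (x - y) powr \<alpha>)"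

lemma holder_constD:
  "holder_const \<alpha> F S f \<Longrightarrow> x \<in> S \<Longrightarrow> y \<in> S \<Longrightarrow> norm (f x - f y) \<le> F * norm (x - y) powr \<alpha>"
  unfolding holder_const_def by blast

lemma holder_const_continuous_on:
  assumes f: "holder_const \<alpha> F S f" and "\<alpha> > 0"
  shows "continuous_on S f"
proof (unfold continuous_on_def, intro ballI)
  fix x assume x: "x \<in> S"
  have "((\<lambda>y. F * norm (y - x) powr \<alpha>) \<longlongrightarrow> F * norm (x - x) powr \<alpha>) (at x within S)"
    by (intro tendsto_intros tendsto_powr') (use \<open>\<alpha> > 0\<close> in auto)
  then have "((\<lambda>y. F * norm (y - x) powr \<alpha>) \<longlongrightarrow> 0) (at x within S)" using \<open>\<alpha> > 0\<close> by simp
  then have "((\<lambda>y. f y - f x) \<longlongrightarrow> 0) (at x within S)"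
    by (rule Lim_null_comparison[rotated])
      (use holder_constD[OF f _ x] in \<open>auto simp: eventually_at_filter\<close>)
  then show "(f \<longlongrightarrow> f x) (at x within S)" by (simp add: LIM_zero_iff)
qed

lemma has_derivative_quadratic_remainder:
  fixes g :: "'a::real_normed_vector \<Rightarrow> 'b::real_normed_vector"
  assumes "bounded_linear g'" "d > 0"
    and rem: "\<And>e. norm e \<le> d \<Longrightarrow> norm (g (x + e) - g x - g' e) \<le> C * (norm e)\<^sup>2"
  shows "(g has_derivative g') (at x)"
  unfolding has_derivative_at
proof (intro conjI)
  have "((\<lambda>h. C * norm h) \<longlongrightarrow> C * norm (0::'a)) (at (0::'a))"
    by (intro tendsto_mult_left tendsto_norm tendsto_ident_at)
  then have "((\<lambda>h. C * norm h) \<longlongrightarrow> 0) (at (0::'a))" by simp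
  then show "(\<lambda>h. norm (g (x + h) - g x - g' h) / norm h) \<midarrow>0\<rightarrow> 0"
  proof (rule Lim_null_comparison[rotated])
    show "\<forall>\<^sub>F h in at 0. norm (norm (g (x + h) - g x - g' h) / norm h) \<le> C * norm h"
      unfolding eventually_at
      using rem \<open>d > 0\<close>
      by (intro exI[of _ d]) (auto simp: dist_norm divide_simps power2_eq_square mult.assoc)
  qed
qed (rule assms)

section \<open>Integrals under translation and scaling, and with compact support\<close>

lemma lborel_integral_translate:
  fixes g :: "'a::euclidean_space \<Rightarrow> 'b::{banach, second_countable_topology}"
  assumes "g \<in> borel_measurable borel"
  shows "(\<integral>y. g (w + y) \<partial>lborel) = (\<integral>y. g y \<partial>lborel)"
proof -
  have "(\<integral>y. g y \<partial>lborel) = (\<integral>y. g y \<partial>distr lborel borel ((+) w))"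
    by (simp add: lborel_distr_plus)
  also have "\<dots> = (\<integral>y. g (w + y) \<partial>lborel)"
    by (rule integral_distr) (use assms in auto)
  finally show ?thesis by simp
qed

lemma lborel_integral_scale:
  fixes g :: "'a::euclidean_space \<Rightarrow> 'b::{banach, second_countable_topology}"
  assumes "g \<in> borel_measurable borel" "c > 0"
  shows "(\<integral>y. g y \<partial>lborel) = c ^ DIM('a) *\<^sub>R (\<integral>y. g (c *\<^sub>R y) \<partial>lborel)"
proof -
  have "(\<integral>y. g y \<partial>lborel) = (\<integral>y. g y \<partial>density (distr lborel borel (\<lambda>x. 0 + c *\<^sub>R x)) (\<lambda>_. ennreal (c ^ DIM('a))))"
    using lborel_affine[where 'a='a, of c 0] assms(2) by (simp add: ennreal_power)
  also have "\<dots> = (\<integral>y. c ^ DIM('a) *\<^sub>R g y \<partial>distr lborel borel (\<lambda>x. 0 + c *\<^sub>R x))"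
    by (rule integral_density) (use assms in auto)
  also have "\<dots> = (\<integral>y. c ^ DIM('a) *\<^sub>R g (0 + c *\<^sub>R y) \<partial>lborel)"
    by (rule integral_distr) (use assms in auto)
  finally show ?thesis by simp
qed

lemma integrable_compact_support:
  fixes g :: "'a::euclidean_space \<Rightarrow> 'b::{banach, second_countable_topology}"
  assumes "continuous_on UNIV g" "\<And>y. norm y > r \<Longrightarrow> g y = 0"
  shows "integrable lborel g"
proof -
  have "integrable lborel (\<lambda>y. indicator (cball 0 r) y *\<^sub>R g y)"
    by (intro borel_integrable_compact continuous_on_subset[OF assms(1)]) auto
  moreover have "(\<lambda>y. indicator (cball 0 r) y *\<^sub>R g y) = g"
    using assms(2) by (auto simp: fun_eq_iff indicator_def)
  ultimately show ?thesis by simp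
qed

lemma norm_integral_compact_support:
  fixes g :: "'a::euclidean_space \<Rightarrow> 'b::{banach, second_countable_topology}"
  assumes "\<And>y. norm y > r \<Longrightarrow> g y = 0" "\<And>y. norm y \<le> r \<Longrightarrow> norm (g y) \<le> B"
  shows "norm (\<integral>y. g y \<partial>lborel) \<le> B * measure lborel (cball (0::'a) r)"
proof (cases "integrable lborel g")
  case True
  have fin: "emeasure lborel (cball (0::'a) r) < \<infinity>" by (rule emeasure_bounded_finite) simp
  have "norm (\<integral>y. g y \<partial>lborel) \<le> (\<integral>y. norm (g y) \<partial>lborel)" by (rule integral_norm_bound)
  also have "\<dots> \<le> (\<integral>y. B * indicator (cball (0::'a) r) y \<partial>lborel)"
  proof (rule Bochner_Integration.integral_mono)
    show "integrable lborel (\<lambda>y. B * indicator (cball (0::'a) r) y :: real)"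
      using fin by (intro integrable_mult_right integrable_real_indicator) auto
    show "norm (g y) \<le> B * indicator (cball 0 r) y" for y
      using assms[of y] by (cases "norm y \<le> r") auto
  qed (use True in auto)
  also have "\<dots> = B * measure lborel (cball (0::'a) r)" using fin by simp
  finally show ?thesis .
next
  \<comment> \<open>The Bochner integral of a non-integrable function is 0, so here only the sign of
    the bound is at stake; for r < 0 the ball is empty and the bound is 0.\<close>
  case False
  have "0 \<le> B * measure lborel (cball (0::'a) r)"
  proof (cases "r \<ge> 0")
    case True
    have "0 \<le> norm (g 0)" by simp
    also have "\<dots> \<le> B" using assms(2)[of 0] True by simp
    finally show ?thesis by simp
  qed simp
  then show ?thesis using False by (simp add: not_integrable_integral_eq)
qed

section \<open>Convolution at scale h: size, increments and derivatives\<close>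

text \<open>For h > 0 this is h^{-n} times the integral of k((z - x)/h) f(z) over z, with n the
  dimension. The substitution keeps the kernel at unit scale, so its support and Lipschitz constant
  do not depend on h.\<close>

definition conv :: "real \<Rightarrow> ('a::euclidean_space \<Rightarrow> real) \<Rightarrow> ('a \<Rightarrow> 'b::{banach, second_countable_topology}) \<Rightarrow> 'a \<Rightarrow> 'b"
  where "conv h k f x = (\<integral>y. k y *\<^sub>R f (x + h *\<^sub>R y) \<partial>lborel)"

locale kernel =
  fixes k :: "'a::euclidean_space \<Rightarrow> real" and r B :: real
  assumes r: "r > 0" and support: "norm y \<ge> r \<Longrightarrow> k y = 0"
    and bound: "\<bar>k y\<bar> \<le> B" and lip: "\<bar>k y - k z\<bar> \<le> B * norm (y - z)"
begin

lemma B_nonneg: "B \<ge> 0"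
  using bound[of 0] by linarith

lemma continuous: "continuous_on UNIV k"
proof -
  have "holder_const 1 B UNIV k" unfolding holder_const_def using lip by auto
  then show ?thesis by (rule holder_const_continuous_on) simp
qed

lemma continuous_translate: "continuous_on UNIV (\<lambda>y. k (y - w))"
  by (rule continuous_on_compose2[OF continuous]) (auto intro!: continuous_intros)

lemma integrable_conv:
  fixes f :: "'a \<Rightarrow> 'b::{banach, second_countable_topology}"
  assumes "continuous_on UNIV f"
  shows "integrable lborel (\<lambda>y. k (y - w) *\<^sub>R f (x + h *\<^sub>R y))"
proof (rule integrable_compact_support[where r = "r + norm w"])
  show "continuous_on UNIV (\<lambda>y. k (y - w) *\<^sub>R f (x + h *\<^sub>R y))"
    by (intro continuous_intros continuous_translate continuous_on_compose2[OF assms]) auto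
  show "k (y - w) *\<^sub>R f (x + h *\<^sub>R y) = 0" if "norm y > r + norm w" for y
    using support[of "y - w"] norm_triangle_ineq2[of y w] that by auto
qed

lemmas integrable_conv0 = integrable_conv[of _ 0, simplified]

text \<open>Moves a translation of x onto the kernel, so that regularity in x is that of k and not
  of f.\<close>

lemma conv_translate:
  fixes f :: "'a \<Rightarrow> 'b::{banach, second_countable_topology}"
  assumes "continuous_on UNIV f"
  shows "conv h k f (x + h *\<^sub>R w) = (\<integral>y. k (y - w) *\<^sub>R f (x + h *\<^sub>R y) \<partial>lborel)"
proof -
  have "(\<lambda>y. k (y - w) *\<^sub>R f (x + h *\<^sub>R y)) \<in> borel_measurable borel"
    using borel_measurable_integrable[OF integrable_conv[OF assms]] by simp
  from lborel_integral_translate[OF this, of w] show ?thesis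
    by (simp add: conv_def scaleR_add_right add.assoc)
qed

lemma integrable_kernel: "integrable lborel (\<lambda>y. k (y - w))"
  using integrable_conv[of "\<lambda>_. 1::real" w] by simp

lemma integral_translate: "(\<integral>y. k (y - w) \<partial>lborel) = (\<integral>y. k y \<partial>lborel)"
  using conv_translate[of "\<lambda>_. 1::real" 0 _ w] by (simp add: conv_def)

lemma norm_conv_le:
  assumes "\<And>z. norm (f z) \<le> M"
  shows "norm (conv h k f x) \<le> B * measure lborel (cball (0::'a) r) * M"
proof -
  have "norm (conv h k f x) \<le> (B * M) * measure lborel (cball (0::'a) r)"
    unfolding conv_def
  proof (rule norm_integral_compact_support)
    show "norm (k y *\<^sub>R f (x + h *\<^sub>R y)) \<le> B * M" for y
      using bound[of y] assms[of "x + h *\<^sub>R y"] B_nonneg by (auto intro!: mult_mono)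
  qed (use support in auto)
  then show ?thesis by (simp add: algebra_simps)
qed

context
  fixes f :: "'a \<Rightarrow> 'b::{banach, second_countable_topology}" and F h \<alpha> :: real
  assumes f: "holder_const \<alpha> F UNIV f" and \<alpha>: "\<alpha> > 0" and h: "h > 0"
begin

lemma holder_scaled:
  assumes "norm y \<le> s" shows "norm (f (x + h *\<^sub>R y) - f x) \<le> F * (s powr \<alpha> * h powr \<alpha>)"
proof -
  have F: "F \<ge> 0"
  proof -
    obtain b :: 'a where "b \<in> Basis" using nonempty_Basis by blast
    then have "norm (f b - f 0) \<le> F" using holder_constD[OF f, of b 0] by simp
    then show ?thesis using norm_ge_zero order_trans by blast
  qed
  have "norm (f (x + h *\<^sub>R y) - f x) \<le> F * norm (h *\<^sub>R y) powr \<alpha>"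
    using holder_constD[OF f, of "x + h *\<^sub>R y" x] by simp
  also have "\<dots> = F * (norm y powr \<alpha> * h powr \<alpha>)" using h by (simp add: powr_mult mult.commute)
  also have "\<dots> \<le> F * (s powr \<alpha> * h powr \<alpha>)"
    using F assms \<alpha> by (intro mult_left_mono mult_right_mono powr_mono2) auto
  finally show ?thesis .
qed

text \<open>The kernels k(. - w) and k have the same integral, so the constant f(x) may be
  subtracted from f. The Lipschitz bound of the kernel then contributes |w|, and the oscillation of
  f at scale h contributes h^\<alpha>.\<close>

lemma norm_conv_diff_le:
  assumes w: "norm w \<le> 1"
  shows "norm (conv h k f (x + h *\<^sub>R w) - conv h k f x)
    \<le> B * (r + 1) powr \<alpha> * measure lborel (cball (0::'a) (r + 1)) * F * h powr \<alpha> * norm w"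
proof -
  have cont: "continuous_on UNIV f" by (rule holder_const_continuous_on[OF f \<alpha>])
  have "conv h k f (x + h *\<^sub>R w) - conv h k f x
      = (\<integral>y. k (y - w) *\<^sub>R f (x + h *\<^sub>R y) \<partial>lborel) - (\<integral>y. k y *\<^sub>R f (x + h *\<^sub>R y) \<partial>lborel)
       - ((\<integral>y. k (y - w) \<partial>lborel) - (\<integral>y. k y \<partial>lborel)) *\<^sub>R f x"
    unfolding conv_translate[OF cont] integral_translate by (simp add: conv_def)
  also have "\<dots> = (\<integral>y. (k (y - w) - k y) *\<^sub>R (f (x + h *\<^sub>R y) - f x) \<partial>lborel)"
    using integrable_conv[OF cont, of w x h] integrable_conv0[OF cont, of x h]
      integrable_kernel[of w] integrable_kernel[of 0]
    by (simp add: scaleR_diff_left scaleR_diff_right)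
  also have "norm \<dots> \<le> (B * norm w * (F * ((r + 1) powr \<alpha> * h powr \<alpha>))) * measure lborel (cball (0::'a) (r + 1))"
  proof (rule norm_integral_compact_support)
    show "(k (y - w) - k y) *\<^sub>R (f (x + h *\<^sub>R y) - f x) = 0" if "r + 1 < norm y" for y
      using support[of y] support[of "y - w"] that norm_triangle_ineq2[of y w] w by auto
    show "norm ((k (y - w) - k y) *\<^sub>R (f (x + h *\<^sub>R y) - f x)) \<le> B * norm w * (F * ((r + 1) powr \<alpha> * h powr \<alpha>))"
      if "norm y \<le> r + 1" for y
      using lip[of "y - w" y] holder_scaled[OF that] B_nonneg by (auto intro!: mult_mono)
  qed
  finally show ?thesis by (simp add: algebra_simps)
qed

text \<open>For a kernel of mean zero this is a size bound of order h^\<alpha>; for the bump it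
  identifies the limit as h tends to 0.\<close>

lemma norm_conv_approx_le:
  "norm (conv h k f x - (\<integral>y. k y \<partial>lborel) *\<^sub>R f x)
    \<le> B * (r + 1) powr \<alpha> * measure lborel (cball (0::'a) (r + 1)) * F * h powr \<alpha>"
proof -
  have cont: "continuous_on UNIV f" by (rule holder_const_continuous_on[OF f \<alpha>])
  have "conv h k f x - (\<integral>y. k y \<partial>lborel) *\<^sub>R f x = (\<integral>y. k y *\<^sub>R (f (x + h *\<^sub>R y) - f x) \<partial>lborel)"
    using integrable_conv0[OF cont, of x h] integrable_kernel[of 0]
    by (simp add: conv_def scaleR_diff_right)
  also have "norm \<dots> \<le> (B * (F * ((r + 1) powr \<alpha> * h powr \<alpha>))) * measure lborel (cball (0::'a) (r + 1))"
  proof (rule norm_integral_compact_support)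
    show "norm (k y *\<^sub>R (f (x + h *\<^sub>R y) - f x)) \<le> B * (F * ((r + 1) powr \<alpha> * h powr \<alpha>))"
      if "norm y \<le> r + 1" for y
      using bound[of y] holder_scaled[OF that] B_nonneg by (auto intro!: mult_mono)
  qed (use support in auto)
  finally show ?thesis by (simp add: algebra_simps)
qed

end

end

lemma bounded_lipschitz_kernel:
  assumes "bounded_lipschitz UNIV k" "\<And>y. norm y \<ge> r \<Longrightarrow> k y = 0" "r > 0"
  obtains B where "kernel k r B"
proof -
  obtain B where "\<forall>y\<in>UNIV. \<bar>k y\<bar> \<le> B \<and> (\<forall>z\<in>UNIV. \<bar>k y - k z\<bar> \<le> B * dist y z)"
    using assms(1) unfolding bounded_lipschitz_def by blast
  then have "kernel k r B" using assms(2,3) by unfold_locales (auto simp: dist_norm)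
  then show thesis by (rule that)
qed

lemma kernel_mono: "kernel k r B \<Longrightarrow> B \<le> B' \<Longrightarrow> kernel k r B'"
  unfolding kernel_def by (meson mult_right_mono norm_ge_zero order_trans)

lemma quadratic_remainder:
  fixes k :: "real^'n \<Rightarrow> real"
  assumes deriv: "\<And>y. (k has_derivative (\<lambda>w. \<Sum>j\<in>UNIV. w $ j * k1 j y)) (at y)"
    and lip: "\<And>j y z. \<bar>k1 j y - k1 j z\<bar> \<le> B * norm (y - z)"
  shows "\<bar>k (y + w) - k y - (\<Sum>j\<in>UNIV. w $ j * k1 j y)\<bar> \<le> real CARD('n) * B * (norm w)\<^sup>2"
proof -
  have B: "B \<ge> 0"
    using order_trans[OF abs_ge_zero lip[of undefined 0 "axis undefined 1"]] by (simp add: zero_le_mult_iff)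
  have "norm (k (y + w) - k y - (\<Sum>j\<in>UNIV. (y + w - y) $ j * k1 j y)) \<le> norm (y + w - y) * (real CARD('n) * B * norm w)"
  proof (rule differentiable_bound_linearization[where S = "cball y (norm w)" and f' = "\<lambda>y w. \<Sum>j\<in>UNIV. w $ j * k1 j y"])
    show "y + t *\<^sub>R (y + w - y) \<in> cball y (norm w)" if "t \<in> {0..1}" for t
      using that by (auto simp: dist_norm mult_left_le_one_le)
    show "(k has_derivative (\<lambda>w. \<Sum>j\<in>UNIV. w $ j * k1 j x)) (at x within cball y (norm w))" for x
      by (rule has_derivative_at_withinI[OF deriv])
    fix x assume x: "x \<in> cball y (norm w)"
    show "onorm ((\<lambda>w. \<Sum>j\<in>UNIV. w $ j * k1 j x) - (\<lambda>w. \<Sum>j\<in>UNIV. w $ j * k1 j y)) \<le> real CARD('n) * B * norm w"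
    proof (rule onorm_le)
      fix v :: "real^'n"
      have "norm (((\<lambda>w. \<Sum>j\<in>UNIV. w $ j * k1 j x) - (\<lambda>w. \<Sum>j\<in>UNIV. w $ j * k1 j y)) v)
          = \<bar>\<Sum>j\<in>UNIV. v $ j * (k1 j x - k1 j y)\<bar>"
        by (simp add: sum_subtractf[symmetric] algebra_simps)
      also have "\<dots> \<le> (\<Sum>j\<in>(UNIV::'n set). norm v * (B * norm w))"
      proof (rule order_trans[OF sum_abs], rule sum_mono)
        fix j
        have "\<bar>k1 j x - k1 j y\<bar> \<le> B * norm w"
          using lip[of j x y] x B by (auto simp: dist_norm norm_minus_commute intro: order_trans mult_left_mono)
        then show "\<bar>v $ j * (k1 j x - k1 j y)\<bar> \<le> norm v * (B * norm w)"
          unfolding abs_mult using component_le_norm_cart[of v j] by (intro mult_mono) auto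
      qed
      finally show "norm (((\<lambda>w. \<Sum>j\<in>UNIV. w $ j * k1 j x) - (\<lambda>w. \<Sum>j\<in>UNIV. w $ j * k1 j y)) v)
          \<le> real CARD('n) * B * norm w * norm v" by (simp add: algebra_simps)
    qed
  qed simp
  then show ?thesis by (simp add: power2_eq_square mult_ac)
qed

text \<open>After translation the derivative falls on the kernel, so f need only be continuous and
  bounded. The shift y - w produces the sign and x + h w the factor 1/h.\<close>

lemma conv_has_derivative:
  fixes k :: "real^'n \<Rightarrow> real" and f :: "real^'n \<Rightarrow> 'b::{banach, second_countable_topology}"
  assumes k: "kernel k r B" and k1: "\<And>j. kernel (k1 j) r B"
    and deriv: "\<And>y. (k has_derivative (\<lambda>w. \<Sum>j\<in>UNIV. w $ j * k1 j y)) (at y)"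
    and cont: "continuous_on UNIV f" and M: "\<And>z. norm (f z) \<le> M" and h: "h > 0"
  shows "(conv h k f has_derivative (\<lambda>e. \<Sum>j\<in>UNIV. e $ j *\<^sub>R ((- 1 / h) *\<^sub>R conv h (k1 j) f x))) (at x)"
proof -
  interpret k: kernel k r B by (rule k)
  interpret k1: kernel "k1 j" r B for j by (rule k1)
  have M0: "M \<ge> 0" using order_trans[OF norm_ge_zero M] .
  let ?C = "real CARD('n) * B * M * measure lborel (cball (0::real^'n) (r + 1))"
  \<comment> \<open>For |w| \<le> 1 the shifted kernel is still supported in the ball of radius r +
    1; the increment of x is e = h w.\<close>
  have rem: "norm (conv h k f (x + h *\<^sub>R w) - conv h k f x + (\<Sum>j\<in>UNIV. w $ j *\<^sub>R conv h (k1 j) f x))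
      \<le> ?C * (norm w)\<^sup>2" if w: "norm w \<le> 1" for w
  proof -
    have "conv h k f (x + h *\<^sub>R w) - conv h k f x + (\<Sum>j\<in>UNIV. w $ j *\<^sub>R conv h (k1 j) f x)
      = (\<integral>y. (k (y - w) - k y + (\<Sum>j\<in>UNIV. w $ j * k1 j y)) *\<^sub>R f (x + h *\<^sub>R y) \<partial>lborel)"
      unfolding k.conv_translate[OF cont]
      using k.integrable_conv[OF cont, of w x h] k.integrable_conv0[OF cont, of x h]
        k1.integrable_conv0[OF cont, of _ x h]
      by (simp add: conv_def scaleR_diff_left scaleR_add_left scaleR_sum_left scaleR_scaleR[symmetric]
          del: scaleR_scaleR)
    also have "norm \<dots> \<le> (real CARD('n) * B * (norm w)\<^sup>2 * M) * measure lborel (cball (0::real^'n) (r + 1))"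
    proof (rule norm_integral_compact_support)
      show "(k (y - w) - k y + (\<Sum>j\<in>UNIV. w $ j * k1 j y)) *\<^sub>R f (x + h *\<^sub>R y) = 0" if "r + 1 < norm y" for y
        using k.support[of y] k.support[of "y - w"] k1.support[of y] that norm_triangle_ineq2[of y w] w by auto
      show "norm ((k (y - w) - k y + (\<Sum>j\<in>UNIV. w $ j * k1 j y)) *\<^sub>R f (x + h *\<^sub>R y))
          \<le> real CARD('n) * B * (norm w)\<^sup>2 * M" for y
        using quadratic_remainder[OF deriv k1.lip, of y "- w"] M[of "x + h *\<^sub>R y"] k.B_nonneg
        by (auto simp: sum_negf intro!: mult_mono)
    qed
    finally show ?thesis by (simp add: mult_ac)
  qed
  show ?thesis
  proof (rule has_derivative_quadratic_remainder[OF _ h])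
    show "bounded_linear (\<lambda>e::real^'n. \<Sum>j\<in>UNIV. e $ j *\<^sub>R ((- 1 / h) *\<^sub>R conv h (k1 j) f x))"
      by (intro bounded_linear_sum bounded_linear_scaleR_left[THEN bounded_linear_compose] bounded_linear_vec_nth)
    fix e :: "real^'n" assume e: "norm e \<le> h"
    have "norm ((1 / h) *\<^sub>R e) \<le> 1" using e h by simp
    from rem[OF this] h show "norm (conv h k f (x + e) - conv h k f x - (\<Sum>j\<in>UNIV. e $ j *\<^sub>R ((- 1 / h) *\<^sub>R conv h (k1 j) f x)))
        \<le> ?C / h\<^sup>2 * (norm e)\<^sup>2"
      by (simp add: sum_negf power_divide)
  qed
qed

text \<open>The convolution of k with the constant 1 does not depend on x, so its derivative, whose
  coefficients are minus the integrals of the \<open>k1 j\<close>, vanishes.\<close>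

lemma integral_derivative_kernel:
  fixes k :: "real^'n \<Rightarrow> real"
  assumes k: "kernel k r B" and k1: "\<And>j. kernel (k1 j) r B"
    and deriv: "\<And>y. (k has_derivative (\<lambda>w. \<Sum>j\<in>UNIV. w $ j * k1 j y)) (at y)"
  shows "(\<integral>y. k1 j y \<partial>lborel) = 0"
proof -
  have "(conv 1 k (\<lambda>_. 1::real) has_derivative (\<lambda>e. \<Sum>j\<in>UNIV. e $ j *\<^sub>R ((- 1 / 1) *\<^sub>R conv 1 (k1 j) (\<lambda>_. 1) 0))) (at 0)"
    by (rule conv_has_derivative[OF k k1 deriv, where M = 1]) auto
  moreover have "(conv 1 k (\<lambda>_. 1::real) has_derivative (\<lambda>e. 0)) (at 0)"
    unfolding conv_def by simp
  ultimately have "(\<lambda>e::real^'n. \<Sum>j\<in>UNIV. e $ j *\<^sub>R ((- 1 / 1) *\<^sub>R conv 1 (k1 j) (\<lambda>_. 1::real) 0)) = (\<lambda>e. 0)"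
    by (rule has_derivative_unique)
  from fun_cong[OF this, of "axis j 1"] show ?thesis
    by (simp add: conv_def axis_def if_distrib if_distribR sum.delta' cong: if_cong)
qed

(* With q = (1/2)^alpha the sum satisfies S d = min 1 d + q S (2 d). The bound proved by
   induction is C d^alpha - b d: as b (2 q) = b + 1, the linear term absorbs the first summand. *)
lemma sum_min_powr_le:
  fixes \<alpha> d :: real
  assumes \<alpha>: "0 < \<alpha>" "\<alpha> < 1" and d: "d \<ge> 0"
  shows "(\<Sum>i<N. min (((1/2) ^ i) powr \<alpha>) (d * 2 ^ i * ((1/2) ^ i) powr \<alpha>))
    \<le> (1 / (1 - (1/2) powr \<alpha>) + 2 / (2 * (1/2) powr \<alpha> - 1)) * d powr \<alpha>"
proof -
  define q where "q = (1/2::real) powr \<alpha>"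
  have "(1/2::real) powr 1 < (1/2) powr \<alpha>" "(1/2::real) powr \<alpha> < (1/2) powr 0"
    by (rule powr_less_mono'; use \<alpha> in simp)+
  moreover have "(1/2::real) powr 0 = 1" "(1/2::real) powr 1 = 1/2" by simp_all
  ultimately have q: "1/2 < q" "q < 1" unfolding q_def by linarith+
  have qi: "((1/2) ^ i) powr \<alpha> = q ^ i" for i
    by (simp add: q_def powr_power powr_realpow[symmetric] powr_powr mult.commute)
  define b where "b = 1 / (2 * q - 1)"
  \<comment> \<open>The first summand is the geometric bound of the whole sum, enough for d \<ge> 1;
    the second compensates b * d as long as d \<le> 2.\<close>
  define C where "C = 1 / (1 - q) + 2 * b"
  have b: "b > 0" "b * (2 * q) = b + 1" using q by (auto simp: b_def field_simps)
  have C: "C \<ge> 1 / (1 - q)" "C > 0" using b q by (auto simp: C_def intro!: add_pos_pos)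
  define S where "S N d = (\<Sum>i<N. min (q ^ i) (d * 2 ^ i * q ^ i))" for N and d :: real
  have geo: "S N d \<le> 1 / (1 - q)" for N d
  proof -
    have "S N d \<le> (\<Sum>i<N. q ^ i)" unfolding S_def by (rule sum_mono) simp
    also have "\<dots> \<le> (\<Sum>i. q ^ i)" using q by (intro sum_le_suminf summable_geometric) auto
    also have "\<dots> = 1 / (1 - q)" using q by (simp add: suminf_geometric)
    finally show ?thesis .
  qed
  \<comment> \<open>The recursion is used only for d < 1 and leads to 2 d < 2, so it stays in (0,
    2]; from d = 1 on the geometric bound takes over.\<close>
  have main: "S N d \<le> C * d powr \<alpha> - b * d" if "0 < d" "d \<le> 2" for N d
    using that
  proof (induction N arbitrary: d)
    case 0
    have "b * d \<le> C * d powr \<alpha>"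
    proof -
      have "d = d powr \<alpha> * d powr (1 - \<alpha>)" using 0 by (simp add: powr_add[symmetric])
      also have "\<dots> \<le> d powr \<alpha> * 2"
      proof (rule mult_left_mono)
        have "d powr (1 - \<alpha>) \<le> 2 powr (1 - \<alpha>)" using 0 \<alpha> by (intro powr_mono2) auto
        also have "\<dots> \<le> 2 powr 1" using \<alpha> by (intro powr_mono) auto
        finally show "d powr (1 - \<alpha>) \<le> 2" by simp
      qed simp
      finally have "b * d \<le> (2 * b) * d powr \<alpha>" using b by (simp add: algebra_simps)
      also have "\<dots> \<le> C * d powr \<alpha>" using q by (intro mult_right_mono) (auto simp: C_def)
      finally show ?thesis .
    qed
    then show ?case by (simp add: S_def)
  next
    case (Suc N)
    show ?case
    proof (cases "d \<ge> 1")
      case True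
      have "1 \<le> d powr \<alpha>" using True \<alpha> by (intro ge_one_powr_ge_zero) auto
      then have "C * 1 \<le> C * d powr \<alpha>" using C by (intro mult_left_mono) auto
      moreover have "b * d \<le> b * 2" using Suc.prems b by (intro mult_left_mono) auto
      ultimately show ?thesis using geo[of "Suc N" d] by (simp add: C_def)
    next
      case False
      have "S (Suc N) d = min 1 d + q * S N (2 * d)"
      proof -
        have "S (Suc N) d = min 1 d + (\<Sum>i<N. min (q ^ Suc i) (d * 2 ^ Suc i * q ^ Suc i))"
          unfolding S_def sum.lessThan_Suc_shift by simp
        also have "(\<Sum>i<N. min (q ^ Suc i) (d * 2 ^ Suc i * q ^ Suc i)) = q * S N (2 * d)"
          unfolding S_def sum_distrib_left
          using q by (intro sum.cong refl) (auto simp: min_def algebra_simps)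
        finally show ?thesis .
      qed
      also have "\<dots> \<le> d + q * (C * (2 * d) powr \<alpha> - b * (2 * d))"
        using Suc.IH[of "2 * d"] Suc.prems False q by (intro add_mono mult_left_mono) auto
      also have "\<dots> = C * (q * (2 * d) powr \<alpha>) + d - (b * (2 * q)) * d" by (simp add: algebra_simps)
      also have "q * (2 * d) powr \<alpha> = d powr \<alpha>"
        using Suc.prems by (simp add: q_def powr_mult[symmetric])
      finally show ?thesis unfolding b by (simp add: algebra_simps)
    qed
  qed
  have "S N d \<le> C * d powr \<alpha>"
  proof -
    consider "d = 0" | "0 < d" "d \<le> 2" | "d > 2" using d by linarith
    then show ?thesis
    proof cases
      case 1 then show ?thesis by (auto simp: S_def min_def intro!: sum_nonpos)
    next
      case 2
      then have "0 \<le> b * d" using b by simp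
      then show ?thesis using main[OF 2, of N] by linarith
    next
      case 3
      have "1 \<le> d powr \<alpha>" using 3 \<alpha> by (intro ge_one_powr_ge_zero) auto
      then have "C * 1 \<le> C * d powr \<alpha>" using C by (intro mult_left_mono) auto
      then show ?thesis using geo[of N d] C by linarith
    qed
  qed
  then show ?thesis unfolding S_def C_def b_def qi by (simp add: q_def)
qed

section \<open>An approximate inverse of a constant coefficient operator\<close>

lemma le_mult_min: "x \<le> c * a \<Longrightarrow> x \<le> c * b \<Longrightarrow> x \<le> c * min a (b::real)"
  by (simp add: min_def)

section \<open>Series of functions and rules for convolutions\<close>

text \<open>There are finitely many coordinates, so uniform convergence of each series of partials,
  given by the majorant W, is uniform convergence of the derivatives in operator norm.\<close>

lemma has_derivative_partials_suminf:
  fixes g :: "nat \<Rightarrow> real^'n \<Rightarrow> 'b::banach"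
  assumes deriv: "\<And>i x. (g i has_derivative (\<lambda>e. \<Sum>j\<in>UNIV. e $ j *\<^sub>R T i j x)) (at x)"
    and le: "\<And>i j x. norm (T i j x) \<le> W i" and W: "summable W"
    and summ: "\<And>x. summable (\<lambda>i. g i x)"
  shows "((\<lambda>x. \<Sum>i. g i x) has_derivative (\<lambda>e. \<Sum>j\<in>UNIV. e $ j *\<^sub>R (\<Sum>i. T i j x))) (at x)"
proof -
  have "\<exists>G. \<forall>x\<in>UNIV. (\<lambda>i. g i x) sums G x \<and>
     (G has_derivative (\<lambda>e. \<Sum>j\<in>UNIV. e $ j *\<^sub>R (\<Sum>i. T i j x))) (at x within UNIV)"
  proof (rule has_derivative_series[where f' = "\<lambda>i x e. \<Sum>j\<in>UNIV. e $ j *\<^sub>R T i j x" and x = 0])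
    fix \<epsilon> :: real assume "\<epsilon> > 0"
    then have \<epsilon>: "\<epsilon> / real CARD('n) > 0" by simp
    have "\<forall>\<^sub>F n in sequentially. \<forall>x\<in>UNIV. dist (\<Sum>i<n. T i j x) (\<Sum>i. T i j x) < \<epsilon> / real CARD('n)" for j
      using uniform_limitD[OF Weierstrass_m_test[of UNIV "\<lambda>i x. T i j x" W] \<epsilon>] le W by blast
    then have "\<forall>\<^sub>F n in sequentially. \<forall>j. \<forall>x. dist (\<Sum>i<n. T i j x) (\<Sum>i. T i j x) < \<epsilon> / real CARD('n)"
      by (intro eventually_all_finite) simp
    then show "\<forall>\<^sub>F n in sequentially. \<forall>x\<in>UNIV. \<forall>h. norm ((\<Sum>i<n. \<Sum>j\<in>UNIV. h $ j *\<^sub>R T i j x)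
       - (\<Sum>j\<in>UNIV. h $ j *\<^sub>R (\<Sum>i. T i j x))) \<le> \<epsilon> * norm h"
    proof (eventually_elim, intro ballI allI)
      fix n and x h :: "real^'n"
      assume *: "\<forall>j x. dist (\<Sum>i<n. T i j x) (\<Sum>i. T i j x) < \<epsilon> / real CARD('n)"
      have "(\<Sum>i<n. \<Sum>j\<in>UNIV. h $ j *\<^sub>R T i j x) - (\<Sum>j\<in>UNIV. h $ j *\<^sub>R (\<Sum>i. T i j x))
         = (\<Sum>j\<in>UNIV. h $ j *\<^sub>R ((\<Sum>i<n. T i j x) - (\<Sum>i. T i j x)))"
        by (subst sum.swap) (simp add: scaleR_sum_right scaleR_diff_right sum_subtractf)
      also have "norm \<dots> \<le> (\<Sum>j\<in>(UNIV::'n set). norm h * (\<epsilon> / real CARD('n)))"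
      proof (rule sum_norm_le)
        fix j
        show "norm (h $ j *\<^sub>R ((\<Sum>i<n. T i j x) - (\<Sum>i. T i j x))) \<le> norm h * (\<epsilon> / real CARD('n))"
          unfolding norm_scaleR using * component_le_norm_cart[of h j]
          by (intro mult_mono) (auto simp: dist_norm intro: less_imp_le)
      qed
      finally show "norm ((\<Sum>i<n. \<Sum>j\<in>UNIV. h $ j *\<^sub>R T i j x)
       - (\<Sum>j\<in>UNIV. h $ j *\<^sub>R (\<Sum>i. T i j x))) \<le> \<epsilon> * norm h" by (simp add: mult.commute)
    qed
  qed (use deriv summ in \<open>auto intro: summable_sums\<close>)
  then obtain G where G: "\<And>x. (\<lambda>i. g i x) sums G x"
    "\<And>x. (G has_derivative (\<lambda>e. \<Sum>j\<in>UNIV. e $ j *\<^sub>R (\<Sum>i. T i j x))) (at x)" by auto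
  have "G = (\<lambda>x. \<Sum>i. g i x)" using G(1) by (auto simp: fun_eq_iff sums_iff)
  with G(2) show ?thesis by simp
qed

lemma conv_diff:
  fixes f g :: "'a::euclidean_space \<Rightarrow> 'b::{banach, second_countable_topology}"
  assumes "kernel k r B" "continuous_on UNIV f" "continuous_on UNIV g"
  shows "conv h k (\<lambda>x. f x - g x) x = conv h k f x - conv h k g x"
  unfolding conv_def scaleR_diff_right
  by (rule Bochner_Integration.integral_diff; rule kernel.integrable_conv0[OF assms(1)]; fact)

lemma conv_sum_kernel:
  fixes f :: "'a::euclidean_space \<Rightarrow> 'b::{banach, second_countable_topology}"
  assumes "\<And>i. i \<in> I \<Longrightarrow> kernel (k i) r B" "continuous_on UNIV f"
  shows "conv h (\<lambda>y. \<Sum>i\<in>I. c i * k i y) f x = (\<Sum>i\<in>I. c i *\<^sub>R conv h (k i) f x)"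
proof -
  have "conv h (\<lambda>y. \<Sum>i\<in>I. c i * k i y) f x = (\<integral>y. (\<Sum>i\<in>I. c i *\<^sub>R (k i y *\<^sub>R f (x + h *\<^sub>R y))) \<partial>lborel)"
    by (simp add: conv_def scaleR_sum_left)
  also have "\<dots> = (\<Sum>i\<in>I. \<integral>y. c i *\<^sub>R (k i y *\<^sub>R f (x + h *\<^sub>R y)) \<partial>lborel)"
    by (intro Bochner_Integration.integral_sum integrable_scaleR_right kernel.integrable_conv0[OF assms(1) assms(2)])
  finally show ?thesis by (simp only: conv_def integral_scaleR_right)
qed

text \<open>The factor 2^{-n} is absorbed by the Jacobian of the dilation by 2. Thus the kernel
  identity for E becomes a difference of convolutions with E at the scales 2 h and h.\<close>

lemma conv_dilate_kernel:
  fixes f :: "'a::euclidean_space \<Rightarrow> 'b::{banach, second_countable_topology}"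
  assumes "kernel k r B" "continuous_on UNIV f"
  shows "(\<integral>y. (k ((1/2) *\<^sub>R y) / 2 ^ DIM('a)) *\<^sub>R f (x + h *\<^sub>R y) \<partial>lborel) = conv (2 * h) k f x"
proof -
  interpret kernel k r B by (rule assms)
  have "continuous_on UNIV (\<lambda>y. (k ((1/2) *\<^sub>R y) / 2 ^ DIM('a)) *\<^sub>R f (x + h *\<^sub>R y))"
    by (intro continuous_intros continuous_on_compose2[OF continuous] continuous_on_compose2[OF assms(2)]) auto
  then have "(\<lambda>y. (k ((1/2) *\<^sub>R y) / 2 ^ DIM('a)) *\<^sub>R f (x + h *\<^sub>R y)) \<in> borel_measurable borel"
    by (rule borel_measurable_continuous_onI)
  from lborel_integral_scale[OF this, of 2] show ?thesis
    by (simp add: conv_def mult.commute integral_scaleR_right[symmetric] del: integral_scaleR_right)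
qed

section \<open>The dyadic parametrix\<close>

text \<open>The functions on which the dyadic series converge: boundedness controls the terms of the
  potential and of its gradient, the Hoelder bound those of the second derivatives.\<close>

definition admissible :: "real \<Rightarrow> ('a::real_normed_vector \<Rightarrow> 'b::real_normed_vector) \<Rightarrow> bool"
  where "admissible \<alpha> f \<longleftrightarrow> (\<exists>F. holder_const \<alpha> F UNIV f) \<and> bounded (range f)"

text \<open>\<open>N\<close> is the dyadic sum divided by the mass of the bump, with gradient
  \<open>N1\<close> and Hessian \<open>N2\<close>. The error estimate compares two points because
  this form survives the subtraction of a quadratic polynomial.\<close>

lemma parametrix_raw:
  fixes a :: "'n::finite \<Rightarrow> 'n \<Rightarrow> real"
  assumes "lam > 0"
    and pos: "\<And>\<xi> :: real^'n. (\<Sum>i\<in>UNIV. \<Sum>j\<in>UNIV. a i j * \<xi> $ i * \<xi> $ j) \<ge> lam * (norm \<xi>)\<^sup>2"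
    and \<alpha>: "0 < \<alpha>" "\<alpha> < 1"
  obtains C and N :: "(real^'n \<Rightarrow> 'b::{banach, second_countable_topology}) \<Rightarrow> real^'n \<Rightarrow> 'b" and N1 N2 where
    "C > 0"
    "\<And>f x. admissible \<alpha> f \<Longrightarrow> (N f has_derivative (\<lambda>e. \<Sum>j\<in>UNIV. e $ j *\<^sub>R N1 j f x)) (at x)"
    "\<And>f j x. admissible \<alpha> f \<Longrightarrow> (N1 j f has_derivative (\<lambda>e. \<Sum>i\<in>UNIV. e $ i *\<^sub>R N2 i j f x)) (at x)"
    "\<And>i j. N2 i j = N2 j i"
    "\<And>f F i j. admissible \<alpha> f \<Longrightarrow> holder_const \<alpha> F UNIV f \<Longrightarrow> holder_const \<alpha> (C * F) UNIV (N2 i j f)"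
    "\<And>f F x y. admissible \<alpha> f \<Longrightarrow> holder_const \<alpha> F UNIV f \<Longrightarrow> norm (x - y) \<le> 1 \<Longrightarrow>
      norm (((\<Sum>i\<in>UNIV. \<Sum>j\<in>UNIV. a i j *\<^sub>R N2 i j f x) - f x)
        - ((\<Sum>i\<in>UNIV. \<Sum>j\<in>UNIV. a i j *\<^sub>R N2 i j f y) - f y)) \<le> C * F * norm (x - y)"
    "\<And>f g x. admissible \<alpha> f \<Longrightarrow> admissible \<alpha> g \<Longrightarrow> N (\<lambda>x. f x - g x) x = N f x - N g x"
    "\<And>f g j x. admissible \<alpha> f \<Longrightarrow> admissible \<alpha> g \<Longrightarrow> N1 j (\<lambda>x. f x - g x) x = N1 j f x - N1 j g x"
    "\<And>f g i j x. admissible \<alpha> f \<Longrightarrow> admissible \<alpha> g \<Longrightarrow> N2 i j (\<lambda>x. f x - g x) x = N2 i j f x - N2 i j g x"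
proof -
  obtain K :: "real^'n \<Rightarrow> real" and K1 K2 E r where
    bl: "bounded_lipschitz UNIV K" "\<And>j. bounded_lipschitz UNIV (K1 j)"
    "\<And>i j. bounded_lipschitz UNIV (K2 i j)" "bounded_lipschitz UNIV E" and
    zero: "\<And>y. norm y \<ge> r \<Longrightarrow> K y = 0" "\<And>j y. norm y \<ge> r \<Longrightarrow> K1 j y = 0"
    "\<And>i j y. norm y \<ge> r \<Longrightarrow> K2 i j y = 0" "\<And>y. norm y \<ge> r \<Longrightarrow> E y = 0" and
    dK: "\<And>y. (K has_derivative (\<lambda>w. \<Sum>j\<in>UNIV. w $ j * K1 j y)) (at y)" and
    dK1: "\<And>j y. (K1 j has_derivative (\<lambda>w. \<Sum>i\<in>UNIV. w $ i * K2 i j y)) (at y)" and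
    K2sym: "\<And>i j. K2 i j = K2 j i" and
    K2E: "\<And>y. (\<Sum>i\<in>UNIV. \<Sum>j\<in>UNIV. a i j * K2 i j y) = E ((1/2) *\<^sub>R y) / 2 ^ CARD('n) - E y" and
    E: "\<And>y. E y \<ge> 0" "E 0 > 0" and r: "r > 0"
    using telescoping_kernel[OF \<open>lam > 0\<close> pos] by blast
  obtain BK where BK: "kernel K r BK" using bounded_lipschitz_kernel[OF bl(1) zero(1) r] .
  obtain BE where BE: "kernel E r BE" using bounded_lipschitz_kernel[OF bl(4) zero(4) r] .
  have "\<exists>B. kernel (K1 j) r B" for j using bounded_lipschitz_kernel[OF bl(2) zero(2) r] by metis
  then obtain B1 where B1: "\<And>j. kernel (K1 j) r (B1 j)" by metis
  have "\<exists>B. kernel (K2 i j) r B" for i j using bounded_lipschitz_kernel[OF bl(3) zero(3) r] by metis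
  then obtain B2 where B2: "\<And>i j. kernel (K2 i j) r (B2 i j)" by metis
  define B where "B = BK + BE + (\<Sum>j\<in>UNIV. B1 j) + (\<Sum>i\<in>UNIV. \<Sum>j\<in>UNIV. B2 i j)"
  have nn: "BK \<ge> 0" "BE \<ge> 0" "\<And>j. B1 j \<ge> 0" "\<And>i j. B2 i j \<ge> 0"
    using kernel.B_nonneg BK BE B1 B2 by blast+
  have nn': "(\<Sum>j\<in>UNIV. B1 j) \<ge> 0" "(\<Sum>i\<in>UNIV. \<Sum>j\<in>UNIV. B2 i j) \<ge> 0"
    using nn by (auto intro!: sum_nonneg)
  have kK: "kernel K r B" by (rule kernel_mono[OF BK]) (use nn nn' in \<open>simp add: B_def\<close>)
  have kE: "kernel E r B" by (rule kernel_mono[OF BE]) (use nn nn' in \<open>simp add: B_def\<close>)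
  have kK1: "kernel (K1 j) r B" for j
  proof (rule kernel_mono[OF B1])
    have "B1 j \<le> (\<Sum>j\<in>UNIV. B1 j)" using nn by (intro member_le_sum) auto
    then show "B1 j \<le> B" using nn nn' by (simp add: B_def)
  qed
  have kK2: "kernel (K2 i j) r B" for i j
  proof (rule kernel_mono[OF B2])
    have "B2 i j \<le> (\<Sum>j\<in>UNIV. B2 i j)" using nn by (intro member_le_sum) auto
    also have "\<dots> \<le> (\<Sum>i\<in>UNIV. \<Sum>j\<in>UNIV. B2 i j)"
      using nn by (intro member_le_sum[of i UNIV "\<lambda>i. \<Sum>j\<in>UNIV. B2 i j"] sum_nonneg) auto
    finally show "B2 i j \<le> B" using nn nn' by (simp add: B_def)
  qed
  have B: "B \<ge> 0" using nn nn' by (simp add: B_def)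
  define c where "c = (\<integral>y. E y \<partial>lborel)"
  have c: "c > 0"
  proof -
    have "c \<ge> 0" unfolding c_def using E by (intro integral_nonneg_AE) auto
    \<comment> \<open>If the mass were 0, the set where E is non-zero would be open and null, hence
      empty, against E(0) > 0.\<close>
    moreover have "c \<noteq> 0"
    proof
      assume "c = 0"
      have intE: "integrable lborel E" using kernel.integrable_kernel[OF kE, of 0] by simp
      have "AE y in lborel. E y = 0"
        using \<open>c = 0\<close> integral_nonneg_eq_0_iff_AE[OF intE] E by (auto simp: c_def)
      then have "E 0 = 0"
      proof -
        assume ae: "AE y in lborel. E y = 0"
        have op: "open {y. E y \<noteq> 0}"
          using kernel.continuous[OF kE] by (intro open_Collect_neq) (auto intro: continuous_intros)
        have "{y. E y \<noteq> 0} \<in> null_sets lborel"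
          using ae op by (subst AE_iff_null_sets) auto
        then have "negligible {y. E y \<noteq> 0}"
          by (simp add: negligible_iff_null_sets null_sets_completionI)
        then have "{y. E y \<noteq> 0} = {}" using open_not_negligible[OF op] by blast
        then show ?thesis by blast
      qed
      then show False using E(2) by simp
    qed
    ultimately show ?thesis by simp
  qed
  define D0 where "D0 = B * measure lborel (cball (0::real^'n) r)"
  define D where "D = B * (r + 1) powr \<alpha> * measure lborel (cball (0::real^'n) (r + 1))"
  have D: "D \<ge> 0" "D0 \<ge> 0" using B r by (auto simp: D_def D0_def)
  define q where "q = (1/2::real) powr \<alpha>"
  have "(1/2::real) powr 0 > (1/2) powr \<alpha>" using \<alpha> by (intro powr_less_mono') auto
  then have q: "0 < q" "q < 1" by (auto simp: q_def)
  have qi: "((1/2) ^ i) powr \<alpha> = q ^ i" for i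
    by (simp add: q_def powr_power powr_realpow[symmetric] powr_powr mult.commute)
  define Cs where "Cs = 1 / (1 - (1/2) powr \<alpha>) + 2 / (2 * (1/2) powr \<alpha> - 1)"
  define h where "h i = (1/2::real) ^ i" for i
  have h: "h i > 0" for i by (simp add: h_def)
  have int0: "(\<integral>y. K2 i j y \<partial>lborel) = 0" for i j
    by (rule integral_derivative_kernel[OF kK1[of j] kK2 dK1])
  \<comment> \<open>Each differentiation of a convolution at scale h costs a factor -1/h, so the
    weights run -h^2, h, -1. The last series has no decaying weight; it converges because of
    \<open>int0\<close> and the Hoelder bound of f.\<close>
  define V :: "(real^'n \<Rightarrow> 'b) \<Rightarrow> real^'n \<Rightarrow> 'b" where "V f x = (\<Sum>i. (- ((h i)\<^sup>2)) *\<^sub>R conv (h i) K f x)" for f x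
  define V1 :: "'n \<Rightarrow> (real^'n \<Rightarrow> 'b) \<Rightarrow> real^'n \<Rightarrow> 'b" where "V1 j f x = (\<Sum>i. h i *\<^sub>R conv (h i) (K1 j) f x)" for j f x
  define V2 :: "'n \<Rightarrow> 'n \<Rightarrow> (real^'n \<Rightarrow> 'b) \<Rightarrow> real^'n \<Rightarrow> 'b" where "V2 j l f x = (\<Sum>i. - conv (h i) (K2 j l) f x)" for j l f x
  have cont: "continuous_on UNIV f" if "admissible \<alpha> f" for f :: "real^'n \<Rightarrow> 'b"
    using that holder_const_continuous_on[OF _ \<alpha>(1)] by (auto simp: admissible_def)
  have Fnn: "F \<ge> 0" if "holder_const \<alpha> F UNIV f" for F and f :: "real^'n \<Rightarrow> 'b"
    using order_trans[OF norm_ge_zero holder_constD[OF that, of "axis undefined 1" 0]] by simp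
  have bnd2: "norm (- conv (h i) (K2 j l) f x) \<le> D * F * q ^ i"
    if "holder_const \<alpha> F UNIV f" for f :: "real^'n \<Rightarrow> 'b" and F i j l x
    using kernel.norm_conv_approx_le[OF kK2 that \<alpha>(1) h, of i j l x] unfolding int0
    by (simp add: D_def h_def qi)
  have summ2: "summable (\<lambda>i. - conv (h i) (K2 j l) f x)" if "admissible \<alpha> f" for f :: "real^'n \<Rightarrow> 'b" and j l x
  proof -
    obtain F where F: "holder_const \<alpha> F UNIV f" using \<open>admissible \<alpha> f\<close> by (auto simp: admissible_def)
    show ?thesis
      by (rule summable_comparison_test'[where N = 0 and g = "\<lambda>i. D * F * q ^ i"])
        (use q bnd2[OF F] in \<open>auto intro!: summable_mult summable_geometric\<close>)
  qed
  have bnd: "\<exists>M. (\<forall>z. norm (f z) \<le> M) \<and> (\<forall>k i x. kernel k r B \<longrightarrow> norm (conv (h i) k f x) \<le> D0 * M)"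
    if adm: "admissible \<alpha> f" for f :: "real^'n \<Rightarrow> 'b"
  proof -
    obtain M where M: "\<And>z. norm (f z) \<le> M" using adm by (auto simp: admissible_def bounded_iff)
    have "norm (conv (h i) k f x) \<le> D0 * M" if k: "kernel k r B" for k i x
      unfolding D0_def by (rule kernel.norm_conv_le[OF k M])
    with M show ?thesis by blast
  qed
  have hle: "(h i)\<^sup>2 \<le> h i" for i
  proof -
    have "h i \<le> 1" by (simp add: h_def power_le_one)
    then show ?thesis using h[of i] by (simp add: power2_eq_square mult_left_le)
  qed
  have summ_h: "summable (\<lambda>i. h i * M)" for M unfolding h_def by (intro summable_mult2 summable_geometric) simp
  have summ: "summable (\<lambda>i. (- ((h i)\<^sup>2)) *\<^sub>R conv (h i) K f x)" "summable (\<lambda>i. h i *\<^sub>R conv (h i) (K1 j) f x)"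
    if adm: "admissible \<alpha> f" for f :: "real^'n \<Rightarrow> 'b" and j x
  proof -
    obtain M where M: "\<And>k i x. kernel k r B \<Longrightarrow> norm (conv (h i) k f x) \<le> D0 * M" using bnd[OF adm] by blast
    have "norm ((- ((h i)\<^sup>2)) *\<^sub>R conv (h i) K f x) \<le> h i * (D0 * M)" for i
      using M[OF kK, of i x] hle[of i] h[of i] by (auto intro!: mult_mono)
    then show "summable (\<lambda>i. (- ((h i)\<^sup>2)) *\<^sub>R conv (h i) K f x)"
      by (intro summable_comparison_test'[OF summ_h[of "D0 * M"], where N = 0])
    have "norm (h i *\<^sub>R conv (h i) (K1 j) f x) \<le> h i * (D0 * M)" for i
      using M[OF kK1, of i j x] h[of i] by (auto intro!: mult_mono)
    then show "summable (\<lambda>i. h i *\<^sub>R conv (h i) (K1 j) f x)"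
      by (intro summable_comparison_test'[OF summ_h[of "D0 * M"], where N = 0])
  qed
  have dV: "(V f has_derivative (\<lambda>e. \<Sum>j\<in>UNIV. e $ j *\<^sub>R V1 j f x)) (at x)"
    if adm: "admissible \<alpha> f" for f x
  proof -
    obtain M where M: "\<And>z. norm (f z) \<le> M" "\<And>k i x. kernel k r B \<Longrightarrow> norm (conv (h i) k f x) \<le> D0 * M"
      using bnd[OF adm] by blast
    show ?thesis unfolding V_def[abs_def] V1_def
    proof (rule has_derivative_partials_suminf[OF _ _ summ_h[of "D0 * M"] summ(1)[OF adm]])
      fix i x
      have "((\<lambda>x. (- ((h i)\<^sup>2)) *\<^sub>R conv (h i) K f x) has_derivative
         (\<lambda>e. (- ((h i)\<^sup>2)) *\<^sub>R (\<Sum>j\<in>UNIV. e $ j *\<^sub>R ((- 1 / h i) *\<^sub>R conv (h i) (K1 j) f x)))) (at x)"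
        by (intro has_derivative_scaleR_right conv_has_derivative[OF kK kK1 dK cont[OF adm] M(1) h])
      then show "((\<lambda>x. (- ((h i)\<^sup>2)) *\<^sub>R conv (h i) K f x) has_derivative
         (\<lambda>e. \<Sum>j\<in>UNIV. e $ j *\<^sub>R (h i *\<^sub>R conv (h i) (K1 j) f x))) (at x)"
        by (rule has_derivative_eq_rhs)
          (use h[of i] in \<open>simp add: fun_eq_iff scaleR_sum_right power2_eq_square mult_ac\<close>)
      show "norm (h i *\<^sub>R conv (h i) (K1 j) f x) \<le> h i * (D0 * M)" for j
        using M(2)[OF kK1, of i j x] h[of i] by (auto intro!: mult_mono)
    qed
  qed
  have dV1: "(V1 j f has_derivative (\<lambda>e. \<Sum>i\<in>UNIV. e $ i *\<^sub>R V2 i j f x)) (at x)"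
    if adm: "admissible \<alpha> f" for f x j
  proof -
    obtain M where M: "\<And>z. norm (f z) \<le> M" using bnd[OF adm] by blast
    obtain F where F: "holder_const \<alpha> F UNIV f" using adm by (auto simp: admissible_def)
    show ?thesis unfolding V1_def[abs_def] V2_def
    proof (rule has_derivative_partials_suminf[OF _ bnd2[OF F] _ summ(2)[OF adm]])
      fix i x
      have "((\<lambda>x. h i *\<^sub>R conv (h i) (K1 j) f x) has_derivative
         (\<lambda>e. h i *\<^sub>R (\<Sum>l\<in>UNIV. e $ l *\<^sub>R ((- 1 / h i) *\<^sub>R conv (h i) (K2 l j) f x)))) (at x)"
        by (intro has_derivative_scaleR_right conv_has_derivative[OF kK1 kK2 dK1 cont[OF adm] M h])
      then show "((\<lambda>x. h i *\<^sub>R conv (h i) (K1 j) f x) has_derivative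
         (\<lambda>e. \<Sum>l\<in>UNIV. e $ l *\<^sub>R (- conv (h i) (K2 l j) f x))) (at x)"
        by (rule has_derivative_eq_rhs)
          (use h[of i] in \<open>simp add: fun_eq_iff scaleR_sum_right sum_negf mult_ac\<close>)
    qed (use q in \<open>auto intro!: summable_mult summable_geometric\<close>)
  qed
  have V2sym: "V2 i j = V2 j i" for i j by (simp add: V2_def[abs_def] K2sym[of i j])
  have holV2: "holder_const \<alpha> (2 * D * F * Cs) UNIV (V2 i j f)"
    if adm: "admissible \<alpha> f" and F: "holder_const \<alpha> F UNIV f" for f F i j
    unfolding holder_const_def
  proof (intro ballI)
    fix x y :: "real^'n"
    let ?d = "norm (x - y)"
    let ?s = "\<lambda>l. - conv (h l) (K2 i j) f x - - conv (h l) (K2 i j) f y"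
    have DF: "D * F \<ge> 0" using D Fnn[OF F] by simp
    have sd1: "norm (?s l) \<le> 2 * D * F * q ^ l" for l
      using norm_triangle_ineq4[of "- conv (h l) (K2 i j) f x" "- conv (h l) (K2 i j) f y"]
        bnd2[OF F, of l i j x] bnd2[OF F, of l i j y] by linarith
    have sd: "norm (?s l) \<le> 2 * D * F * min (((1/2) ^ l) powr \<alpha>) (?d * 2 ^ l * ((1/2) ^ l) powr \<alpha>)" for l
    proof -
      show ?thesis
      \<comment> \<open>For |x - y| \<le> h the increment in units of h has norm at most 1 and the
        Lipschitz estimate applies; otherwise 2^l |x - y| > 1 and the size bound is the smaller
        entry of the minimum.\<close>
      proof (cases "?d \<le> h l")
        case True
        let ?w = "(1 / h l) *\<^sub>R (x - y)"
        have nw: "norm ?w = ?d / h l" using h[of l] by simp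
        have w: "norm ?w \<le> 1" "norm ?w = ?d * 2 ^ l" "y + h l *\<^sub>R ?w = x"
          unfolding nw using True h[of l] by (simp_all add: h_def power_divide divide_simps)
        have "norm (?s l) = norm (conv (h l) (K2 i j) f (y + h l *\<^sub>R ?w) - conv (h l) (K2 i j) f y)"
          unfolding w(3) by (simp add: norm_minus_commute)
        also have "\<dots> \<le> D * F * q ^ l * (?d * 2 ^ l)"
          using kernel.norm_conv_diff_le[OF kK2[of i j] F \<alpha>(1) h[of l] w(1), of y] unfolding w(2)
          by (simp add: D_def h_def qi)
        also have "\<dots> \<le> 2 * (D * F * q ^ l * (?d * 2 ^ l))"
        proof -
          have "0 \<le> D * F * q ^ l * (?d * 2 ^ l)" using D Fnn[OF F] q by (intro mult_nonneg_nonneg) auto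
          then show ?thesis by linarith
        qed
        finally have "norm (?s l) \<le> 2 * D * F * (?d * 2 ^ l * q ^ l)" by (simp add: mult_ac)
        then show ?thesis unfolding qi by (rule le_mult_min[OF sd1])
      next
        case False
        then have "?d * 2 ^ l > 1" by (simp add: h_def field_simps power_divide)
        then have "q ^ l \<le> ?d * 2 ^ l * q ^ l" using q by simp
        then show ?thesis using sd1[of l] unfolding qi by (simp only: min_absorb1)
      qed
    qed
    have sm: "summable ?s" by (intro summable_diff summ2 adm)
    have smn: "summable (\<lambda>l. norm (?s l))"
    proof (rule summable_comparison_test'[where N = 0 and g = "\<lambda>l. 2 * D * F * q ^ l"])
      show "summable (\<lambda>l. 2 * D * F * q ^ l)" using q by (intro summable_mult summable_geometric) simp
      show "norm (norm (?s l)) \<le> 2 * D * F * q ^ l" for l unfolding real_norm_def abs_norm_cancel by (rule sd1)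
    qed
    have "V2 i j f x - V2 i j f y = suminf ?s"
      unfolding V2_def by (rule suminf_diff[OF summ2[OF adm] summ2[OF adm]])
    also have "norm \<dots> \<le> (\<Sum>l. norm (?s l))" by (rule summable_norm[OF smn])
    also have "\<dots> \<le> 2 * D * F * (Cs * ?d powr \<alpha>)"
    proof (rule suminf_le_const[OF smn])
      fix n
      have "(\<Sum>l<n. norm (?s l)) \<le> (\<Sum>l<n. 2 * D * F * min (((1/2) ^ l) powr \<alpha>) (?d * 2 ^ l * ((1/2) ^ l) powr \<alpha>))"
        by (rule sum_mono[OF sd])
      also have "\<dots> \<le> 2 * D * F * (Cs * ?d powr \<alpha>)"
        unfolding sum_distrib_left[symmetric] Cs_def using DF
        by (intro mult_left_mono sum_min_powr_le[OF \<alpha>]) auto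
      finally show "(\<Sum>l<n. norm (?s l)) \<le> 2 * D * F * (Cs * ?d powr \<alpha>)" .
    qed
    finally show "norm (V2 i j f x - V2 i j f y) \<le> 2 * D * F * Cs * ?d powr \<alpha>" by (simp add: mult.assoc)
  qed
  have LV: "(\<Sum>i\<in>UNIV. \<Sum>j\<in>UNIV. a i j *\<^sub>R V2 i j f x) = c *\<^sub>R f x - conv 2 E f x"
    if adm: "admissible \<alpha> f" for f x
  proof -
    obtain F where F: "holder_const \<alpha> F UNIV f" using adm by (auto simp: admissible_def)
    \<comment> \<open>The scale is doubled so that the l-th term of the series is g(l + 1) - g(l);
      the sum runs from g(0), at scale 2, to the limit c f(x).\<close>
    define g where "g l = conv (2 * h l) E f x" for l
    have "(\<Sum>i\<in>UNIV. \<Sum>j\<in>UNIV. a i j *\<^sub>R (- conv (h l) (K2 i j) f x)) = g (Suc l) - g l" for l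
    proof -
      have "(\<Sum>i\<in>UNIV. \<Sum>j\<in>UNIV. a i j *\<^sub>R conv (h l) (K2 i j) f x)
          = conv (h l) (\<lambda>y. \<Sum>p\<in>UNIV. a (fst p) (snd p) * K2 (fst p) (snd p) y) f x"
        by (subst conv_sum_kernel[OF kK2 cont[OF adm]]) (simp add: sum.cartesian_product UNIV_Times_UNIV split_beta)
      also have "(\<lambda>y. \<Sum>p\<in>UNIV. a (fst p) (snd p) * K2 (fst p) (snd p) y) = (\<lambda>y. E ((1/2) *\<^sub>R y) / 2 ^ CARD('n) - E y)"
        unfolding K2E[symmetric] by (simp add: sum.cartesian_product UNIV_Times_UNIV split_beta)
      also have "conv (h l) (\<lambda>y. E ((1/2) *\<^sub>R y) / 2 ^ CARD('n) - E y) f x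
         = (\<integral>y. (E ((1/2) *\<^sub>R y) / 2 ^ DIM(real^'n)) *\<^sub>R f (x + h l *\<^sub>R y) \<partial>lborel) - conv (h l) E f x"
        unfolding conv_def scaleR_diff_left DIM_cart DIM_real mult_1_right
      proof (rule Bochner_Integration.integral_diff)
        show "integrable lborel (\<lambda>y. E y *\<^sub>R f (x + h l *\<^sub>R y))"
          by (rule kernel.integrable_conv0[OF kE cont[OF adm]])
        show "integrable lborel (\<lambda>y. (E ((1/2) *\<^sub>R y) / 2 ^ CARD('n)) *\<^sub>R f (x + h l *\<^sub>R y))"
        proof (rule integrable_compact_support[where r = "2 * r"])
          show "continuous_on UNIV (\<lambda>y. (E ((1/2) *\<^sub>R y) / 2 ^ CARD('n)) *\<^sub>R f (x + h l *\<^sub>R y))"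
            by (intro continuous_intros continuous_on_compose2[OF kernel.continuous[OF kE]] continuous_on_compose2[OF cont[OF adm]]) auto
        qed (simp add: zero)
      qed
      also have "\<dots> = conv (2 * h l) E f x - conv (h l) E f x"
        by (simp only: conv_dilate_kernel[OF kE cont[OF adm]])
      also have "\<dots> = g l - g (Suc l)" by (simp add: g_def h_def)
      finally show ?thesis by (simp add: sum_negf)
    qed
    moreover have "g \<longlonglongrightarrow> c *\<^sub>R f x"
    proof (rule LIM_zero_cancel, rule Lim_null_comparison)
      have "norm (g l - c *\<^sub>R f x) \<le> D * F * (2 powr \<alpha> * q ^ l)" for l
        using kernel.norm_conv_approx_le[OF kE F \<alpha>(1), where h = "2 * h l" and x = x] h[of l]
        by (simp add: g_def c_def D_def h_def powr_mult qi)
      then show "\<forall>\<^sub>F l in sequentially. norm (g l - c *\<^sub>R f x) \<le> D * F * (2 powr \<alpha> * q ^ l)" by simp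
      have "(\<lambda>l. D * F * (2 powr \<alpha> * q ^ l)) \<longlonglongrightarrow> D * F * (2 powr \<alpha> * 0)"
        using q by (intro tendsto_intros LIMSEQ_realpow_zero) auto
      then show "(\<lambda>l. D * F * (2 powr \<alpha> * q ^ l)) \<longlonglongrightarrow> 0" by simp
    qed
    ultimately have "(\<lambda>l. \<Sum>i\<in>UNIV. \<Sum>j\<in>UNIV. a i j *\<^sub>R (- conv (h l) (K2 i j) f x)) sums (c *\<^sub>R f x - g 0)"
      using telescope_sums[of g "c *\<^sub>R f x"] by simp
    moreover have "(\<lambda>l. \<Sum>i\<in>UNIV. \<Sum>j\<in>UNIV. a i j *\<^sub>R (- conv (h l) (K2 i j) f x)) sums
       (\<Sum>i\<in>UNIV. \<Sum>j\<in>UNIV. a i j *\<^sub>R V2 i j f x)"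
      unfolding V2_def by (intro sums_sum sums_scaleR_right summable_sums summ2 adm)
    ultimately show ?thesis using sums_unique2 by (force simp: g_def h_def)
  qed
  \<comment> \<open>The two summands serve the Hessian bound and the error bound; adding 1 makes C
    positive in every case.\<close>
  define C where "C = (2 * D * \<bar>Cs\<bar> + D * 2 powr \<alpha>) / c + 1"
  have C0: "C > 0" using D c by (auto simp: C_def intro!: add_nonneg_pos divide_nonneg_pos)
  show thesis
  proof (rule that[of C "\<lambda>f x. (1 / c) *\<^sub>R V f x" "\<lambda>j f x. (1 / c) *\<^sub>R V1 j f x" "\<lambda>i j f x. (1 / c) *\<^sub>R V2 i j f x"])
    show "C > 0" by (rule C0)
    fix f g :: "real^'n \<Rightarrow> 'b" and x j i assume adm: "admissible \<alpha> f"
    show "((\<lambda>x. (1 / c) *\<^sub>R V f x) has_derivative (\<lambda>e. \<Sum>j\<in>UNIV. e $ j *\<^sub>R (1 / c) *\<^sub>R V1 j f x)) (at x)"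
      using has_derivative_scaleR_right[OF dV[OF adm], of "1/c"] by (simp add: scaleR_sum_right mult.commute)
    show "((\<lambda>x. (1 / c) *\<^sub>R V1 j f x) has_derivative (\<lambda>e. \<Sum>i\<in>UNIV. e $ i *\<^sub>R (1 / c) *\<^sub>R V2 i j f x)) (at x)"
      using has_derivative_scaleR_right[OF dV1[OF adm], of "1/c"] by (simp add: scaleR_sum_right mult.commute)
    {
      fix F assume F: "holder_const \<alpha> F UNIV f"
      have F0: "F \<ge> 0" by (rule Fnn[OF F])
      have "2 * D * F * Cs / c \<le> C * F"
      proof -
        have "2 * D * Cs \<le> 2 * D * \<bar>Cs\<bar> + D * 2 powr \<alpha>"
        proof -
          have "2 * D * Cs \<le> 2 * D * \<bar>Cs\<bar>" using D by (intro mult_left_mono) auto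
          moreover have "0 \<le> D * 2 powr \<alpha>" using D by simp
          ultimately show ?thesis by linarith
        qed
        from divide_right_mono[OF this, of c] have "2 * D * Cs / c \<le> C" using c unfolding C_def by linarith
        then have "2 * D * Cs / c * F \<le> C * F" using F0 by (rule mult_right_mono)
        then show ?thesis by (simp only: mult_ac times_divide_eq_left times_divide_eq_right)
      qed
      show "holder_const \<alpha> (C * F) UNIV (\<lambda>x. (1 / c) *\<^sub>R V2 i j f x)"
        unfolding holder_const_def
      proof (intro ballI)
        fix x y :: "real^'n"
        have "norm ((1 / c) *\<^sub>R V2 i j f x - (1 / c) *\<^sub>R V2 i j f y) = norm (V2 i j f x - V2 i j f y) / c"
          using c by (simp add: scaleR_diff_right[symmetric] del: scaleR_diff_right)
        also have "\<dots> \<le> (2 * D * F * Cs * norm (x - y) powr \<alpha>) / c"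
          using c by (intro divide_right_mono holder_constD[OF holV2[OF adm F]]) auto
        also have "\<dots> = (2 * D * F * Cs / c) * norm (x - y) powr \<alpha>" by simp
        also have "\<dots> \<le> C * F * norm (x - y) powr \<alpha>"
          using \<open>2 * D * F * Cs / c \<le> C * F\<close> by (intro mult_right_mono) auto
        finally show "norm ((1 / c) *\<^sub>R V2 i j f x - (1 / c) *\<^sub>R V2 i j f y) \<le> C * F * norm (x - y) powr \<alpha>" .
      qed
      fix y assume xy: "norm (x - y) \<le> 1"
      have eq: "(\<Sum>i\<in>UNIV. \<Sum>j\<in>UNIV. a i j *\<^sub>R (1 / c) *\<^sub>R V2 i j f x) - f x = - (1 / c) *\<^sub>R conv 2 E f x" for x
      proof -
        have "(\<Sum>i\<in>UNIV. \<Sum>j\<in>UNIV. a i j *\<^sub>R (1 / c) *\<^sub>R V2 i j f x)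
          = (1 / c) *\<^sub>R (\<Sum>i\<in>UNIV. \<Sum>j\<in>UNIV. a i j *\<^sub>R V2 i j f x)"
          by (simp add: scaleR_sum_right mult.commute)
        also have "\<dots> = f x - (1 / c) *\<^sub>R conv 2 E f x" unfolding LV[OF adm] using c by (simp add: scaleR_diff_right)
        finally show ?thesis by simp
      qed
      \<comment> \<open>The remaining bump lives at scale 2, so x is written as y + 2 w with |w|
        \<le> 1.\<close>
      let ?w = "(1/2) *\<^sub>R (x - y)"
      have w: "norm ?w \<le> 1" "y + 2 *\<^sub>R ?w = x" using xy by auto
      have "norm (- (1 / c) *\<^sub>R conv 2 E f x - - (1 / c) *\<^sub>R conv 2 E f y) = norm (conv 2 E f (y + 2 *\<^sub>R ?w) - conv 2 E f y) / c"
        unfolding w(2) using c by (simp add: scaleR_diff_right[symmetric] norm_minus_commute del: scaleR_diff_right)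
      also have "\<dots> \<le> (D * F * 2 powr \<alpha> * (norm (x - y) / 2)) / c"
        using kernel.norm_conv_diff_le[OF kE F \<alpha>(1) _ w(1), where h = 2 and x = y] c
        by (intro divide_right_mono) (auto simp: D_def)
      also have "\<dots> \<le> (D * 2 powr \<alpha> / c) * (F * norm (x - y))"
        using D F0 c by (simp add: divide_simps mult_ac)
      also have "\<dots> \<le> C * (F * norm (x - y))"
        using D F0 c by (intro mult_right_mono) (auto simp: C_def add_divide_distrib)
      finally show "norm ((\<Sum>i\<in>UNIV. \<Sum>j\<in>UNIV. a i j *\<^sub>R (1 / c) *\<^sub>R V2 i j f x) - f x
        - ((\<Sum>i\<in>UNIV. \<Sum>j\<in>UNIV. a i j *\<^sub>R (1 / c) *\<^sub>R V2 i j f y) - f y)) \<le> C * F * norm (x - y)"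
        unfolding eq by (simp add: mult.assoc)
    }
    assume admg: "admissible \<alpha> g"
    note cd = conv_diff[OF _ cont[OF adm] cont[OF admg]]
    have "V (\<lambda>x. f x - g x) x = V f x - V g x"
      unfolding V_def cd[OF kK] scaleR_diff_right by (rule suminf_diff[symmetric]; rule summ; fact)
    then show "(1 / c) *\<^sub>R V (\<lambda>x. f x - g x) x = (1 / c) *\<^sub>R V f x - (1 / c) *\<^sub>R V g x"
      by (simp only: scaleR_diff_right)
    have "V1 j (\<lambda>x. f x - g x) x = V1 j f x - V1 j g x"
      unfolding V1_def cd[OF kK1] scaleR_diff_right by (rule suminf_diff[symmetric]; rule summ; fact)
    then show "(1 / c) *\<^sub>R V1 j (\<lambda>x. f x - g x) x = (1 / c) *\<^sub>R V1 j f x - (1 / c) *\<^sub>R V1 j g x"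
      by (simp only: scaleR_diff_right)
    have "V2 i j (\<lambda>x. f x - g x) x = V2 i j f x - V2 i j g x"
      using suminf_diff[OF summ2[OF adm, of i j x] summ2[OF admg, of i j x]]
      unfolding V2_def cd[OF kK2] by simp
    then show "(1 / c) *\<^sub>R V2 i j (\<lambda>x. f x - g x) x = (1 / c) *\<^sub>R V2 i j f x - (1 / c) *\<^sub>R V2 i j g x"
      by (simp only: scaleR_diff_right)
  qed (simp add: V2sym)
qed

lemma has_derivative_quadratic_form:
  fixes m :: "'n::finite \<Rightarrow> 'n \<Rightarrow> 'b::real_normed_vector"
  assumes m: "\<And>i j. m i j = m j i"
  shows "((\<lambda>x::real^'n. (1/2) *\<^sub>R (\<Sum>j\<in>UNIV. \<Sum>i\<in>UNIV. (x $ i * x $ j) *\<^sub>R m i j)) has_derivative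
    (\<lambda>e. \<Sum>j\<in>UNIV. e $ j *\<^sub>R (\<Sum>i\<in>UNIV. x $ i *\<^sub>R m i j))) (at x)"
proof -
  have vn: "((\<lambda>x::real^'n. x $ i) has_derivative (\<lambda>e. e $ i)) (at x)" for i
    by (rule bounded_linear_imp_has_derivative[OF bounded_linear_vec_nth])
  have "((\<lambda>x::real^'n. (1/2) *\<^sub>R (\<Sum>j\<in>UNIV. \<Sum>i\<in>UNIV. (x $ i * x $ j) *\<^sub>R m i j)) has_derivative
    (\<lambda>e. (1/2) *\<^sub>R (\<Sum>j\<in>UNIV. \<Sum>i\<in>UNIV. (x $ i * e $ j + e $ i * x $ j) *\<^sub>R m i j))) (at x)"
    by (intro has_derivative_scaleR_right has_derivative_sum has_derivative_scaleR_left has_derivative_mult vn)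
  moreover have "(1/2) *\<^sub>R (\<Sum>j\<in>UNIV. \<Sum>i\<in>UNIV. (x $ i * e $ j + e $ i * x $ j) *\<^sub>R m i j)
    = (\<Sum>j\<in>UNIV. e $ j *\<^sub>R (\<Sum>i\<in>UNIV. x $ i *\<^sub>R m i j))" for e :: "real^'n"
  proof -
    have "(\<Sum>j\<in>UNIV. \<Sum>i\<in>UNIV. (e $ i * x $ j) *\<^sub>R m i j) = (\<Sum>j\<in>UNIV. \<Sum>i\<in>UNIV. (e $ j * x $ i) *\<^sub>R m i j)"
      by (subst sum.swap) (intro sum.cong refl arg_cong2[where f = scaleR] m)
    then have "(\<Sum>j\<in>UNIV. \<Sum>i\<in>UNIV. (x $ i * e $ j + e $ i * x $ j) *\<^sub>R m i j)
      = 2 *\<^sub>R (\<Sum>j\<in>UNIV. \<Sum>i\<in>UNIV. (e $ j * x $ i) *\<^sub>R m i j)"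
      by (simp add: scaleR_add_left sum.distrib scaleR_2 mult.commute)
    then show ?thesis by (simp add: scaleR_sum_right)
  qed
  ultimately show ?thesis by simp
qed

text \<open>The second-order Taylor polynomial at 0 is subtracted from N f. Its Hessian is constant,
  so the Hoelder seminorms of the second derivatives and the error estimate for differences are
  unaffected. Symmetry of \<open>N2\<close> is used to differentiate the quadratic part.\<close>

lemma parametrix:
  fixes a :: "'n::finite \<Rightarrow> 'n \<Rightarrow> real"
  assumes "lam > 0"
    and pos: "\<And>\<xi> :: real^'n. (\<Sum>i\<in>UNIV. \<Sum>j\<in>UNIV. a i j * \<xi> $ i * \<xi> $ j) \<ge> lam * (norm \<xi>)\<^sup>2"
    and \<alpha>: "0 < \<alpha>" "\<alpha> < 1"
  obtains C and N :: "(real^'n \<Rightarrow> 'b::{banach, second_countable_topology}) \<Rightarrow> real^'n \<Rightarrow> 'b" and N1 N2 where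
    "C > 0"
    "\<And>f x. admissible \<alpha> f \<Longrightarrow> (N f has_derivative (\<lambda>e. \<Sum>j\<in>UNIV. e $ j *\<^sub>R N1 j f x)) (at x)"
    "\<And>f j x. admissible \<alpha> f \<Longrightarrow> (N1 j f has_derivative (\<lambda>e. \<Sum>i\<in>UNIV. e $ i *\<^sub>R N2 i j f x)) (at x)"
    "\<And>f F i j. admissible \<alpha> f \<Longrightarrow> holder_const \<alpha> F UNIV f \<Longrightarrow> holder_const \<alpha> (C * F) UNIV (N2 i j f)"
    "\<And>f F x y. admissible \<alpha> f \<Longrightarrow> holder_const \<alpha> F UNIV f \<Longrightarrow> norm (x - y) \<le> 1 \<Longrightarrow>
      norm (((\<Sum>i\<in>UNIV. \<Sum>j\<in>UNIV. a i j *\<^sub>R N2 i j f x) - f x)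
        - ((\<Sum>i\<in>UNIV. \<Sum>j\<in>UNIV. a i j *\<^sub>R N2 i j f y) - f y)) \<le> C * F * norm (x - y)"
    "\<And>f g x. admissible \<alpha> f \<Longrightarrow> admissible \<alpha> g \<Longrightarrow> N (\<lambda>x. f x - g x) x = N f x - N g x"
    "\<And>f g j x. admissible \<alpha> f \<Longrightarrow> admissible \<alpha> g \<Longrightarrow> N1 j (\<lambda>x. f x - g x) x = N1 j f x - N1 j g x"
    "\<And>f g i j x. admissible \<alpha> f \<Longrightarrow> admissible \<alpha> g \<Longrightarrow> N2 i j (\<lambda>x. f x - g x) x = N2 i j f x - N2 i j g x"
    "\<And>f. N f 0 = 0" "\<And>j f. N1 j f 0 = 0" "\<And>i j f. N2 i j f 0 = 0"
proof -
  obtain C and N :: "(real^'n \<Rightarrow> 'b) \<Rightarrow> real^'n \<Rightarrow> 'b" and N1 N2 where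
    C: "C > 0" and
    dN: "\<And>f x. admissible \<alpha> f \<Longrightarrow> (N f has_derivative (\<lambda>e. \<Sum>j\<in>UNIV. e $ j *\<^sub>R N1 j f x)) (at x)" and
    dN1: "\<And>f j x. admissible \<alpha> f \<Longrightarrow> (N1 j f has_derivative (\<lambda>e. \<Sum>i\<in>UNIV. e $ i *\<^sub>R N2 i j f x)) (at x)" and
    sym: "\<And>i j. N2 i j = N2 j i" and
    hol: "\<And>f F i j. admissible \<alpha> f \<Longrightarrow> holder_const \<alpha> F UNIV f \<Longrightarrow> holder_const \<alpha> (C * F) UNIV (N2 i j f)" and
    err: "\<And>f F x y. admissible \<alpha> f \<Longrightarrow> holder_const \<alpha> F UNIV f \<Longrightarrow> norm (x - y) \<le> 1 \<Longrightarrow>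
      norm (((\<Sum>i\<in>UNIV. \<Sum>j\<in>UNIV. a i j *\<^sub>R N2 i j f x) - f x)
        - ((\<Sum>i\<in>UNIV. \<Sum>j\<in>UNIV. a i j *\<^sub>R N2 i j f y) - f y)) \<le> C * F * norm (x - y)" and
    diff: "\<And>f g x. admissible \<alpha> f \<Longrightarrow> admissible \<alpha> g \<Longrightarrow> N (\<lambda>x. f x - g x) x = N f x - N g x"
    "\<And>f g j x. admissible \<alpha> f \<Longrightarrow> admissible \<alpha> g \<Longrightarrow> N1 j (\<lambda>x. f x - g x) x = N1 j f x - N1 j g x"
    "\<And>f g i j x. admissible \<alpha> f \<Longrightarrow> admissible \<alpha> g \<Longrightarrow> N2 i j (\<lambda>x. f x - g x) x = N2 i j f x - N2 i j g x"
    using parametrix_raw[OF \<open>lam > 0\<close> pos \<alpha>] by blast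
  show thesis
  proof (rule that[of C
      "\<lambda>f x. N f x - N f 0 - (\<Sum>j\<in>UNIV. x $ j *\<^sub>R N1 j f 0) - (1/2) *\<^sub>R (\<Sum>j\<in>UNIV. \<Sum>i\<in>UNIV. (x $ i * x $ j) *\<^sub>R N2 i j f 0)"
      "\<lambda>j f x. N1 j f x - N1 j f 0 - (\<Sum>i\<in>UNIV. x $ i *\<^sub>R N2 i j f 0)"
      "\<lambda>i j f x. N2 i j f x - N2 i j f 0"])
    show "C > 0" by fact
    fix f g :: "real^'n \<Rightarrow> 'b" and x i j assume adm: "admissible \<alpha> f"
    have lin: "((\<lambda>x::real^'n. \<Sum>j\<in>UNIV. x $ j *\<^sub>R w j) has_derivative (\<lambda>e. \<Sum>j\<in>UNIV. e $ j *\<^sub>R w j)) (at x)" for w :: "'n \<Rightarrow> 'b"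
      by (intro bounded_linear_imp_has_derivative bounded_linear_sum bounded_linear_scaleR_left[THEN bounded_linear_compose] bounded_linear_vec_nth)
    have "((\<lambda>x. N f x - N f 0 - (\<Sum>j\<in>UNIV. x $ j *\<^sub>R N1 j f 0) - (1/2) *\<^sub>R (\<Sum>j\<in>UNIV. \<Sum>i\<in>UNIV. (x $ i * x $ j) *\<^sub>R N2 i j f 0))
      has_derivative (\<lambda>e. (\<Sum>j\<in>UNIV. e $ j *\<^sub>R N1 j f x) - 0 - (\<Sum>j\<in>UNIV. e $ j *\<^sub>R N1 j f 0)
        - (\<Sum>j\<in>UNIV. e $ j *\<^sub>R (\<Sum>i\<in>UNIV. x $ i *\<^sub>R N2 i j f 0)))) (at x)"
      by (intro has_derivative_diff dN[OF adm] has_derivative_const lin has_derivative_quadratic_form) (simp add: sym)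
    then show "((\<lambda>x. N f x - N f 0 - (\<Sum>j\<in>UNIV. x $ j *\<^sub>R N1 j f 0) - (1/2) *\<^sub>R (\<Sum>j\<in>UNIV. \<Sum>i\<in>UNIV. (x $ i * x $ j) *\<^sub>R N2 i j f 0))
      has_derivative (\<lambda>e. \<Sum>j\<in>UNIV. e $ j *\<^sub>R (N1 j f x - N1 j f 0 - (\<Sum>i\<in>UNIV. x $ i *\<^sub>R N2 i j f 0)))) (at x)"
      by (simp add: sum_subtractf scaleR_diff_right)
    have "((\<lambda>x. N1 j f x - N1 j f 0 - (\<Sum>i\<in>UNIV. x $ i *\<^sub>R N2 i j f 0))
      has_derivative (\<lambda>e. (\<Sum>i\<in>UNIV. e $ i *\<^sub>R N2 i j f x) - 0 - (\<Sum>i\<in>UNIV. e $ i *\<^sub>R N2 i j f 0))) (at x)"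
      by (intro has_derivative_diff dN1[OF adm] has_derivative_const lin)
    then show "((\<lambda>x. N1 j f x - N1 j f 0 - (\<Sum>i\<in>UNIV. x $ i *\<^sub>R N2 i j f 0))
      has_derivative (\<lambda>e. \<Sum>i\<in>UNIV. e $ i *\<^sub>R (N2 i j f x - N2 i j f 0))) (at x)"
      by (simp add: sum_subtractf scaleR_diff_right)
    {
      fix F assume F: "holder_const \<alpha> F UNIV f"
      show "holder_const \<alpha> (C * F) UNIV (\<lambda>x. N2 i j f x - N2 i j f 0)"
        using hol[OF adm F, of i j] unfolding holder_const_def by simp
      fix y assume "norm (x - y) \<le> 1"
      from err[OF adm F this]
      show "norm (((\<Sum>i\<in>UNIV. \<Sum>j\<in>UNIV. a i j *\<^sub>R (N2 i j f x - N2 i j f 0)) - f x)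
        - ((\<Sum>i\<in>UNIV. \<Sum>j\<in>UNIV. a i j *\<^sub>R (N2 i j f y - N2 i j f 0)) - f y)) \<le> C * F * norm (x - y)"
        by (simp add: scaleR_diff_right sum_subtractf)
    }
    assume admg: "admissible \<alpha> g"
    note d = diff[OF adm admg]
    show "N (\<lambda>x. f x - g x) x - N (\<lambda>x. f x - g x) 0 - (\<Sum>j\<in>UNIV. x $ j *\<^sub>R N1 j (\<lambda>x. f x - g x) 0)
        - (1/2) *\<^sub>R (\<Sum>j\<in>UNIV. \<Sum>i\<in>UNIV. (x $ i * x $ j) *\<^sub>R N2 i j (\<lambda>x. f x - g x) 0)
      = (N f x - N f 0 - (\<Sum>j\<in>UNIV. x $ j *\<^sub>R N1 j f 0) - (1/2) *\<^sub>R (\<Sum>j\<in>UNIV. \<Sum>i\<in>UNIV. (x $ i * x $ j) *\<^sub>R N2 i j f 0))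
      - (N g x - N g 0 - (\<Sum>j\<in>UNIV. x $ j *\<^sub>R N1 j g 0) - (1/2) *\<^sub>R (\<Sum>j\<in>UNIV. \<Sum>i\<in>UNIV. (x $ i * x $ j) *\<^sub>R N2 i j g 0))"
      unfolding d by (simp only: scaleR_diff_right sum_subtractf) simp
    show "N1 j (\<lambda>x. f x - g x) x - N1 j (\<lambda>x. f x - g x) 0 - (\<Sum>i\<in>UNIV. x $ i *\<^sub>R N2 i j (\<lambda>x. f x - g x) 0)
      = (N1 j f x - N1 j f 0 - (\<Sum>i\<in>UNIV. x $ i *\<^sub>R N2 i j f 0)) - (N1 j g x - N1 j g 0 - (\<Sum>i\<in>UNIV. x $ i *\<^sub>R N2 i j g 0))"
      unfolding d by (simp only: scaleR_diff_right sum_subtractf) simp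
    show "N2 i j (\<lambda>x. f x - g x) x - N2 i j (\<lambda>x. f x - g x) 0 = (N2 i j f x - N2 i j f 0) - (N2 i j g x - N2 i j g 0)"
      unfolding d by simp
  qed simp_all
qed

section \<open>Quantitative C^{1,\<alpha>} bounds and second differences\<close>

lemma lipschitz_of_partials:
  fixes g :: "real^'n \<Rightarrow> 'b::real_normed_vector"
  assumes deriv: "\<And>x. x \<in> S \<Longrightarrow> (g has_derivative (\<lambda>e. \<Sum>j\<in>UNIV. e $ j *\<^sub>R T j x)) (at x)"
    and le: "\<And>j x. x \<in> S \<Longrightarrow> norm (T j x) \<le> B" and "convex S" "x \<in> S" "y \<in> S"
  shows "norm (g x - g y) \<le> real CARD('n) * B * norm (x - y)"
proof (rule differentiable_bound[OF \<open>convex S\<close>, where f' = "\<lambda>x e. \<Sum>j\<in>UNIV. e $ j *\<^sub>R T j x"])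
  fix z assume z: "z \<in> S"
  show "(g has_derivative (\<lambda>e. \<Sum>j\<in>UNIV. e $ j *\<^sub>R T j z)) (at z within S)"
    by (rule has_derivative_at_withinI[OF deriv[OF z]])
  show "onorm (\<lambda>e. \<Sum>j\<in>UNIV. e $ j *\<^sub>R T j z) \<le> real CARD('n) * B"
  proof (rule onorm_le)
    fix e :: "real^'n"
    have "norm (\<Sum>j\<in>UNIV. e $ j *\<^sub>R T j z) \<le> (\<Sum>j\<in>(UNIV::'n set). norm e * B)"
      using le[OF z] component_le_norm_cart[of e] by (intro sum_norm_le) (auto intro!: mult_mono)
    then show "norm (\<Sum>j\<in>UNIV. e $ j *\<^sub>R T j z) \<le> real CARD('n) * B * norm e" by (simp add: mult_ac)
  qed
qed (use assms in auto)

text \<open>C^{1,\<alpha>} on a closed ball, with one constant for the derivative and for its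
  Hoelder seminorm. The derivative is the full one even on the sphere, which suits balls in the
  interior of the domain of G.\<close>

definition C1_ball :: "real \<Rightarrow> 'a::real_normed_vector \<Rightarrow> real \<Rightarrow> real \<Rightarrow> ('a \<Rightarrow> 'b::real_normed_vector) \<Rightarrow> bool"
  where "C1_ball \<alpha> z0 \<rho> A G \<longleftrightarrow> (\<exists>G'. \<forall>z\<in>cball z0 \<rho>. (G has_derivative G' z) (at z) \<and>
    (\<forall>h. norm (G' z h) \<le> A * norm h \<and>
      (\<forall>z'\<in>cball z0 \<rho>. norm (G' z h - G' z' h) \<le> A * norm (z - z') powr \<alpha> * norm h)))"

lemma C1_holder_loc_on_imp_C1_ball:
  fixes G :: "'a::euclidean_space \<Rightarrow> 'b::real_normed_vector"
  assumes G: "C1_holder_loc_on \<alpha> S G" and z0: "z0 \<in> interior S" and \<alpha>: "\<alpha> > 0"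
  obtains \<rho> A where "\<rho> > 0" "A \<ge> 0" "cball z0 \<rho> \<subseteq> S" "C1_ball \<alpha> z0 \<rho> A G"
proof -
  obtain e0 where e0: "e0 > 0" "ball z0 e0 \<subseteq> interior S"
    using z0 open_interior open_contains_ball by blast
  have z0S: "z0 \<in> S" using z0 interior_subset by blast
  have "\<exists>e>0. holder_on \<alpha> (S \<inter> ball z0 e) (partial_in S b G)" if "b \<in> Basis" for b
    using G z0S that unfolding C1_holder_loc_on_def locally_holder_on_def by blast
  then obtain e where e: "\<And>b. b \<in> Basis \<Longrightarrow> e b > 0 \<and> holder_on \<alpha> (S \<inter> ball z0 (e b)) (partial_in S b G)"
    by metis
  then have "\<forall>b\<in>Basis. \<exists>c. \<forall>x\<in>S \<inter> ball z0 (e b). \<forall>y\<in>S \<inter> ball z0 (e b). 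
      dist (partial_in S b G x) (partial_in S b G y) \<le> c * dist x y powr \<alpha>"
    unfolding holder_on_def by blast
  then obtain c where c: "\<And>b x y. b \<in> Basis \<Longrightarrow> x \<in> S \<inter> ball z0 (e b) \<Longrightarrow> y \<in> S \<inter> ball z0 (e b) \<Longrightarrow>
      dist (partial_in S b G x) (partial_in S b G y) \<le> c b * dist x y powr \<alpha>"
    by metis
  \<comment> \<open>The entry 1 gives |z - z0|^\<alpha> \<le> 1, and halving puts the closed ball
    inside all the open ones.\<close>
  define \<rho> where "\<rho> = Min (insert e0 (insert 1 (e ` Basis))) / 2"
  have \<rho>: "\<rho> > 0" unfolding \<rho>_def using e0 e by (auto simp: Min_gr_iff)
  have m: "2 * \<rho> = Min (insert e0 (insert 1 (e ` Basis)))" by (simp add: \<rho>_def)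
  have "2 * \<rho> \<le> e0" "2 * \<rho> \<le> 1" and \<rho>b: "\<And>b. b \<in> Basis \<Longrightarrow> 2 * \<rho> \<le> e b"
    unfolding m by (rule Min_le; simp)+
  then have \<rho>e: "\<rho> < e0" "\<rho> \<le> 1" "\<And>b. b \<in> Basis \<Longrightarrow> \<rho> < e b" using \<rho> \<rho>b by (auto, smt (verit))
  have sub: "cball z0 \<rho> \<subseteq> interior S" using \<rho>e(1) e0(2) by (auto simp: subset_iff)
  then have subS: "cball z0 \<rho> \<subseteq> S" using interior_subset by blast
  define P where "P b z = partial_in S b G z" for b z
  define G' where "G' z = frechet_derivative G (at z)" for z
  have dG: "(G has_derivative G' z) (at z)" if "z \<in> cball z0 \<rho>" for z
  proof -
    have "G differentiable (at z within S)" using G subS that unfolding C1_holder_loc_on_def differentiable_on_def by blast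
    then have "G differentiable (at z)" using at_within_interior[of z S] sub that by auto
    then show ?thesis unfolding G'_def using frechet_derivative_works by blast
  qed
  have G'P: "G' z h = (\<Sum>b\<in>Basis. (h \<bullet> b) *\<^sub>R P b z)" if "z \<in> cball z0 \<rho>" for z h
  proof -
    have lin: "linear (G' z)" using dG[OF that] has_derivative_linear by blast
    have Gb: "G' z b = P b z" for b
      unfolding P_def partial_in_def G'_def using at_within_interior[of z S] sub that by (metis subsetD)
    have "G' z (\<Sum>b\<in>Basis. (h \<bullet> b) *\<^sub>R b) = (\<Sum>b\<in>Basis. (h \<bullet> b) *\<^sub>R G' z b)"
      by (simp only: linear_sum[OF lin] linear_scale[OF lin])
    then show ?thesis unfolding Gb euclidean_representation .
  qed
  have Phol: "norm (P b z - P b z') \<le> \<bar>c b\<bar> * norm (z - z') powr \<alpha>"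
    if "b \<in> Basis" "z \<in> cball z0 \<rho>" "z' \<in> cball z0 \<rho>" for b z z'
  proof -
    have "dist (P b z) (P b z') \<le> c b * dist z z' powr \<alpha>"
      unfolding P_def using that \<rho>e(3)[OF that(1)] subS by (intro c) auto
    also have "\<dots> \<le> \<bar>c b\<bar> * dist z z' powr \<alpha>" by (intro mult_right_mono) auto
    finally show ?thesis by (simp add: dist_norm)
  qed
  \<comment> \<open>The Hoelder constants bound the oscillation of the partials, and with the values
    at z0 also their size.\<close>
  define A where "A = (\<Sum>b\<in>Basis. \<bar>c b\<bar> + norm (P b z0))"
  have A: "A \<ge> 0" unfolding A_def by (intro sum_nonneg) auto
  have "norm (G' z h) \<le> A * norm h" if z: "z \<in> cball z0 \<rho>" for z h
  proof -
    have "norm (P b z) \<le> \<bar>c b\<bar> + norm (P b z0)" if b: "b \<in> Basis" for b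
    proof -
      have "norm (z - z0) powr \<alpha> \<le> 1 powr \<alpha>" using z \<rho>e(2) \<alpha> by (intro powr_mono2) (auto simp: dist_norm norm_minus_commute)
      then have "\<bar>c b\<bar> * norm (z - z0) powr \<alpha> \<le> \<bar>c b\<bar> * 1" by (intro mult_left_mono) auto
      then have "norm (P b z - P b z0) \<le> \<bar>c b\<bar>" using Phol[OF b z, of z0] \<rho> by auto
      then show ?thesis using norm_triangle_ineq2[of "P b z" "P b z0"] by linarith
    qed
    then have "norm (\<Sum>b\<in>Basis. (h \<bullet> b) *\<^sub>R P b z) \<le> (\<Sum>b\<in>Basis. norm h * (\<bar>c b\<bar> + norm (P b z0)))"
      by (intro sum_norm_le) (auto intro!: mult_mono Basis_le_norm)
    then show ?thesis unfolding G'P[OF z] A_def by (simp add: sum_distrib_left mult.commute)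
  qed
  moreover have "norm (G' z h - G' z' h) \<le> A * norm (z - z') powr \<alpha> * norm h"
    if z: "z \<in> cball z0 \<rho>" "z' \<in> cball z0 \<rho>" for z z' h
  proof -
    have "norm (\<Sum>b\<in>Basis. (h \<bullet> b) *\<^sub>R (P b z - P b z')) \<le> (\<Sum>b\<in>Basis. norm h * ((\<bar>c b\<bar> + norm (P b z0)) * norm (z - z') powr \<alpha>))"
    proof (rule sum_norm_le)
      fix b :: 'a assume b: "b \<in> Basis"
      have "norm (P b z - P b z') \<le> (\<bar>c b\<bar> + norm (P b z0)) * norm (z - z') powr \<alpha>"
        by (rule order_trans[OF Phol[OF b z]]) (intro mult_right_mono, auto)
      then show "norm ((h \<bullet> b) *\<^sub>R (P b z - P b z')) \<le> norm h * ((\<bar>c b\<bar> + norm (P b z0)) * norm (z - z') powr \<alpha>)"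
        using b by (auto intro!: mult_mono Basis_le_norm)
    qed
    then show ?thesis unfolding G'P[OF z(1)] G'P[OF z(2)] A_def
      by (simp add: sum_subtractf scaleR_diff_right sum_distrib_left sum_distrib_right mult_ac)
  qed
  ultimately have "C1_ball \<alpha> z0 \<rho> A G" unfolding C1_ball_def using dG by blast
  with \<rho> A subS show thesis by (rule that)
qed

text \<open>The segments from p2 to p1 and from p4 to p3 are run through with a common parameter, as
  P and Q. The derivative of G(P) - G(Q) splits into G'(P) on the difference of the two directions,
  bounded by A, and G'(P) - G'(Q) on p3 - p4, where Hoelder continuity of G' gives
  M^\<alpha>.\<close>

lemma four_point_bound:
  fixes G :: "'a::real_normed_vector \<Rightarrow> 'b::real_normed_vector"
  assumes K: "convex K" and dG: "\<And>z. z \<in> K \<Longrightarrow> (G has_derivative G' z) (at z)"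
    and bd: "\<And>z h. z \<in> K \<Longrightarrow> norm (G' z h) \<le> A * norm h"
    and hol: "\<And>z z' h. z \<in> K \<Longrightarrow> z' \<in> K \<Longrightarrow> norm (G' z h - G' z' h) \<le> A * norm (z - z') powr \<alpha> * norm h"
    and p: "p1 \<in> K" "p2 \<in> K" "p3 \<in> K" "p4 \<in> K" and M: "norm (p2 - p4) \<le> M" "norm (p1 - p3) \<le> M"
    and A: "A \<ge> 0" "\<alpha> > 0"
  shows "norm ((G p1 - G p2) - (G p3 - G p4)) \<le> A * norm ((p1 - p2) - (p3 - p4)) + A * M powr \<alpha> * norm (p3 - p4)"
proof -
  define P where "P t = p2 + t *\<^sub>R (p1 - p2)" for t
  define Q where "Q t = p4 + t *\<^sub>R (p3 - p4)" for t
  have PQ: "P t \<in> K" "Q t \<in> K" "norm (P t - Q t) \<le> M" if "t \<in> {0..1}" for t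
  proof -
    have e: "P t = (1 - t) *\<^sub>R p2 + t *\<^sub>R p1" "Q t = (1 - t) *\<^sub>R p4 + t *\<^sub>R p3"
      by (simp_all add: P_def Q_def algebra_simps)
    show "P t \<in> K" "Q t \<in> K" unfolding e using that K p by (auto intro!: convexD)
    have "P t - Q t = (1 - t) *\<^sub>R (p2 - p4) + t *\<^sub>R (p1 - p3)" unfolding e by (simp add: algebra_simps)
    then have "norm (P t - Q t) \<le> (1 - t) * norm (p2 - p4) + t * norm (p1 - p3)"
      using norm_triangle_ineq[of "(1 - t) *\<^sub>R (p2 - p4)" "t *\<^sub>R (p1 - p3)"] that by simp
    also have "\<dots> \<le> (1 - t) * M + t * M" using that M by (intro add_mono mult_left_mono) auto
    finally show "norm (P t - Q t) \<le> M" by (simp add: algebra_simps)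
  qed
  let ?B = "A * norm ((p1 - p2) - (p3 - p4)) + A * M powr \<alpha> * norm (p3 - p4)"
  have "norm ((G (P 1) - G (Q 1)) - (G (P 0) - G (Q 0))) \<le> ?B * norm (1 - 0 :: real)"
  proof (rule differentiable_bound[of "{0..1}" "\<lambda>t. G (P t) - G (Q t)" "\<lambda>t s. G' (P t) (s *\<^sub>R (p1 - p2)) - G' (Q t) (s *\<^sub>R (p3 - p4))"])
    fix t :: real assume t: "t \<in> {0..1}"
    have "(P has_derivative (\<lambda>s. s *\<^sub>R (p1 - p2))) (at t)" "(Q has_derivative (\<lambda>s. s *\<^sub>R (p3 - p4))) (at t)"
      unfolding P_def[abs_def] Q_def[abs_def] by (auto intro!: derivative_eq_intros)
    from has_derivative_compose[OF this(1) dG[OF PQ(1)[OF t]]] has_derivative_compose[OF this(2) dG[OF PQ(2)[OF t]]]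
    show "((\<lambda>t. G (P t) - G (Q t)) has_derivative (\<lambda>s. G' (P t) (s *\<^sub>R (p1 - p2)) - G' (Q t) (s *\<^sub>R (p3 - p4)))) (at t within {0..1})"
      by (intro has_derivative_at_withinI[OF has_derivative_diff]) auto
    have lP: "linear (G' (P t))" and lQ: "linear (G' (Q t))"
      using dG[OF PQ(1)[OF t]] dG[OF PQ(2)[OF t]] has_derivative_linear by blast+
    show "onorm (\<lambda>s. G' (P t) (s *\<^sub>R (p1 - p2)) - G' (Q t) (s *\<^sub>R (p3 - p4))) \<le> ?B"
    proof (rule onorm_le)
      fix s :: real
      have "G' (P t) (p1 - p2) - G' (Q t) (p3 - p4)
        = G' (P t) ((p1 - p2) - (p3 - p4)) + (G' (P t) (p3 - p4) - G' (Q t) (p3 - p4))"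
        by (simp only: linear_diff[OF lP]) simp
      also have "norm \<dots> \<le> A * norm ((p1 - p2) - (p3 - p4)) + A * M powr \<alpha> * norm (p3 - p4)"
      proof (rule order_trans[OF norm_triangle_ineq], rule add_mono[OF bd[OF PQ(1)[OF t]]])
        have "norm (P t - Q t) powr \<alpha> \<le> M powr \<alpha>" using PQ(3)[OF t] A by (intro powr_mono2) auto
        then have "A * norm (P t - Q t) powr \<alpha> * norm (p3 - p4) \<le> A * M powr \<alpha> * norm (p3 - p4)"
          using A by (intro mult_right_mono mult_left_mono) auto
        then show "norm (G' (P t) (p3 - p4) - G' (Q t) (p3 - p4)) \<le> A * M powr \<alpha> * norm (p3 - p4)"
          using hol[OF PQ(1,2)[OF t], of "p3 - p4"] by linarith
      qed
      finally have "norm (G' (P t) (p1 - p2) - G' (Q t) (p3 - p4)) \<le> ?B" .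
      then have "\<bar>s\<bar> * norm (G' (P t) (p1 - p2) - G' (Q t) (p3 - p4)) \<le> \<bar>s\<bar> * ?B" by (intro mult_left_mono) auto
      moreover have "G' (P t) (s *\<^sub>R (p1 - p2)) - G' (Q t) (s *\<^sub>R (p3 - p4)) = s *\<^sub>R (G' (P t) (p1 - p2) - G' (Q t) (p3 - p4))"
        unfolding linear_scale[OF lP] linear_scale[OF lQ] by (rule scaleR_diff_right[symmetric])
      ultimately show "norm (G' (P t) (s *\<^sub>R (p1 - p2)) - G' (Q t) (s *\<^sub>R (p3 - p4))) \<le> ?B * norm s"
        by (simp add: mult.commute)
    qed
  qed auto
  moreover have "(G (P 1) - G (Q 1)) - (G (P 0) - G (Q 0)) = (G p1 - G p2) - (G p3 - G p4)"
    by (simp add: P_def Q_def)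
  ultimately show ?thesis by simp
qed

section \<open>Contraction in the Hoelder seminorm\<close>

text \<open>Vanishing at 0 makes the seminorm a norm and, for R \<le> 1, a bound of the sup norm on
  the ball. A relation between f and an upper bound K suffices, since only upper bounds are
  combined.\<close>

definition holder_zero :: "real \<Rightarrow> real \<Rightarrow> real \<Rightarrow> ('a::real_normed_vector \<Rightarrow> 'b::real_normed_vector) \<Rightarrow> bool"
  where "holder_zero \<alpha> R K f \<longleftrightarrow> f 0 = 0 \<and> holder_const \<alpha> K (cball 0 R) f"

lemma holder_zeroI:
  "f 0 = 0 \<Longrightarrow> (\<And>x y. x \<in> cball 0 R \<Longrightarrow> y \<in> cball 0 R \<Longrightarrow> norm (f x - f y) \<le> K * norm (x - y) powr \<alpha>)
    \<Longrightarrow> holder_zero \<alpha> R K f"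
  unfolding holder_zero_def holder_const_def by blast

lemma holder_zeroD:
  assumes "holder_zero \<alpha> R K f"
  shows "f 0 = 0" "x \<in> cball 0 R \<Longrightarrow> y \<in> cball 0 R \<Longrightarrow> norm (f x - f y) \<le> K * norm (x - y) powr \<alpha>"
  using assms unfolding holder_zero_def holder_const_def by auto

lemma holder_zero_nonneg:
  fixes f :: "'a::euclidean_space \<Rightarrow> 'b::real_normed_vector"
  assumes f: "holder_zero \<alpha> R K f" and R: "R > 0" shows "K \<ge> 0"
proof -
  obtain b :: 'a where b: "b \<in> Basis" using nonempty_Basis by blast
  have "norm (f (R *\<^sub>R b) - f 0) \<le> K * norm (R *\<^sub>R b - 0) powr \<alpha>"
    using b R by (intro holder_zeroD(2)[OF f]) auto
  from order_trans[OF norm_ge_zero this] have "0 \<le> K * R powr \<alpha>" using b R by simp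
  then show ?thesis using R by (simp add: zero_le_mult_iff)
qed

lemma holder_zero_norm_le:
  fixes f :: "'a::euclidean_space \<Rightarrow> 'b::real_normed_vector"
  assumes f: "holder_zero \<alpha> R K f" and R: "0 < R" "R \<le> 1" and \<alpha>: "\<alpha> > 0" and x: "x \<in> cball 0 R"
  shows "norm (f x) \<le> K"
proof -
  have "norm (f x - f 0) \<le> K * norm (x - 0) powr \<alpha>" using x R by (intro holder_zeroD(2)[OF f]) auto
  also have "\<dots> \<le> K * 1 powr \<alpha>"
    using x R \<alpha> holder_zero_nonneg[OF f R(1)] by (intro mult_left_mono powr_mono2) auto
  finally show ?thesis using holder_zeroD(1)[OF f] by simp
qed

lemma holder_zero_mono: "holder_zero \<alpha> R K f \<Longrightarrow> K \<le> K' \<Longrightarrow> holder_zero \<alpha> R K' f"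
  unfolding holder_zero_def holder_const_def
  by (blast intro: order_trans[OF _ mult_right_mono[OF _ powr_ge_zero]])

lemma holder_zero_add:
  fixes f :: "'a::real_normed_vector \<Rightarrow> 'b::real_normed_vector"
  assumes "holder_zero \<alpha> R K f" "holder_zero \<alpha> R L g" shows "holder_zero \<alpha> R (K + L) (\<lambda>x. f x + g x)"
proof (rule holder_zeroI)
  fix x y :: 'a assume xy: "x \<in> cball 0 R" "y \<in> cball 0 R"
  have "norm (f x + g x - (f y + g y)) \<le> norm (f x - f y) + norm (g x - g y)"
    using norm_triangle_ineq[of "f x - f y" "g x - g y"] by (simp add: algebra_simps)
  then show "norm (f x + g x - (f y + g y)) \<le> (K + L) * norm (x - y) powr \<alpha>"
    using holder_zeroD(2)[OF assms(1) xy] holder_zeroD(2)[OF assms(2) xy] by (simp add: distrib_right)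
qed (simp add: holder_zeroD(1)[OF assms(1)] holder_zeroD(1)[OF assms(2)])

lemma holder_zero_minus: "holder_zero \<alpha> R K f \<Longrightarrow> holder_zero \<alpha> R K (\<lambda>x. - f x)"
  unfolding holder_zero_def holder_const_def by (simp add: norm_minus_commute)

lemma holder_zero_diff:
  "holder_zero \<alpha> R K f \<Longrightarrow> holder_zero \<alpha> R L g \<Longrightarrow> holder_zero \<alpha> R (K + L) (\<lambda>x. f x - g x)"
  using holder_zero_add[OF _ holder_zero_minus, of \<alpha> R K f L g] by simp

lemma holder_zero_const0: "holder_zero \<alpha> R 0 (\<lambda>_. 0)"
  by (rule holder_zeroI) auto

lemma holder_zero_sum:
  "finite I \<Longrightarrow> (\<And>i. i \<in> I \<Longrightarrow> holder_zero \<alpha> R K (f i)) \<Longrightarrow> holder_zero \<alpha> R (real (card I) * K) (\<lambda>x. \<Sum>i\<in>I. f i x)"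
proof (induction I rule: finite_induct)
  case (insert i I)
  then have "holder_zero \<alpha> R (K + real (card I) * K) (\<lambda>x. f i x + (\<Sum>i\<in>I. f i x))"
    by (intro holder_zero_add) auto
  then show ?case using insert.hyps by (simp add: distrib_right)
qed (simp add: holder_zero_const0)

lemma holder_zero_scaleR_const:
  fixes f :: "'a::euclidean_space \<Rightarrow> real"
  assumes f: "holder_zero \<alpha> R K f" and R: "R > 0" and h: "norm h \<le> H"
  shows "holder_zero \<alpha> R (K * H) (\<lambda>x. f x *\<^sub>R h)"
proof (rule holder_zeroI)
  fix x y :: 'a assume xy: "x \<in> cball 0 R" "y \<in> cball 0 R"
  have "norm (f x *\<^sub>R h - f y *\<^sub>R h) = norm (f x - f y) * norm h" by (simp add: scaleR_diff_left[symmetric])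
  also have "\<dots> \<le> (K * norm (x - y) powr \<alpha>) * H"
    by (intro mult_mono holder_zeroD(2)[OF f xy] h norm_ge_zero mult_nonneg_nonneg powr_ge_zero holder_zero_nonneg[OF f R])
  finally show "norm (f x *\<^sub>R h - f y *\<^sub>R h) \<le> K * H * norm (x - y) powr \<alpha>" by (simp add: mult_ac)
qed (simp add: holder_zeroD(1)[OF f])

text \<open>Both factors vanish at 0, so K and L also bound their sup norms, and the product rule
  for differences yields K L twice.\<close>

lemma holder_zero_scaleR:
  fixes f :: "'a::euclidean_space \<Rightarrow> real"
  assumes f: "holder_zero \<alpha> R K f" and g: "holder_zero \<alpha> R L g" and R: "0 < R" "R \<le> 1" and \<alpha>: "\<alpha> > 0"
  shows "holder_zero \<alpha> R (2 * K * L) (\<lambda>x. f x *\<^sub>R g x)"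
proof (rule holder_zeroI)
  fix x y :: 'a assume xy: "x \<in> cball 0 R" "y \<in> cball 0 R"
  note nn = holder_zero_nonneg[OF f R(1)] holder_zero_nonneg[OF g R(1)]
  have "f x *\<^sub>R g x - f y *\<^sub>R g y = f x *\<^sub>R (g x - g y) + (f x - f y) *\<^sub>R g y" by (simp add: algebra_simps)
  also have "norm \<dots> \<le> norm (f x) * norm (g x - g y) + norm (f x - f y) * norm (g y)"
    using norm_triangle_ineq[of "f x *\<^sub>R (g x - g y)" "(f x - f y) *\<^sub>R g y"]
    by (simp only: norm_scaleR real_norm_def)
  also have "\<dots> \<le> K * (L * norm (x - y) powr \<alpha>) + (K * norm (x - y) powr \<alpha>) * L"
    by (intro add_mono mult_mono holder_zeroD(2)[OF f xy] holder_zeroD(2)[OF g xy]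
      holder_zero_norm_le[OF f R \<alpha> xy(1)] holder_zero_norm_le[OF g R \<alpha> xy(2)] mult_nonneg_nonneg nn norm_ge_zero powr_ge_zero)
  finally show "norm (f x *\<^sub>R g x - f y *\<^sub>R g y) \<le> 2 * K * L * norm (x - y) powr \<alpha>" by (simp add: mult_ac)
qed (simp add: holder_zeroD(1)[OF f])

text \<open>Source of the small factor: |x - y|^{1 - \<alpha>} \<le> (2 R)^{1 - \<alpha>} on the
  ball.\<close>

lemma norm_le_powr_cball:
  fixes x y :: "'a::real_normed_vector"
  assumes xy: "x \<in> cball 0 R" "y \<in> cball 0 R" and \<alpha>: "0 < \<alpha>" "\<alpha> < 1"
  shows "norm (x - y) \<le> 2 * R powr (1 - \<alpha>) * norm (x - y) powr \<alpha>"
proof -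
  have "norm x \<le> R" using xy by simp
  then have R: "R \<ge> 0" using norm_ge_zero[of x] by linarith
  have "norm (x - y) = norm (x - y) powr (1 - \<alpha>) * norm (x - y) powr \<alpha>"
    by (simp add: powr_add[symmetric])
  also have "norm (x - y) powr (1 - \<alpha>) \<le> (2 * R) powr (1 - \<alpha>)"
    using xy norm_triangle_ineq4[of x y] \<alpha> by (intro powr_mono2) auto
  also have "\<dots> = 2 powr (1 - \<alpha>) * R powr (1 - \<alpha>)" using R by (simp add: powr_mult)
  also have "\<dots> \<le> 2 powr 1 * R powr (1 - \<alpha>)" using \<alpha> by (intro mult_right_mono powr_mono) auto
  finally show ?thesis by (simp add: mult_right_mono)
qed

lemma holder_zero_of_lipschitz:
  fixes f :: "'a::real_normed_vector \<Rightarrow> 'b::real_normed_vector"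
  assumes "f 0 = 0" and lip: "\<And>x y. x \<in> cball 0 R \<Longrightarrow> y \<in> cball 0 R \<Longrightarrow> norm (f x - f y) \<le> K * norm (x - y)"
    and "K \<ge> 0" "0 < \<alpha>" "\<alpha> < 1"
  shows "holder_zero \<alpha> R (2 * K * R powr (1 - \<alpha>)) f"
proof (rule holder_zeroI)
  fix x y :: 'a assume xy: "x \<in> cball 0 R" "y \<in> cball 0 R"
  have "K * norm (x - y) \<le> K * (2 * R powr (1 - \<alpha>) * norm (x - y) powr \<alpha>)"
    by (intro mult_left_mono norm_le_powr_cball xy assms)
  then show "norm (f x - f y) \<le> 2 * K * R powr (1 - \<alpha>) * norm (x - y) powr \<alpha>"
    using lip[OF xy] by (simp add: mult_ac)
qed fact

section \<open>Picard iteration\<close>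

text \<open>The maps act on total functions of which only the values on the ball matter. The
  seminorm bounds the values, so the iterates converge pointwise there, and Hoelder bounds pass to
  the pointwise limit; \<open>contr\<close> for the limit and an iterate then shows that the limit
  is fixed.\<close>

lemma holder_fixed_point:
  fixes \<Phi> :: "('a::euclidean_space \<Rightarrow> 'b::banach) \<Rightarrow> 'a \<Rightarrow> 'b"
  assumes R: "0 < R" "R \<le> 1" and \<alpha>: "\<alpha> > 0"
    and contr: "\<And>f g D. holder_zero \<alpha> R 1 f \<Longrightarrow> holder_zero \<alpha> R 1 g \<Longrightarrow> holder_zero \<alpha> R D (\<lambda>x. f x - g x)
      \<Longrightarrow> holder_zero \<alpha> R (D / 2) (\<lambda>x. \<Phi> f x - \<Phi> g x)"
    and start: "holder_zero \<alpha> R (1/2) (\<Phi> (\<lambda>_. 0))"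
  obtains f where "holder_zero \<alpha> R 1 f" "\<And>x. x \<in> cball 0 R \<Longrightarrow> \<Phi> f x = f x"
proof -
  have z1: "holder_zero \<alpha> R 1 (\<lambda>_::'a. 0::'b)" by (rule holder_zero_mono[OF holder_zero_const0]) simp
  \<comment> \<open>Contraction between f and 0 contributes 1/2 and \<open>start\<close> the other
    1/2, so the unit ball is preserved.\<close>
  have self: "holder_zero \<alpha> R 1 (\<Phi> f)" if f: "holder_zero \<alpha> R 1 f" for f
    using holder_zero_add[OF contr[OF f z1, of 1] start] f by simp
  define s where "s k = (\<Phi> ^^ k) (\<lambda>_. 0)" for k :: nat
  have s0: "s 0 = (\<lambda>_. 0)" and sS: "s (Suc k) = \<Phi> (s k)" for k by (simp_all add: s_def)
  have hs: "holder_zero \<alpha> R 1 (s k)" for k by (induction k) (auto simp: s0 sS z1 self)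
  have step: "holder_zero \<alpha> R ((1/2) ^ k) (\<lambda>x. s (Suc k) x - s k x)" for k
  proof (induction k)
    case 0
    show ?case using holder_zero_mono[OF start, of 1] by (simp add: sS s0)
  next
    case (Suc k)
    from contr[OF hs[of "Suc k"] hs[of k] Suc] show ?case by (simp add: sS)
  qed
  \<comment> \<open>The partial geometric sum is kept exact, so that the induction on l closes by
    adding one step.\<close>
  have far: "holder_zero \<alpha> R (2 * (1/2) ^ k - 2 * (1/2) ^ (k + l)) (\<lambda>x. s (k + l) x - s k x)" for k l
  proof (induction l)
    case (Suc l)
    from holder_zero_add[OF Suc step[of "k + l"]] show ?case by (simp add: algebra_simps)
  qed (simp add: holder_zero_const0)
  have far': "holder_zero \<alpha> R (2 * (1/2) ^ k) (\<lambda>x. s l x - s k x)" if "k \<le> l" for k l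
    using holder_zero_mono[OF far[of k "l - k"], of "2 * (1/2) ^ k"] that by simp
  have half0: "(\<lambda>k. 2 * (1/2::real) ^ k) \<longlonglongrightarrow> 0"
    using tendsto_mult_right_zero[OF LIMSEQ_realpow_zero[of "1/2::real"]] by simp
  define f where "f x = lim (\<lambda>k. s k x)" for x
  have conv: "(\<lambda>k. s k x) \<longlonglongrightarrow> f x" if x: "x \<in> cball 0 R" for x
  proof -
    have "Cauchy (\<lambda>k. s k x)"
    proof (rule metric_CauchyI)
      fix e :: real assume "e > 0"
      then have "\<forall>\<^sub>F k in sequentially. 2 * (1/2::real) ^ k < e / 2"
        using order_tendstoD(2)[OF half0, of "e/2"] by simp
      then obtain k where k: "2 * (1/2::real) ^ k < e / 2" unfolding eventually_sequentially by blast
      have near: "dist (s l x) (s k x) < e / 2" if "k \<le> l" for l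
        unfolding dist_norm using holder_zero_norm_le[OF far'[OF that] R \<alpha> x] k by linarith
      show "\<exists>M. \<forall>m\<ge>M. \<forall>n\<ge>M. dist (s m x) (s n x) < e"
        using dist_triangle_half_l[OF near near] by blast
    qed
    then show ?thesis unfolding f_def by (simp add: Cauchy_convergent_iff convergent_LIMSEQ_iff)
  qed
  have f0: "f 0 = 0" unfolding f_def using holder_zeroD(1)[OF hs] by simp
  have hf: "holder_zero \<alpha> R 1 f"
  proof (rule holder_zeroI)
    show "f 0 = 0" by (rule f0)
    fix x y :: 'a assume xy: "x \<in> cball 0 R" "y \<in> cball 0 R"
    have "(\<lambda>k. norm (s k x - s k y)) \<longlonglongrightarrow> norm (f x - f y)" by (intro tendsto_intros conv xy)
    then show "norm (f x - f y) \<le> 1 * norm (x - y) powr \<alpha>"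
      by (rule LIMSEQ_le_const2) (use holder_zeroD(2)[OF hs xy] in auto)
  qed
  have hfs: "holder_zero \<alpha> R (2 * (1/2) ^ k) (\<lambda>x. f x - s k x)" for k
  proof (rule holder_zeroI)
    show "f 0 - s k 0 = 0" using f0 holder_zeroD(1)[OF hs] by simp
    fix x y :: 'a assume xy: "x \<in> cball 0 R" "y \<in> cball 0 R"
    have "(\<lambda>l. norm ((s l x - s k x) - (s l y - s k y))) \<longlonglongrightarrow> norm ((f x - s k x) - (f y - s k y))"
      by (intro tendsto_intros conv xy)
    then show "norm ((f x - s k x) - (f y - s k y)) \<le> 2 * (1/2) ^ k * norm (x - y) powr \<alpha>"
      by (rule LIMSEQ_le_const2) (use holder_zeroD(2)[OF far' xy] in blast)
  qed
  have "\<Phi> f x = f x" if x: "x \<in> cball 0 R" for x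
  proof -
    have "norm (s (Suc k) x - \<Phi> f x) \<le> 2 * (1/2) ^ k" for k
    proof -
      have "norm (\<Phi> f x - \<Phi> (s k) x) \<le> 2 * (1/2) ^ k / 2"
        by (rule holder_zero_norm_le[OF contr[OF hf hs hfs] R \<alpha> x])
      also have "\<dots> \<le> 2 * (1/2) ^ k" by simp
      finally show ?thesis by (simp add: sS norm_minus_commute)
    qed
    then have "(\<lambda>k. s (Suc k) x - \<Phi> f x) \<longlonglongrightarrow> 0"
      by (intro Lim_null_comparison[OF _ half0]) auto
    then have "(\<lambda>k. s (Suc k) x) \<longlonglongrightarrow> \<Phi> f x" by (rule LIM_zero_cancel)
    moreover have "(\<lambda>k. s (Suc k) x) \<longlonglongrightarrow> f x" by (rule LIMSEQ_Suc[OF conv[OF x]])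
    ultimately show ?thesis by (rule LIMSEQ_unique)
  qed
  with hf show thesis by (rule that)
qed

section \<open>Superposition operators in the Hoelder seminorm\<close>

lemma C1_ball_mono:
  assumes "C1_ball \<alpha> z0 \<rho> A G" "\<rho>' \<le> \<rho>" "A \<le> A'" shows "C1_ball \<alpha> z0 \<rho>' A' G"
proof -
  obtain G' where G': "\<And>z. z \<in> cball z0 \<rho> \<Longrightarrow> (G has_derivative G' z) (at z)"
    "\<And>z h. z \<in> cball z0 \<rho> \<Longrightarrow> norm (G' z h) \<le> A * norm h"
    "\<And>z z' h. z \<in> cball z0 \<rho> \<Longrightarrow> z' \<in> cball z0 \<rho> \<Longrightarrow> norm (G' z h - G' z' h) \<le> A * norm (z - z') powr \<alpha> * norm h"
    using assms(1) unfolding C1_ball_def by metis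
  have sub: "z \<in> cball z0 \<rho>" if "z \<in> cball z0 \<rho>'" for z using that assms(2) by auto
  show ?thesis unfolding C1_ball_def
  proof (intro exI[of _ G'] ballI conjI allI)
    fix z z' h assume z: "z \<in> cball z0 \<rho>'" "z' \<in> cball z0 \<rho>'"
    show "norm (G' z h - G' z' h) \<le> A' * norm (z - z') powr \<alpha> * norm h"
      by (rule order_trans[OF G'(3)[OF sub[OF z(1)] sub[OF z(2)]]]) (intro mult_right_mono assms(3); simp)
  next
    fix z h assume z: "z \<in> cball z0 \<rho>'"
    show "norm (G' z h) \<le> A' * norm h"
      by (rule order_trans[OF G'(2)[OF sub[OF z]]]) (intro mult_right_mono assms(3); simp)
  qed (use G'(1) sub in auto)
qed

text \<open>G o w is Lipschitz, and on the ball this turns into a Hoelder bound with R^{1 -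
  \<alpha>}. For the difference, the first term of \<open>four_point_bound\<close> is at most A
  \<Delta> |x - y| and gives the 2. The second is A (\<Lambda> |x - y|)^\<alpha> |w y - w' y|; it
  gives the \<Lambda>, because w and w' agree at 0 and so differ by at most \<Delta> R on the
  ball.\<close>

lemma
  fixes w w' :: "'a::euclidean_space \<Rightarrow> 'c::euclidean_space" and G :: "'c \<Rightarrow> 'b::real_normed_vector"
  assumes G: "C1_ball \<alpha> z0 \<rho> A G" and A: "A \<ge> 0" and \<alpha>: "0 < \<alpha>" "\<alpha> < 1" and R: "0 < R" "R \<le> 1"
    and \<Lambda>: "\<Lambda> \<ge> 1"
    and w: "\<And>x. x \<in> cball 0 R \<Longrightarrow> w x \<in> cball z0 \<rho>" "w 0 = z0"
      "\<And>x y. x \<in> cball 0 R \<Longrightarrow> y \<in> cball 0 R \<Longrightarrow> norm (w x - w y) \<le> \<Lambda> * norm (x - y)"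
  shows holder_zero_compose: "holder_zero \<alpha> R (2 * (A * \<Lambda>) * R powr (1 - \<alpha>)) (\<lambda>x. G (w x) - G z0)"
    and holder_zero_compose_diff:
      "(\<And>x. x \<in> cball 0 R \<Longrightarrow> w' x \<in> cball z0 \<rho>) \<Longrightarrow> w' 0 = z0 \<Longrightarrow>
      (\<And>x y. x \<in> cball 0 R \<Longrightarrow> y \<in> cball 0 R \<Longrightarrow> norm (w' x - w' y) \<le> \<Lambda> * norm (x - y)) \<Longrightarrow>
      (\<And>x y. x \<in> cball 0 R \<Longrightarrow> y \<in> cball 0 R \<Longrightarrow> norm ((w x - w' x) - (w y - w' y)) \<le> \<Delta> * norm (x - y)) \<Longrightarrow>
      \<Delta> \<ge> 0 \<Longrightarrow>
      holder_zero \<alpha> R (A * (2 + \<Lambda>) * \<Delta> * R powr (1 - \<alpha>)) (\<lambda>x. G (w x) - G (w' x))"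
proof -
  obtain G' where G': "\<And>z. z \<in> cball z0 \<rho> \<Longrightarrow> (G has_derivative G' z) (at z)"
    "\<And>z h. z \<in> cball z0 \<rho> \<Longrightarrow> norm (G' z h) \<le> A * norm h"
    "\<And>z z' h. z \<in> cball z0 \<rho> \<Longrightarrow> z' \<in> cball z0 \<rho> \<Longrightarrow> norm (G' z h - G' z' h) \<le> A * norm (z - z') powr \<alpha> * norm h"
    using G unfolding C1_ball_def by metis
  have lip: "norm (G p - G q) \<le> A * norm (p - q)" if "p \<in> cball z0 \<rho>" "q \<in> cball z0 \<rho>" for p q
  proof (rule differentiable_bound[OF convex_cball[of z0 \<rho>], where f' = G'])
    fix z assume z: "z \<in> cball z0 \<rho>"
    show "(G has_derivative G' z) (at z within cball z0 \<rho>)" by (rule has_derivative_at_withinI[OF G'(1)[OF z]])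
    show "onorm (G' z) \<le> A" by (rule onorm_le) (rule G'(2)[OF z])
  qed fact+
  show "holder_zero \<alpha> R (2 * (A * \<Lambda>) * R powr (1 - \<alpha>)) (\<lambda>x. G (w x) - G z0)"
  proof (rule holder_zero_of_lipschitz)
    fix x y :: 'a assume xy: "x \<in> cball 0 R" "y \<in> cball 0 R"
    have "norm (G (w x) - G (w y)) \<le> A * norm (w x - w y)" by (intro lip w xy)
    also have "\<dots> \<le> A * (\<Lambda> * norm (x - y))" using A by (intro mult_left_mono w xy)
    finally show "norm (G (w x) - G z0 - (G (w y) - G z0)) \<le> A * \<Lambda> * norm (x - y)" by (simp add: mult_ac)
  qed (use w(2) A \<Lambda> \<alpha> in auto)
  assume w': "\<And>x. x \<in> cball 0 R \<Longrightarrow> w' x \<in> cball z0 \<rho>" "w' 0 = z0"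
      "\<And>x y. x \<in> cball 0 R \<Longrightarrow> y \<in> cball 0 R \<Longrightarrow> norm (w' x - w' y) \<le> \<Lambda> * norm (x - y)"
    and \<Delta>: "\<And>x y. x \<in> cball 0 R \<Longrightarrow> y \<in> cball 0 R \<Longrightarrow> norm ((w x - w' x) - (w y - w' y)) \<le> \<Delta> * norm (x - y)" "\<Delta> \<ge> 0"
  show "holder_zero \<alpha> R (A * (2 + \<Lambda>) * \<Delta> * R powr (1 - \<alpha>)) (\<lambda>x. G (w x) - G (w' x))"
  proof (rule holder_zeroI)
    fix x y :: 'a assume xy: "x \<in> cball 0 R" "y \<in> cball 0 R"
    let ?d = "norm (x - y)"
    have RR: "R \<le> R powr (1 - \<alpha>)" using powr_mono'[of "1 - \<alpha>" 1 R] R \<alpha> by simp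
    have LL: "\<Lambda> powr \<alpha> \<le> \<Lambda>" using powr_mono[of \<alpha> 1 \<Lambda>] \<Lambda> \<alpha> by simp
    have dy: "norm (w y - w' y) \<le> \<Delta> * R"
    proof -
      have "norm ((w y - w' y) - (w 0 - w' 0)) \<le> \<Delta> * norm (y - 0)" using xy R by (intro \<Delta>(1)) auto
      also have "\<dots> \<le> \<Delta> * R" using xy \<Delta>(2) by (intro mult_left_mono) auto
      finally show ?thesis by (simp add: w(2) w'(2))
    qed
    have "norm ((G (w x) - G (w' x)) - (G (w y) - G (w' y)))
      \<le> A * norm ((w x - w' x) - (w y - w' y)) + A * (\<Lambda> * ?d) powr \<alpha> * norm (w y - w' y)"
      by (rule four_point_bound[OF convex_cball G']) (use w w' xy A \<alpha> in auto)
    also have "\<dots> \<le> A * (\<Delta> * (2 * R powr (1 - \<alpha>) * ?d powr \<alpha>)) + A * (\<Lambda> * ?d powr \<alpha>) * (\<Delta> * R powr (1 - \<alpha>))"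
    proof (intro add_mono mult_mono)
      show "norm ((w x - w' x) - (w y - w' y)) \<le> \<Delta> * (2 * R powr (1 - \<alpha>) * ?d powr \<alpha>)"
        by (rule order_trans[OF \<Delta>(1)[OF xy] mult_left_mono[OF norm_le_powr_cball[OF xy \<alpha>] \<Delta>(2)]])
      show "(\<Lambda> * ?d) powr \<alpha> \<le> \<Lambda> * ?d powr \<alpha>"
        using LL \<Lambda> by (simp add: powr_mult mult_right_mono)
      show "norm (w y - w' y) \<le> \<Delta> * R powr (1 - \<alpha>)"
        by (rule order_trans[OF dy mult_left_mono[OF RR \<Delta>(2)]])
    qed (use A \<Lambda> in auto)
    also have "\<dots> = A * (2 + \<Lambda>) * \<Delta> * R powr (1 - \<alpha>) * ?d powr \<alpha>" by (simp add: algebra_simps)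
    finally show "norm (G (w x) - G (w' x) - (G (w y) - G (w' y))) \<le> A * (2 + \<Lambda>) * \<Delta> * R powr (1 - \<alpha>) * ?d powr \<alpha>" .
  qed (simp add: w w')
qed

section \<open>Jets and extension from the ball\<close>

lemma norm_transpose_family_le:
  fixes T :: "'n::finite \<Rightarrow> real^'m"
  shows "norm (\<chi> k j. T j $ k :: real^'n^'m) \<le> real CARD('m) * (\<Sum>j\<in>UNIV. norm (T j))"
proof -
  have vec: "norm v \<le> (\<Sum>i\<in>UNIV. norm (v $ i))" for v :: "'b::real_normed_vector^'c::finite"
    unfolding norm_vec_def by (rule L2_set_le_sum) auto
  have "norm (\<chi> k j. T j $ k :: real^'n^'m) \<le> (\<Sum>k\<in>UNIV. norm (\<chi> j. T j $ k :: real^'n))"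
    using vec[of "\<chi> k j. T j $ k :: real^'n^'m"] by simp
  also have "\<dots> \<le> (\<Sum>k\<in>(UNIV::'m set). \<Sum>j\<in>UNIV. norm (T j))"
  proof (rule sum_mono)
    fix k
    have "norm (\<chi> j. T j $ k :: real^'n) \<le> (\<Sum>j\<in>UNIV. norm (T j $ k))"
      using vec[of "\<chi> j. T j $ k :: real^'n"] by simp
    also have "\<dots> \<le> (\<Sum>j\<in>UNIV. norm (T j))" by (intro sum_mono) (simp add: component_le_norm_cart)
    finally show "norm (\<chi> j. T j $ k :: real^'n) \<le> (\<Sum>j\<in>UNIV. norm (T j))" .
  qed
  finally show ?thesis by simp
qed

text \<open>The x slot is 0 so that differences of jets are jets of differences; the base point is
  added separately. Rows of the last slot are components of u and columns are derivatives, as in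
  \<open>Du\<close>.\<close>

definition jet :: "(real^'n \<Rightarrow> real^'m) \<Rightarrow> ('n \<Rightarrow> real^'n \<Rightarrow> real^'m) \<Rightarrow> real^'n \<Rightarrow> (real^'n) \<times> (real^'m) \<times> (real^'n^'m)"
  where "jet u u1 x = (0, u x, \<chi> k j. u1 j x $ k)"

lemma jet_diff: "jet u u1 x - jet v v1 y = (0, u x - v y, \<chi> k j. (u1 j x - v1 j y) $ k)"
  by (simp add: jet_def vec_eq_iff)

lemma norm_jet_diff_le:
  fixes u :: "real^'n \<Rightarrow> real^'m"
  assumes "norm (u x - u y) \<le> L * norm (x - y)" "\<And>j. norm (u1 j x - u1 j y) \<le> L * norm (x - y)"
  shows "norm (jet u u1 x - jet u u1 y) \<le> L * (1 + real CARD('m) * real CARD('n)) * norm (x - y)"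
proof -
  have "norm (jet u u1 x - jet u u1 y) \<le> norm (u x - u y) + norm (\<chi> k j. (u1 j x - u1 j y) $ k :: real^'n^'m)"
    unfolding jet_diff using norm_Pair_le[of "u x - u y"] by (auto simp: norm_Pair)
  also have "\<dots> \<le> L * norm (x - y) + real CARD('m) * (\<Sum>j\<in>(UNIV::'n set). L * norm (x - y))"
    by (intro add_mono assms(1) order_trans[OF norm_transpose_family_le] mult_left_mono sum_mono assms(2)) auto
  finally show ?thesis by (simp add: algebra_simps)
qed

text \<open>The nearest-point projection onto the ball is 1-Lipschitz, so composing with it extends
  f to the whole space, where the parametrix acts, with the same Hoelder constant.\<close>

lemma admissible_closest_point:
  fixes f :: "'a::euclidean_space \<Rightarrow> 'b::real_normed_vector"
  assumes f: "holder_zero \<alpha> R F f" and R: "0 < R" "R \<le> 1" and \<alpha>: "\<alpha> > 0"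
  shows "holder_const \<alpha> F UNIV (\<lambda>x. f (closest_point (cball 0 R) x))"
    and "admissible \<alpha> (\<lambda>x. f (closest_point (cball 0 R) x))"
proof -
  let ?p = "closest_point (cball (0::'a) R)"
  have p: "?p x \<in> cball 0 R" for x using R by (intro closest_point_in_set) auto
  have pl: "norm (?p x - ?p y) \<le> norm (x - y)" for x y
    using closest_point_lipschitz[of "cball (0::'a) R" x y] R by (simp add: dist_norm)
  have F: "F \<ge> 0" by (rule holder_zero_nonneg[OF f R(1)])
  show "holder_const \<alpha> F UNIV (\<lambda>x. f (?p x))" unfolding holder_const_def
  proof (intro ballI)
    fix x y
    have "norm (f (?p x) - f (?p y)) \<le> F * norm (?p x - ?p y) powr \<alpha>" by (rule holder_zeroD(2)[OF f p p])
    also have "\<dots> \<le> F * norm (x - y) powr \<alpha>" using F pl \<alpha> by (intro mult_left_mono powr_mono2) auto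
    finally show "norm (f (?p x) - f (?p y)) \<le> F * norm (x - y) powr \<alpha>" .
  qed
  moreover have "bounded (range (\<lambda>x. f (?p x)))"
    unfolding bounded_iff using holder_zero_norm_le[OF f R \<alpha> p] by auto
  ultimately show "admissible \<alpha> (\<lambda>x. f (?p x))" unfolding admissible_def by blast
qed

section \<open>The quasi-linear system\<close>

text \<open>u, u1 and u2 are differentiated on the whole space, so that derivatives within any
  smaller closed ball can be read off; the equation itself holds on the ball only.\<close>

lemma local_solution:
  fixes a :: "'n::finite \<Rightarrow> 'n \<Rightarrow> (real^'n) \<times> (real^'m::finite) \<times> (real^'n^'m) \<Rightarrow> real"
    and \<phi> :: "(real^'n) \<times> (real^'m) \<times> (real^'n^'m) \<Rightarrow> real^'m"
  assumes z0: "z0 = (0, c0, c1)" and lam: "lam > 0"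
    and pos: "\<And>\<xi> :: real^'n. (\<Sum>i\<in>UNIV. \<Sum>j\<in>UNIV. a i j z0 * \<xi> $ i * \<xi> $ j) \<ge> lam * (norm \<xi>)\<^sup>2"
    and \<alpha>: "0 < \<alpha>" "\<alpha> < 1" and A: "A \<ge> 0" and \<rho>: "\<rho> > 0"
    and aC1: "\<And>i j. C1_ball \<alpha> z0 \<rho> A (a i j)" and \<phi>C1: "C1_ball \<alpha> z0 \<rho> A \<phi>"
  obtains R K u u1 u2 where "R > 0"
    "\<And>x. (u has_derivative (\<lambda>e. \<Sum>j\<in>UNIV. e $ j *\<^sub>R u1 j x)) (at x)"
    "\<And>j x. (u1 j has_derivative (\<lambda>e. \<Sum>i\<in>UNIV. e $ i *\<^sub>R u2 i j x)) (at x)"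
    "\<And>i j. holder_const \<alpha> K (cball 0 R) (u2 i j)"
    "u 0 = c0" "(\<chi> k j. u1 j 0 $ k) = c1"
    "\<And>x. x \<in> cball 0 R \<Longrightarrow> (x, u x, \<chi> k j. u1 j x $ k) \<in> cball z0 \<rho>"
    "\<And>x. x \<in> cball 0 R \<Longrightarrow> (\<Sum>i\<in>UNIV. \<Sum>j\<in>UNIV. a i j (x, u x, \<chi> k j. u1 j x $ k) *\<^sub>R u2 i j x)
      = \<phi> (x, u x, \<chi> k j. u1 j x $ k)"
proof -
  obtain C and N :: "(real^'n \<Rightarrow> real^'m) \<Rightarrow> real^'n \<Rightarrow> real^'m" and N1 N2 where
    C: "C > 0" and
    dN: "\<And>f x. admissible \<alpha> f \<Longrightarrow> (N f has_derivative (\<lambda>e. \<Sum>j\<in>UNIV. e $ j *\<^sub>R N1 j f x)) (at x)" and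
    dN1: "\<And>f j x. admissible \<alpha> f \<Longrightarrow> (N1 j f has_derivative (\<lambda>e. \<Sum>i\<in>UNIV. e $ i *\<^sub>R N2 i j f x)) (at x)" and
    hol: "\<And>f F i j. admissible \<alpha> f \<Longrightarrow> holder_const \<alpha> F UNIV f \<Longrightarrow> holder_const \<alpha> (C * F) UNIV (N2 i j f)" and
    err: "\<And>f F x y. admissible \<alpha> f \<Longrightarrow> holder_const \<alpha> F UNIV f \<Longrightarrow> norm (x - y) \<le> 1 \<Longrightarrow>
      norm (((\<Sum>i\<in>UNIV. \<Sum>j\<in>UNIV. a i j z0 *\<^sub>R N2 i j f x) - f x)
        - ((\<Sum>i\<in>UNIV. \<Sum>j\<in>UNIV. a i j z0 *\<^sub>R N2 i j f y) - f y)) \<le> C * F * norm (x - y)" and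
    lin: "\<And>f g x. admissible \<alpha> f \<Longrightarrow> admissible \<alpha> g \<Longrightarrow> N (\<lambda>x. f x - g x) x = N f x - N g x"
    "\<And>f g j x. admissible \<alpha> f \<Longrightarrow> admissible \<alpha> g \<Longrightarrow> N1 j (\<lambda>x. f x - g x) x = N1 j f x - N1 j g x"
    "\<And>f g i j x. admissible \<alpha> f \<Longrightarrow> admissible \<alpha> g \<Longrightarrow> N2 i j (\<lambda>x. f x - g x) x = N2 i j f x - N2 i j g x" and
    zero: "\<And>f. N f 0 = 0" "\<And>j f. N1 j f 0 = 0" "\<And>i j f. N2 i j f 0 = 0"
    using parametrix[OF lam pos \<alpha>] by blast
  define n where "n = real CARD('n)"
  define m where "m = real CARD('m)"
  have nm: "n \<ge> 1" "m \<ge> 1" unfolding n_def m_def by (simp_all add: Suc_leI)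
  \<comment> \<open>Ellipticity at a coordinate vector makes the diagonal entry s positive, so the
    single quadratic term x_{i0}^2 / (2 s) times \<phi>(z0) already solves L P = \<phi>(z0).\<close>
  obtain i0 :: 'n where True by blast
  define s where "s = a i0 i0 z0"
  have s: "s > 0"
  proof -
    have "(\<Sum>j\<in>UNIV. a i j z0 * (axis i0 1 :: real^'n) $ i * (axis i0 1 :: real^'n) $ j) = (if i = i0 then s else 0)" for i
      by (cases "i = i0") (simp_all add: s_def axis_def if_distrib[of "(*) _"] cong: if_cong)
    then have "(\<Sum>i\<in>UNIV. \<Sum>j\<in>UNIV. a i j z0 * (axis i0 1 :: real^'n) $ i * (axis i0 1 :: real^'n) $ j) = s"
      by simp
    then show ?thesis using pos[of "axis i0 1"] lam by simp
  qed
  define \<phi>0 where "\<phi>0 = \<phi> z0"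
  define cl where "cl j = (\<chi> k. c1 $ k $ j)" for j
  define ub where "ub x = c0 + (\<Sum>j\<in>UNIV. x $ j *\<^sub>R cl j) + ((x $ i0)\<^sup>2 / (2 * s)) *\<^sub>R \<phi>0" for x :: "real^'n"
  define ub1 where "ub1 j x = cl j + (if j = i0 then (x $ i0 / s) *\<^sub>R \<phi>0 else 0)" for j and x :: "real^'n"
  define h0 where "h0 i j = (if i = i0 \<and> j = i0 then (1 / s) *\<^sub>R \<phi>0 else 0)" for i j
  have vn: "((\<lambda>x::real^'n. x $ i) has_derivative (\<lambda>e. e $ i)) (at x)" for i x
    by (rule bounded_linear_imp_has_derivative[OF bounded_linear_vec_nth])
  have dub: "(ub has_derivative (\<lambda>e. \<Sum>j\<in>UNIV. e $ j *\<^sub>R ub1 j x)) (at x)" for x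
  proof -
    have "(ub has_derivative (\<lambda>e. 0 + (\<Sum>j\<in>UNIV. e $ j *\<^sub>R cl j) + (x $ i0 * e $ i0 / s) *\<^sub>R \<phi>0)) (at x)"
      unfolding ub_def[abs_def]
      by (intro has_derivative_add has_derivative_const has_derivative_sum has_derivative_scaleR_left vn)
        (use s in \<open>auto intro!: derivative_eq_intros vn simp: field_simps\<close>)
    moreover have "e $ j *\<^sub>R ub1 j x = e $ j *\<^sub>R cl j + (if j = i0 then (x $ i0 * e $ i0 / s) *\<^sub>R \<phi>0 else 0)"
      for e :: "real^'n" and j
      by (simp add: ub1_def scaleR_add_right mult.commute)
    ultimately show ?thesis by (simp add: sum.distrib)
  qed
  have dub1: "(ub1 j has_derivative (\<lambda>e. \<Sum>i\<in>UNIV. e $ i *\<^sub>R h0 i j)) (at x)" for j x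
  proof (cases "j = i0")
    case True
    have "(ub1 j has_derivative (\<lambda>e. 0 + (e $ i0 / s) *\<^sub>R \<phi>0)) (at x)"
      unfolding ub1_def[abs_def] using True s
      by (auto intro!: derivative_eq_intros vn simp: field_simps)
    then show ?thesis
      by (rule has_derivative_eq_rhs) (use True in \<open>simp add: h0_def fun_eq_iff if_distrib cong: if_cong\<close>)
  next
    case False
    then show ?thesis unfolding ub1_def[abs_def] by (simp add: h0_def)
  qed
  define H where "H = norm \<phi>0 / s"
  have H: "H \<ge> 0" "\<And>i j. norm (h0 i j) \<le> H" using s by (auto simp: H_def h0_def)
  have ub1l: "norm (ub1 j x - ub1 j y) \<le> H * norm (x - y)" for j x y
  proof (cases "j = i0")
    case True
    have "ub1 j x - ub1 j y = ((x - y) $ i0 / s) *\<^sub>R \<phi>0"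
      using True by (simp add: ub1_def scaleR_diff_left[symmetric] diff_divide_distrib)
    then have "norm (ub1 j x - ub1 j y) = H * \<bar>(x - y) $ i0\<bar>" using s by (simp add: H_def)
    also have "\<dots> \<le> H * norm (x - y)" using H(1) by (intro mult_left_mono component_le_norm_cart)
    finally show ?thesis .
  qed (use H in \<open>simp add: ub1_def\<close>)
  define Bb where "Bb = (\<Sum>j\<in>UNIV. norm (cl j)) + H"
  have Bb: "Bb \<ge> 0" unfolding Bb_def using H by (intro add_nonneg_nonneg sum_nonneg) auto
  have ub1b: "norm (ub1 j x) \<le> Bb" if "x \<in> cball 0 1" for j x
  proof -
    have "norm (ub1 j x) \<le> norm (ub1 j 0) + norm (ub1 j x - ub1 j 0)" by (rule norm_triangle_sub)
    moreover have "norm (ub1 j x - ub1 j 0) \<le> H * 1"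
      by (rule order_trans[OF ub1l mult_left_mono]) (use that H in auto)
    moreover have "norm (ub1 j 0) \<le> (\<Sum>j\<in>UNIV. norm (cl j))"
      by (auto simp: ub1_def intro!: member_le_sum)
    ultimately show ?thesis by (simp add: Bb_def)
  qed
  \<comment> \<open>\<open>Lb\<close> is a Lipschitz constant of \<open>ub\<close> and of its
    partials, and 1 + m n passes from components to jets. In \<open>J\<close>, the factor n^2 C
    comes from integrating the Hessian bound twice from 0. \<open>\<Lambda>\<close> then serves
    every w f with f in the unit ball.\<close>
  define Lb where "Lb = n * Bb + H"
  define W0 where "W0 = 1 + Lb * (1 + m * n)"
  define J where "J = n * n * C * (1 + m * n)"
  define \<Lambda> where "\<Lambda> = W0 + J"
  have pos': "Lb \<ge> 0" "J \<ge> 0" "W0 \<ge> 1" "\<Lambda> \<ge> 1"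
    using nm H Bb C by (auto simp: Lb_def J_def W0_def \<Lambda>_def intro!: add_nonneg_nonneg mult_nonneg_nonneg add_increasing2)
  define w0 where "w0 x = (x, 0, 0) + jet ub ub1 x" for x
  have w0l: "norm (w0 x - w0 y) \<le> W0 * norm (x - y)" if xy: "x \<in> cball 0 1" "y \<in> cball 0 1" for x y
  proof -
    have "norm (ub x - ub y) \<le> n * Bb * norm (x - y)"
      unfolding n_def by (rule lipschitz_of_partials[OF dub ub1b convex_cball xy])
    also have "\<dots> \<le> Lb * norm (x - y)" using H by (intro mult_right_mono) (auto simp: Lb_def)
    finally have 1: "norm (ub x - ub y) \<le> Lb * norm (x - y)" .
    have 2: "norm (ub1 j x - ub1 j y) \<le> Lb * norm (x - y)" for j
      by (rule order_trans[OF ub1l mult_right_mono]) (use nm Bb in \<open>auto simp: Lb_def\<close>)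
    have "w0 x - w0 y = (x - y, 0, 0) + (jet ub ub1 x - jet ub ub1 y)" by (simp add: w0_def algebra_simps)
    also have "norm \<dots> \<le> norm (x - y) + Lb * (1 + m * n) * norm (x - y)"
      using norm_triangle_ineq[of "(x - y, 0, 0)" "jet ub ub1 x - jet ub ub1 y"] norm_jet_diff_le[of ub x y Lb ub1, OF 1 2]
      unfolding n_def m_def by (simp add: norm_Pair)
    finally show ?thesis by (simp add: W0_def algebra_simps)
  qed
  \<comment> \<open>The first three summands collect the contraction estimate: the \<phi> term, the
    double sum over the coefficients and the error of the parametrix. The last bracket bounds the
    image of 0.\<close>
  define K where "K = A * (2 + \<Lambda>) * J + n * (n * (A * (2 + \<Lambda>) * J * H + 2 * (A * (2 + \<Lambda>) * J) * C + 2 * (2 * (A * \<Lambda>)) * C))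
    + 2 * C + (2 * (A * \<Lambda>) + n * (n * (2 * (A * \<Lambda>) * H)))"
  have "0 \<le> A * (2 + \<Lambda>) * J + n * (n * (A * (2 + \<Lambda>) * J * H + 2 * (A * (2 + \<Lambda>) * J) * C + 2 * (2 * (A * \<Lambda>)) * C))"
    and Y: "0 \<le> 2 * (A * \<Lambda>) + n * (n * (2 * (A * \<Lambda>) * H))"
    using A pos' nm H(1) C by (intro add_nonneg_nonneg mult_nonneg_nonneg; simp)+
  then have K1: "2 * (A * \<Lambda>) + n * (n * (2 * (A * \<Lambda>) * H)) \<le> K" and K0: "K > 0"
    unfolding K_def using C by linarith+
  \<comment> \<open>1/2 ensures |x - y| \<le> 1 on the ball, as the error estimate demands; \<rho> /
    \<Lambda> keeps the jets where a and \<phi> are controlled; the last entry makes K R^{1 -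
    \<alpha>} \<le> 1/2.\<close>
  define R where "R = min (1/2) (min (\<rho> / \<Lambda>) ((1 / (2 * K)) powr (1 / (1 - \<alpha>))))"
  have R: "0 < R" "R \<le> 1/2" "R \<le> 1" "\<Lambda> * R \<le> \<rho>"
  proof -
    show "0 < R" using \<rho> pos' K0 by (auto simp: R_def)
    show "R \<le> 1/2" unfolding R_def by (rule min.cobounded1)
    then show "R \<le> 1" by simp
    have "R \<le> \<rho> / \<Lambda>" by (simp add: R_def)
    then show "\<Lambda> * R \<le> \<rho>" using pos' by (simp add: field_simps)
  qed
  define \<epsilon> where "\<epsilon> = R powr (1 - \<alpha>)"
  have \<epsilon>: "\<epsilon> \<ge> 0" "K * \<epsilon> \<le> 1/2"
  proof -
    have "\<epsilon> \<le> ((1 / (2 * K)) powr (1 / (1 - \<alpha>))) powr (1 - \<alpha>)"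
      unfolding \<epsilon>_def using \<alpha> R by (intro powr_mono2) (auto simp: R_def)
    also have "\<dots> = 1 / (2 * K)" using \<alpha> K0 by (simp add: powr_powr)
    finally show "K * \<epsilon> \<le> 1/2" using K0 by (simp add: field_simps)
  qed (simp add: \<epsilon>_def)
  define E where "E f x = f (closest_point (cball 0 R) x)" for f :: "real^'n \<Rightarrow> real^'m" and x
  have Ef: "holder_const \<alpha> F UNIV (E f)" "admissible \<alpha> (E f)" if "holder_zero \<alpha> R F f" for f F
    using admissible_closest_point[OF that R(1,3) \<alpha>(1)] unfolding E_def[abs_def] by auto
  have Ediff: "E (\<lambda>x. f x - g x) = (\<lambda>x. E f x - E g x)" for f g by (simp add: E_def[abs_def])
  have Ein: "E f x = f x" if "x \<in> cball 0 R" for f x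
    using closest_point_self[OF that] by (simp add: E_def)
  define v where "v f = jet (N (E f)) (\<lambda>j. N1 j (E f))" for f
  have v2: "holder_zero \<alpha> R (C * F) (N2 i j (E f))" if "holder_zero \<alpha> R F f" for f F i j
    using hol[OF Ef(2)[OF that] Ef(1)[OF that], of i j] zero(3) unfolding holder_zero_def holder_const_def by auto
  have v0: "v f 0 = 0" for f by (simp add: v_def jet_def zero vec_eq_iff zero_prod_def)
  have vl: "norm (v f x - v f y) \<le> J * F * norm (x - y)"
    if f: "holder_zero \<alpha> R F f" and xy: "x \<in> cball 0 R" "y \<in> cball 0 R" for f F x y
  proof -
    have F: "F \<ge> 0" by (rule holder_zero_nonneg[OF f R(1)])
    have N2b: "norm (N2 i j (E f) x) \<le> C * F" if "x \<in> cball 0 R" for i j x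
      by (rule holder_zero_norm_le[OF v2[OF f] R(1,3) \<alpha>(1) that])
    have N1l: "norm (N1 j (E f) x - N1 j (E f) y) \<le> n * (C * F) * norm (x - y)"
      if "x \<in> cball 0 R" "y \<in> cball 0 R" for j x y
      unfolding n_def by (rule lipschitz_of_partials[OF dN1[OF Ef(2)[OF f]] N2b convex_cball that])
    have N1b: "norm (N1 j (E f) x) \<le> n * (C * F)" if "x \<in> cball 0 R" for j x
    proof -
      have "norm (N1 j (E f) x - N1 j (E f) 0) \<le> n * (C * F) * norm (x - 0)" using that R by (intro N1l) auto
      also have "\<dots> \<le> n * (C * F) * 1" using that R C F nm by (intro mult_left_mono) auto
      finally show ?thesis by (simp add: zero)
    qed
    have "norm (N (E f) x - N (E f) y) \<le> n * (n * (C * F)) * norm (x - y)"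
      using lipschitz_of_partials[OF dN[OF Ef(2)[OF f]] N1b convex_cball xy] by (simp add: n_def)
    moreover have "norm (N1 j (E f) x - N1 j (E f) y) \<le> n * (n * (C * F)) * norm (x - y)" for j
    proof (rule order_trans[OF N1l[OF xy] mult_right_mono])
      have "1 * (n * (C * F)) \<le> n * (n * (C * F))" using nm C F by (intro mult_right_mono) auto
      then show "n * (C * F) \<le> n * (n * (C * F))" by simp
    qed simp
    ultimately have "norm (v f x - v f y) \<le> n * (n * (C * F)) * (1 + m * n) * norm (x - y)"
      unfolding v_def n_def m_def by (rule norm_jet_diff_le)
    then show ?thesis by (simp add: J_def mult_ac)
  qed
  have vdiff: "v f x - v g x = v (\<lambda>x. f x - g x) x" if "holder_zero \<alpha> R F f" "holder_zero \<alpha> R G g" for f g F G x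
    using lin[OF Ef(2)[OF that(1)] Ef(2)[OF that(2)]]
    by (simp add: v_def jet_diff Ediff) (simp add: jet_def)
  define w where "w f x = w0 x + v f x" for f x
  have w0: "w f 0 = z0" for f
    by (simp add: w_def v0 w0_def jet_def z0 ub_def ub1_def cl_def vec_eq_iff)
  have wl: "norm (w f x - w f y) \<le> \<Lambda> * norm (x - y)"
    if f: "holder_zero \<alpha> R 1 f" and xy: "x \<in> cball 0 R" "y \<in> cball 0 R" for f x y
  proof -
    have "w f x - w f y = (w0 x - w0 y) + (v f x - v f y)" by (simp add: w_def)
    also have "norm \<dots> \<le> W0 * norm (x - y) + J * 1 * norm (x - y)"
      by (intro order_trans[OF norm_triangle_ineq] add_mono w0l vl f xy) (use xy R in auto)
    finally show ?thesis by (simp add: \<Lambda>_def algebra_simps)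
  qed
  have win: "w f x \<in> cball z0 \<rho>" if f: "holder_zero \<alpha> R 1 f" and x: "x \<in> cball 0 R" for f x
  proof -
    have "norm (w f x - w f 0) \<le> \<Lambda> * norm (x - 0)" using x R by (intro wl f) auto
    also have "\<dots> \<le> \<Lambda> * R" using x pos' by (intro mult_left_mono) auto
    finally show ?thesis using R(4) by (simp add: w0 dist_norm norm_minus_commute)
  qed
  define er where "er f x = E f x - (\<Sum>i\<in>UNIV. \<Sum>j\<in>UNIV. a i j z0 *\<^sub>R N2 i j (E f) x)" for f x
  \<comment> \<open>With u = ub + N (E f) and the sum of a(z0) h0 equal to \<phi>(z0), the system on
    the ball reads f = \<Phi> f. Values at z0 are subtracted so that every term vanishes at
    0.\<close>
  define \<Phi> where "\<Phi> f x = (\<phi> (w f x) - \<phi> z0)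
    - (\<Sum>i\<in>UNIV. \<Sum>j\<in>UNIV. (a i j (w f x) - a i j z0) *\<^sub>R (h0 i j + N2 i j (E f) x)) + er f x" for f x
  have ahz: "holder_zero \<alpha> R (2 * (A * \<Lambda>) * \<epsilon>) (\<lambda>x. a i j (w f x) - a i j z0)"
    if f: "holder_zero \<alpha> R 1 f" for f i j
    unfolding \<epsilon>_def
    using holder_zero_compose[where w = "w f", OF aC1 A \<alpha> R(1,3) pos'(4) win[OF f] w0 wl[OF f]] .
  have \<phi>hz: "holder_zero \<alpha> R (2 * (A * \<Lambda>) * \<epsilon>) (\<lambda>x. \<phi> (w f x) - \<phi> z0)"
    if f: "holder_zero \<alpha> R 1 f" for f
    unfolding \<epsilon>_def
    using holder_zero_compose[where w = "w f", OF \<phi>C1 A \<alpha> R(1,3) pos'(4) win[OF f] w0 wl[OF f]] .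
  have contr: "holder_zero \<alpha> R (D / 2) (\<lambda>x. \<Phi> f x - \<Phi> g x)"
    if f: "holder_zero \<alpha> R 1 f" and g: "holder_zero \<alpha> R 1 g" and fg: "holder_zero \<alpha> R D (\<lambda>x. f x - g x)" for f g D
  proof -
    have D: "D \<ge> 0" by (rule holder_zero_nonneg[OF fg R(1)])
    have wd: "norm ((w f x - w g x) - (w f y - w g y)) \<le> J * D * norm (x - y)" if "x \<in> cball 0 R" "y \<in> cball 0 R" for x y
    proof -
      have "w f x - w g x = v (\<lambda>x. f x - g x) x" for x using vdiff[OF f g] by (simp add: w_def)
      then show ?thesis using vl[OF fg that] by simp
    qed
    have JD: "J * D \<ge> 0" using pos' D by simp
    note cmp = holder_zero_compose_diff[where w = "w f" and w' = "w g", OF _ A \<alpha> R(1,3) pos'(4) win[OF f] w0 wl[OF f] win[OF g] w0 wl[OF g] wd JD, folded \<epsilon>_def]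
    have P1: "holder_zero \<alpha> R (A * (2 + \<Lambda>) * (J * D) * \<epsilon>) (\<lambda>x. \<phi> (w f x) - \<phi> (w g x))" by (rule cmp[OF \<phi>C1])
    have Pa: "holder_zero \<alpha> R (A * (2 + \<Lambda>) * (J * D) * \<epsilon>) (\<lambda>x. a i j (w f x) - a i j (w g x))" for i j by (rule cmp[OF aC1])
    \<comment> \<open>The difference falls on one factor at a time: a(w f) - a(w g) meets h0 and the
      Hessian of N (E f), while a(w g) - a(z0) meets the Hessian of N (E (f - g)).\<close>
    let ?P = "\<lambda>i j x. (a i j (w f x) - a i j (w g x)) *\<^sub>R h0 i j + (a i j (w f x) - a i j (w g x)) *\<^sub>R N2 i j (E f) x
        + (a i j (w g x) - a i j z0) *\<^sub>R N2 i j (E (\<lambda>x. f x - g x)) x"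
    let ?k = "A * (2 + \<Lambda>) * (J * D) * \<epsilon> * H + 2 * (A * (2 + \<Lambda>) * (J * D) * \<epsilon>) * (C * 1) + 2 * (2 * (A * \<Lambda>) * \<epsilon>) * (C * D)"
    have P2: "holder_zero \<alpha> R ?k (?P i j)" for i j
      by (intro holder_zero_add holder_zero_scaleR_const[OF Pa R(1) H(2)] holder_zero_scaleR[OF Pa v2[OF f] R(1,3) \<alpha>(1)]
          holder_zero_scaleR[OF ahz[OF g] v2[OF fg] R(1,3) \<alpha>(1)])
    have P2': "holder_zero \<alpha> R (n * (n * ?k)) (\<lambda>x. \<Sum>i\<in>UNIV. \<Sum>j\<in>UNIV. ?P i j x)"
      unfolding n_def by (intro holder_zero_sum P2 finite)
    have P3: "holder_zero \<alpha> R (2 * (C * D) * \<epsilon>) (er (\<lambda>x. f x - g x))"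
      unfolding \<epsilon>_def
    proof (rule holder_zero_of_lipschitz)
      show "er (\<lambda>x. f x - g x) 0 = 0"
        using holder_zeroD(1)[OF fg] R by (simp add: er_def zero Ein)
      fix x y :: "real^'n" assume xy: "x \<in> cball 0 R" "y \<in> cball 0 R"
      then have "norm (x - y) \<le> 1" using norm_triangle_ineq4[of x y] R by auto
      from err[OF Ef(2)[OF fg] Ef(1)[OF fg] this]
      show "norm (er (\<lambda>x. f x - g x) x - er (\<lambda>x. f x - g x) y) \<le> C * D * norm (x - y)"
        unfolding er_def by (metis (no_types, lifting) minus_diff_eq norm_minus_commute minus_diff_commute)
    qed (use C D \<alpha> in auto)
    have eq: "\<Phi> f x - \<Phi> g x = (\<phi> (w f x) - \<phi> (w g x)) - (\<Sum>i\<in>UNIV. \<Sum>j\<in>UNIV. ?P i j x) + er (\<lambda>x. f x - g x) x" for x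
    proof -
      note l = lin(3)[OF Ef(2)[OF f] Ef(2)[OF g]]
      have "er (\<lambda>x. f x - g x) x = er f x - er g x"
        by (simp add: er_def Ediff l scaleR_diff_right sum_subtractf)
      moreover have "(\<Sum>i\<in>UNIV. \<Sum>j\<in>UNIV. ?P i j x)
         = (\<Sum>i\<in>UNIV. \<Sum>j\<in>UNIV. (a i j (w f x) - a i j z0) *\<^sub>R (h0 i j + N2 i j (E f) x))
         - (\<Sum>i\<in>UNIV. \<Sum>j\<in>UNIV. (a i j (w g x) - a i j z0) *\<^sub>R (h0 i j + N2 i j (E g) x))"
        unfolding sum_subtractf[symmetric] by (intro sum.cong refl) (simp add: Ediff l algebra_simps)
      ultimately show ?thesis by (simp add: \<Phi>_def)
    qed
    have "holder_zero \<alpha> R (A * (2 + \<Lambda>) * (J * D) * \<epsilon> + n * (n * ?k) + 2 * (C * D) * \<epsilon>) (\<lambda>x. \<Phi> f x - \<Phi> g x)"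
      unfolding eq by (intro holder_zero_add holder_zero_diff P1 P2' P3)
    moreover have "A * (2 + \<Lambda>) * (J * D) * \<epsilon> + n * (n * ?k) + 2 * (C * D) * \<epsilon>
       = (K - (2 * (A * \<Lambda>) + n * (n * (2 * (A * \<Lambda>) * H)))) * \<epsilon> * D"
      unfolding K_def by (simp add: algebra_simps)
    moreover have "(K - (2 * (A * \<Lambda>) + n * (n * (2 * (A * \<Lambda>) * H)))) * \<epsilon> * D \<le> K * \<epsilon> * D"
      by (intro mult_right_mono iffD2[OF diff_le_eq] iffD2[OF le_add_same_cancel1 Y] \<epsilon>(1) D)
    moreover have "K * \<epsilon> * D \<le> 1/2 * D" using \<epsilon> D by (intro mult_right_mono) auto
    ultimately show ?thesis by (elim holder_zero_mono) linarith
  qed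
  have hz0: "holder_zero \<alpha> R 1 (\<lambda>_::real^'n. 0::real^'m)" by (rule holder_zero_mono[OF holder_zero_const0]) simp
  have start: "holder_zero \<alpha> R (1/2) (\<Phi> (\<lambda>_. 0))"
  proof -
    let ?z = "\<lambda>_::real^'n. 0::real^'m"
    have Ez: "E ?z = ?z" by (simp add: E_def[abs_def])
    \<comment> \<open>Linearity is available as a rule for differences, and 0 = 0 - 0.\<close>
    have Nz: "N2 i j ?z x = 0" for i j x
      using lin(3)[OF Ef(2)[OF hz0] Ef(2)[OF hz0], of i j x] by (simp add: Ez)
    have eq: "\<Phi> ?z x = (\<phi> (w ?z x) - \<phi> z0) - (\<Sum>i\<in>UNIV. \<Sum>j\<in>UNIV. (a i j (w ?z x) - a i j z0) *\<^sub>R h0 i j)" for x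
      by (simp add: \<Phi>_def er_def Ez Nz)
    have "holder_zero \<alpha> R (2 * (A * \<Lambda>) * \<epsilon> + n * (n * (2 * (A * \<Lambda>) * \<epsilon> * H))) (\<Phi> ?z)"
      unfolding eq[abs_def] n_def
      by (intro holder_zero_diff holder_zero_sum finite holder_zero_scaleR_const[OF ahz[OF hz0] R(1) H(2)] \<phi>hz[OF hz0])
    moreover have "2 * (A * \<Lambda>) * \<epsilon> + n * (n * (2 * (A * \<Lambda>) * \<epsilon> * H)) = (2 * (A * \<Lambda>) + n * (n * (2 * (A * \<Lambda>) * H))) * \<epsilon>"
      by (simp add: algebra_simps)
    moreover have "\<dots> \<le> K * \<epsilon>" using K1 \<epsilon> by (intro mult_right_mono) auto
    ultimately show ?thesis using \<epsilon>(2) by (elim holder_zero_mono) linarith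
  qed
  obtain f where f: "holder_zero \<alpha> R 1 f" and fixed: "\<And>x. x \<in> cball 0 R \<Longrightarrow> \<Phi> f x = f x"
    using holder_fixed_point[where \<Phi> = \<Phi>, OF R(1,3) \<alpha>(1) contr start] by blast
  define u where "u x = ub x + N (E f) x" for x
  define u1 where "u1 j x = ub1 j x + N1 j (E f) x" for j x
  define u2 where "u2 i j x = h0 i j + N2 i j (E f) x" for i j x
  have wu: "w f x = (x, u x, \<chi> k j. u1 j x $ k)" for x
    by (simp add: w_def w0_def v_def jet_def u_def u1_def vec_eq_iff)
  show thesis
  proof (rule that[of R u u1 u2 C])
    show "R > 0" by (rule R)
    show "(u has_derivative (\<lambda>e. \<Sum>j\<in>UNIV. e $ j *\<^sub>R u1 j x)) (at x)" for x
      using has_derivative_add[OF dub[of x] dN[OF Ef(2)[OF f], of x]]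
      by (simp add: u_def[abs_def] u1_def scaleR_add_right sum.distrib)
    show "(u1 j has_derivative (\<lambda>e. \<Sum>i\<in>UNIV. e $ i *\<^sub>R u2 i j x)) (at x)" for j x
      using has_derivative_add[OF dub1[of j x] dN1[OF Ef(2)[OF f], of j x]]
      by (simp add: u1_def[abs_def] u2_def scaleR_add_right sum.distrib)
    \<comment> \<open>The Hessian of \<open>ub\<close> is constant and f has seminorm at most 1, so
      C is the Hoelder constant.\<close>
    show "holder_const \<alpha> C (cball 0 R) (u2 i j)" for i j
      using v2[OF f, of i j] by (simp add: u2_def[abs_def] holder_zero_def holder_const_def)
    have "(0, u 0, \<chi> k j. u1 j 0 $ k) = (0, c0, c1)" using wu[of 0] w0 z0 by simp
    then show "u 0 = c0" "(\<chi> k j. u1 j 0 $ k) = c1" by auto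
    fix x :: "real^'n" assume x: "x \<in> cball 0 R"
    show "(x, u x, \<chi> k j. u1 j x $ k) \<in> cball z0 \<rho>" using win[OF f x] by (simp only: wu)
    have "(\<Sum>i\<in>UNIV. \<Sum>j\<in>UNIV. a i j (w f x) *\<^sub>R u2 i j x) = \<phi> (w f x)"
    proof -
      have h: "(\<Sum>i\<in>UNIV. \<Sum>j\<in>UNIV. a i j z0 *\<^sub>R h0 i j) = \<phi>0"
      proof -
        have "(\<Sum>j\<in>UNIV. a i j z0 *\<^sub>R h0 i j) = (if i = i0 then \<phi>0 else 0)" for i
          using s by (auto simp: h0_def s_def if_distrib cong: if_cong)
        then show ?thesis by simp
      qed
      have "(\<phi> (w f x) - \<phi>0) - (\<Sum>i\<in>UNIV. \<Sum>j\<in>UNIV. (a i j (w f x) - a i j z0) *\<^sub>R u2 i j x)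
          - (\<Sum>i\<in>UNIV. \<Sum>j\<in>UNIV. a i j z0 *\<^sub>R N2 i j (E f) x) = 0"
        using fixed[OF x] Ein[OF x] by (simp add: \<Phi>_def er_def u2_def \<phi>0_def algebra_simps)
      moreover have "(\<Sum>i\<in>UNIV. \<Sum>j\<in>UNIV. (a i j (w f x) - a i j z0) *\<^sub>R u2 i j x)
          = (\<Sum>i\<in>UNIV. \<Sum>j\<in>UNIV. a i j (w f x) *\<^sub>R u2 i j x)
          - ((\<Sum>i\<in>UNIV. \<Sum>j\<in>UNIV. a i j z0 *\<^sub>R h0 i j) + (\<Sum>i\<in>UNIV. \<Sum>j\<in>UNIV. a i j z0 *\<^sub>R N2 i j (E f) x))"
        by (simp add: u2_def scaleR_diff_left scaleR_add_right sum_subtractf sum.distrib)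
      ultimately show ?thesis unfolding h by (simp add: algebra_simps)
    qed
    then show "(\<Sum>i\<in>UNIV. \<Sum>j\<in>UNIV. a i j (x, u x, \<chi> k j. u1 j x $ k) *\<^sub>R u2 i j x)
      = \<phi> (x, u x, \<chi> k j. u1 j x $ k)" by (simp only: wu)
  qed
qed

section \<open>Derivatives within a closed ball\<close>

text \<open>At a boundary point only directions into the ball are available. For the difference D of
  the two derivatives, restriction to the segment from x to y gives D (y - x) = 0 for every y in the
  ball; comparing y with 0 yields D y = 0, and every vector is a multiple of such a y.\<close>

lemma has_derivative_cball_unique:
  fixes g :: "'a::euclidean_space \<Rightarrow> 'b::real_normed_vector"
  assumes R: "R > 0" and x: "x \<in> cball 0 R"
    and d: "(g has_derivative g') (at x within cball 0 R)" "(g has_derivative g'') (at x within cball 0 R)"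
  shows "g' = g''"
proof -
  define D where "D h = g' h - g'' h" for h
  have dD: "((\<lambda>_. 0) has_derivative D) (at x within cball 0 R)"
    using has_derivative_diff[OF d] by (simp add: D_def[abs_def])
  then have lD: "linear D" by (rule has_derivative_linear)
  have zero: "D (y - x) = 0" if y: "y \<in> cball 0 R" for y
  proof -
    have seg: "(\<lambda>t. x + t *\<^sub>R (y - x)) ` {0..1} \<subseteq> cball 0 R"
    proof -
      have "x + t *\<^sub>R (y - x) \<in> cball 0 R" if "t \<in> {0..1}" for t
      proof -
        have "x + t *\<^sub>R (y - x) = (1 - t) *\<^sub>R x + t *\<^sub>R y" by (simp add: algebra_simps)
        then show ?thesis using convexD[OF convex_cball x y, of "1 - t" t] that by auto
      qed
      then show ?thesis by blast
    qed
    have "((\<lambda>t. x + t *\<^sub>R (y - x)) has_derivative (\<lambda>t. t *\<^sub>R (y - x))) (at 0 within {0..1})"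
      by (auto intro!: derivative_eq_intros)
    then have "((\<lambda>_. 0) has_derivative (\<lambda>t. D (t *\<^sub>R (y - x)))) (at (0::real) within {0..1})"
      by (rule has_derivative_in_compose[where g = "\<lambda>_. 0"])
        (use has_derivative_subset[OF dD seg] in simp)
    then have "((\<lambda>_. 0) has_vector_derivative D (y - x)) (at (0::real) within {0..1})"
      by (simp add: has_vector_derivative_def linear_scale[OF lD])
    moreover have "((\<lambda>_. 0) has_vector_derivative (0::'b)) (at (0::real) within {0..1})" by simp
    ultimately show ?thesis
      using vector_derivative_unique_within_closed_interval[of 0 1 0 "\<lambda>_. 0" "D (y - x)" 0] by simp
  qed
  have "D h = 0" for h
  proof (cases "h = 0")
    case False
    let ?y = "(R / norm h) *\<^sub>R h"
    have "?y \<in> cball 0 R" "0 \<in> cball (0::'a) R" using R False by auto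
    from zero[OF this(1)] zero[OF this(2)] have "D ?y = 0"
      using linear_diff[OF lD] linear_neg[OF lD] by simp
    then show ?thesis using R False by (simp add: linear_scale[OF lD])
  qed (use linear_0[OF lD] in simp)
  then show ?thesis by (auto simp: D_def fun_eq_iff)
qed

text \<open>\<open>frechet_derivative\<close> is chosen among the derivatives within the ball;
  uniqueness ties it to the one at hand.\<close>

lemma D1_cball_eq:
  assumes "R > 0" "x \<in> cball 0 R" "(g has_derivative g') (at x within cball 0 R)"
  shows "D1 (cball 0 R) k g x = g' (axis k 1)"
proof -
  have "(g has_derivative frechet_derivative g (at x within cball 0 R)) (at x within cball 0 R)"
    using assms(3) frechet_derivative_works differentiable_def by blast
  from has_derivative_cball_unique[OF assms(1,2) this assms(3)]
  show ?thesis by (simp add: D1_def partial_in_def)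
qed

theorem theorem1p1:
  fixes a :: "'n::finite \<Rightarrow> 'n \<Rightarrow> (real^'n) \<times> (real^'m::finite) \<times> (real^'n^'m) \<Rightarrow> real"
    and \<phi> :: "(real^'n) \<times> (real^'m) \<times> (real^'n^'m) \<Rightarrow> real^'m"
    and \<alpha> lam R0 R' :: real
    and c0 :: "real^'m" and c1 :: "real^'n^'m"
  assumes "CARD('n) \<ge> 2"
    and "0 < \<alpha>" and "\<alpha> < 1"
    and "\<And>i j. C1_holder_loc_on \<alpha> UNIV (a i j)"
    and "lam > 0"
    and "\<And>x p q \<xi>. (\<Sum>i\<in>UNIV. \<Sum>j\<in>UNIV. a i j (x, p, q) * \<xi> $ i * \<xi> $ j) \<ge> lam * (norm \<xi>)\<^sup>2"
    and "R0 > 0" and "R' > 0"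
    and "C1_holder_loc_on \<alpha> (cball 0 R0 \<times> cball 0 R' \<times> UNIV) \<phi>"
    and "c0 \<in> ball 0 R'"
  shows "\<exists>R1. 0 < R1 \<and> R1 \<le> R0 \<and>
    (\<forall>R. 0 < R \<and> R \<le> R1 \<longrightarrow>
      (\<exists>u :: real^'n \<Rightarrow> real^'m.
        C2_holder_on \<alpha> (cball 0 R) u \<and>
        (\<forall>x\<in>cball 0 R. u x \<in> cball 0 R') \<and>
        (\<forall>x\<in>cball 0 R. \<forall>k.
          (\<Sum>i\<in>UNIV. \<Sum>j\<in>UNIV.
             a i j (x, u x, Du (cball 0 R) u x) * D2 (cball 0 R) i j (\<lambda>y. u y $ k) x)
          = \<phi> (x, u x, Du (cball 0 R) u x) $ k) \<and>
        u 0 = c0 \<and> Du (cball 0 R) u 0 = c1))"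
proof -
  define z0 where "z0 = (0 :: real^'n, c0, c1)"
  define S where "S = cball (0 :: real^'n) R0 \<times> cball (0 :: real^'m) R' \<times> (UNIV :: (real^'n^'m) set)"
  \<comment> \<open>\<open>c0\<close> lies in the open ball, which gives u room to move inside
    B'_{R'}; the x slot is interior because R0 > 0.\<close>
  have "z0 \<in> interior S" unfolding S_def z0_def interior_Times using assms(7,10) by simp
  then obtain \<rho>p Ap where p: "\<rho>p > 0" "Ap \<ge> 0" "cball z0 \<rho>p \<subseteq> S" "C1_ball \<alpha> z0 \<rho>p Ap \<phi>"
    by (rule C1_holder_loc_on_imp_C1_ball[OF assms(9)[folded S_def] _ assms(2)])
  have "\<forall>i j. \<exists>\<rho> A. \<rho> > 0 \<and> A \<ge> 0 \<and> C1_ball \<alpha> z0 \<rho> A (a i j)"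
    by (intro allI, rule C1_holder_loc_on_imp_C1_ball[OF assms(4) _ assms(2), of z0]) auto
  then obtain \<rho>a Aa where a: "\<And>i j. \<rho>a i j > 0" "\<And>i j. Aa i j \<ge> (0::real)" "\<And>i j. C1_ball \<alpha> z0 (\<rho>a i j) (Aa i j) (a i j)"
    by metis
  \<comment> \<open>There are finitely many coefficients, so the smallest radius and, below, the sum
    of all constants serve them all.\<close>
  define \<rho> where "\<rho> = Min (insert \<rho>p (range (\<lambda>(i, j). \<rho>a i j)))"
  have \<rho>: "\<rho> > 0" unfolding \<rho>_def using p(1) a(1) by (subst Min_gr_iff) auto
  have \<rho>p: "\<rho> \<le> \<rho>p" unfolding \<rho>_def by (rule Min_le) auto
  have \<rho>a: "\<rho> \<le> \<rho>a i j" for i j unfolding \<rho>_def by (rule Min_le) (auto intro: image_eqI[of _ _ "(i, j)"])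
  define A where "A = Ap + (\<Sum>i\<in>UNIV. \<Sum>j\<in>UNIV. Aa i j)"
  have As: "0 \<le> (\<Sum>i\<in>UNIV. \<Sum>j\<in>UNIV. Aa i j)" by (intro sum_nonneg a(2))
  have Aa: "Aa i j \<le> A" for i j
  proof -
    have "Aa i j \<le> (\<Sum>j\<in>UNIV. Aa i j)" by (rule member_le_sum) (auto intro: a(2))
    also have "\<dots> \<le> (\<Sum>i\<in>UNIV. \<Sum>j\<in>UNIV. Aa i j)"
      by (rule member_le_sum[of i UNIV "\<lambda>i. \<Sum>j\<in>UNIV. Aa i j"]) (auto intro: sum_nonneg a(2))
    finally show ?thesis using p(2) by (simp add: A_def)
  qed
  have A: "A \<ge> 0" "Ap \<le> A" using p(2) As by (auto simp: A_def)
  have ell: "(\<Sum>i\<in>UNIV. \<Sum>j\<in>UNIV. a i j z0 * \<xi> $ i * \<xi> $ j) \<ge> lam * (norm \<xi>)\<^sup>2" for \<xi>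
    unfolding z0_def by (rule assms(6))
  show ?thesis
  proof (rule local_solution[OF z0_def assms(5) ell assms(2,3) A(1) \<rho> C1_ball_mono[OF a(3) \<rho>a Aa] C1_ball_mono[OF p(4) \<rho>p A(2)]])
    fix R K u u1 u2
    assume R: "R > 0" and
      du: "\<And>x. (u has_derivative (\<lambda>e. \<Sum>j\<in>UNIV. e $ j *\<^sub>R u1 j x)) (at x)" and
      du1: "\<And>j x. (u1 j has_derivative (\<lambda>e. \<Sum>i\<in>UNIV. e $ i *\<^sub>R u2 i j x)) (at x)" and
      u2: "\<And>i j. holder_const \<alpha> K (cball 0 R) (u2 i j)" and
      u0: "u 0 = c0" "(\<chi> k j. u1 j 0 $ k) = c1" and
      in_ball: "\<And>x. x \<in> cball 0 R \<Longrightarrow> (x, u x, \<chi> k j. u1 j x $ k) \<in> cball z0 \<rho>" and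
      eqn: "\<And>x. x \<in> cball 0 R \<Longrightarrow> (\<Sum>i\<in>UNIV. \<Sum>j\<in>UNIV. a i j (x, u x, \<chi> k j. u1 j x $ k) *\<^sub>R u2 i j x)
        = \<phi> (x, u x, \<chi> k j. u1 j x $ k)"
    show ?thesis
    \<comment> \<open>One u serves every radius r up to this bound: only the domain of the
      derivatives shrinks.\<close>
    proof (intro exI[of _ "min R R0"] conjI allI impI exI[of _ u] ballI)
      show "0 < min R R0" "min R R0 \<le> R0" using R assms(7) by auto
      fix r assume r: "0 < r \<and> r \<le> min R R0"
      then have sub: "x \<in> cball 0 R" if "x \<in> cball 0 r" for x :: "real^'n" using that by auto
      have nth: "((\<lambda>y. g y $ l) has_derivative (\<lambda>e. \<Sum>j\<in>UNIV. e $ j * T j $ l)) (at x within cball 0 r)"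
        if "(g has_derivative (\<lambda>e. \<Sum>j\<in>UNIV. e $ j *\<^sub>R T j)) (at x)" for g :: "real^'n \<Rightarrow> real^'m" and T l x
        using bounded_linear.has_derivative[OF bounded_linear_vec_nth has_derivative_at_withinI[OF that], of l "cball 0 r"] by simp
      have axis: "(\<Sum>j\<in>UNIV. (axis k 1 :: real^'n) $ j * T j) = T k" for k and T :: "'n \<Rightarrow> real"
        by (simp add: axis_def if_distribR if_distrib cong: if_cong)
      \<comment> \<open>u is differentiable on the whole space, so its derivative within the smaller
        ball is the ordinary one, boundary points included.\<close>
      have d1: "D1 (cball 0 r) k (\<lambda>y. u y $ l) x = u1 k x $ l" if "x \<in> cball 0 r" for x k l
        using D1_cball_eq[OF conjunct1[OF r] that nth[OF du]] by (simp only: axis)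
      have dd1: "(D1 (cball 0 r) j (\<lambda>y. u y $ l) has_derivative (\<lambda>e. \<Sum>i\<in>UNIV. e $ i * u2 i j x $ l)) (at x within cball 0 r)"
        if x: "x \<in> cball 0 r" for x j l
        by (rule has_derivative_transform[OF x d1 nth[OF du1]])
      have d2: "D2 (cball 0 r) i j (\<lambda>y. u y $ l) x = u2 i j x $ l" if "x \<in> cball 0 r" for x i j l
        unfolding D2_def using D1_cball_eq[OF conjunct1[OF r] that dd1[OF that]] by (simp only: axis)
      have Du: "Du (cball 0 r) u x = (\<chi> k j. u1 j x $ k)" if "x \<in> cball 0 r" for x
        by (simp add: Du_def d1[OF that])
      show "C2_holder_on \<alpha> (cball 0 r) u" unfolding C2_holder_on_def
      proof (intro allI conjI)
        show "(\<lambda>y. u y $ l) differentiable_on cball 0 r" for l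
          unfolding differentiable_on_def differentiable_def using nth[OF du] by blast
        show "D1 (cball 0 r) j (\<lambda>y. u y $ l) differentiable_on cball 0 r" for l j
          unfolding differentiable_on_def differentiable_def using dd1 by blast
        show "holder_on \<alpha> (cball 0 r) (D2 (cball 0 r) i j (\<lambda>y. u y $ l))" for l i j
          unfolding holder_on_def
        proof (intro exI[of _ K] ballI)
          fix x y :: "real^'n" assume xy: "x \<in> cball 0 r" "y \<in> cball 0 r"
          have "\<bar>(u2 i j x - u2 i j y) $ l\<bar> \<le> norm (u2 i j x - u2 i j y)" by (rule component_le_norm_cart)
          also have "\<dots> \<le> K * norm (x - y) powr \<alpha>" by (rule holder_constD[OF u2 sub[OF xy(1)] sub[OF xy(2)]])
          finally show "dist (D2 (cball 0 r) i j (\<lambda>y. u y $ l) x) (D2 (cball 0 r) i j (\<lambda>y. u y $ l) y) \<le> K * dist x y powr \<alpha>"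
            unfolding d2[OF xy(1)] d2[OF xy(2)] by (simp add: dist_norm)
        qed
      qed
      have zero: "0 \<in> cball (0::real^'n) r" using r by simp
      show "u 0 = c0" "Du (cball 0 r) u 0 = c1" unfolding Du[OF zero] by (fact u0)+
      fix x :: "real^'n" assume x: "x \<in> cball 0 r"
      \<comment> \<open>The jet stays in the domain of \<phi>, whose middle factor is
        B'_{R'}.\<close>
      have "(x, u x, \<chi> k j. u1 j x $ k) \<in> S"
        using in_ball[OF sub[OF x]] p(3) \<rho>p subset_cball[OF \<rho>p] by blast
      then show "u x \<in> cball 0 R'" by (simp add: S_def)
      show "(\<Sum>i\<in>UNIV. \<Sum>j\<in>UNIV. a i j (x, u x, Du (cball 0 r) u x) * D2 (cball 0 r) i j (\<lambda>y. u y $ k) x)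
            = \<phi> (x, u x, Du (cball 0 r) u x) $ k" for k
        using arg_cong[OF eqn[OF sub[OF x]], of "\<lambda>v. v $ k"] by (simp add: Du[OF x] d2[OF x])
    qed
  qed
qed

end
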